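(* For $\vec{x}=(a,b,c,d,e,f,g)^T\in V$, $$A(1-a,e-a,f-a,g-a)\,A(1+a-f,1+b-f,1+c-f,1+d-f)\,B_4(e-a,e-b,e-c,e-d,1+e-f,e,1+e-g)\,K_{p_0}(\vec{x})$$ $$-\,A(g-a,g-b,g-c,g-d)\,A(a,1+a-e,1+a-f,1+a-g)\,B_4(a,b,c,d,g,f,e)\,K_{n_4}(\vec{x})$$ $$-\,A(a,b,c,d)\,A(e-a,e-b,e-c,e-d)\,B_2(\vec{x})\,L_{\overline{4}}(\vec{x})=0.$$
   Context: $V=\{(a,b,c,d,e,f,g)^T\in\mathbb{C}^7: e+f+g-a-b-c-d=1\}$. ${}_4F_3\left[\begin{smallmatrix}a,b,c,d\\ e,f,g\end{smallmatrix};1\right]=\sum_{n\ge0}\frac{(a)_n(b)_n(c)_n(d)_n}{n!(e)_n(f)_n(g)_n}$, with $(a)_n$ the rising factorial. For $(a,b,c,d,e,f,g)^T\in V$, $$K(a;b,c,d;e,f,g)=\frac{{}_4F_3\left[\begin{smallmatrix}a,b,c,d\\ e,f,g\end{smallmatrix};1\right]}{\sin\pi a\,\Gamma(a)\Gamma(1+a-e)\Gamma(1+a-f)\Gamma(1+a-g)\Gamma(e)\Gamma(f)\Gamma(g)}+\frac{{}_4F_3\left[\begin{smallmatrix}a,1+a-e,1+a-f,1+a-g\\ 1+a-b,1+a-c,1+a-d\end{smallmatrix};1\right]}{\sin\pi a\,\Gamma(a)\Gamma(b)\Gamma(c)\Gamma(d)\Gamma(1+a-b)\Gamma(1+a-c)\Gamma(1+a-d)},$$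 $$L(a,b,c,d;e;f,g)=\frac{{}_4F_3\left[\begin{smallmatrix}a,b,c,d\\ e,f,g\end{smallmatrix};1\right]}{\sin\pi e\,\Gamma(1+a-e)\Gamma(1+b-e)\Gamma(1+c-e)\Gamma(1+d-e)\Gamma(e)\Gamma(f)\Gamma(g)}-\frac{{}_4F_3\left[\begin{smallmatrix}1+a-e,1+b-e,1+c-e,1+d-e\\ 2-e,1+f-e,1+g-e\end{smallmatrix};1\right]}{\sin\pi e\,\Gamma(a)\Gamma(b)\Gamma(c)\Gamma(d)\Gamma(2-e)\Gamma(1+f-e)\Gamma(1+g-e)}.$$ Notation: $S(a_1,\dots,a_n)=\sin\pi a_1\cdots\sin\pi a_n$; $A(x,y,z,w)=\frac{1}{\Gamma(x)\Gamma(y)\Gamma(z)\Gamma(w)}$ (with $1/\Gamma=0$ at nonpositive integers). The relation is asserted for those $\vec{x}\in V$ at which the $K$ and $L$ functions occurring are defined (no lower parameter of an occurring series is a nonpositive integer, no sine in an occurring denominator vanishes). Here $K_{p_0}(\vec{x})=K(a;b,c,d;e,f,g)$, $K_{n_4}(\vec{x})=K(e-a;e-b,e-c,e-d;1+e-f,1+e-g,e)$, $L_{\overline{4}}(\vec{x})=L(1-a,1-b,1-c,1-d;2-g;2-f,2-e)$, and, as functions of the seven coordinates of a point of $V$, $B_2(\vec{x})=\pi^{-4}S(f-a,g-a)\,[S(b-a,c-a,d-a)+S(e-2a,f-a,g-a)]$, $B_4(a,b,c,d,e,f,g)=\pi^{-4}S(f-a,g-a)\,[S(b,c,d)+S(e-a,f,g)]$.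 *)

theory Defs
  imports "HOL-Analysis.Analysis"
begin

text \<open>
  Points of the affine hyperplane \<open>V\<close> in \<open>\<complex>\<^sup>7\<close> are encoded as 7-tuples; functions on \<open>V\<close> take the
  seven coordinates as separate arguments, in the order \<open>a b c d e f g\<close>. The separators in the
  usual notations \<open>K(a;b,c,d;e,f,g)\<close> and \<open>L(a,b,c,d;e;f,g)\<close> only indicate symmetries.
  Throughout, \<open>1/\<Gamma>\<close> is the entire function \<^const>\<open>rGamma\<close>, which vanishes at the
  nonpositive integers.
\<close>

definition V :: "(complex \<times> complex \<times> complex \<times> complex \<times> complex \<times> complex \<times> complex) set" where
  "V = {(a, b, c, d, e, f, g). e + f + g - a - b - c - d = 1}"

text \<open>
  The series at unit argument. It converges if no lower parameter is a nonpositive integer and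
  the real part of (sum of lower) minus (sum of upper parameters) is positive; for all series
  used below, this difference is 1 on \<open>V\<close>.
\<close>

definition hyp4F3 ::
  "complex \<Rightarrow> complex \<Rightarrow> complex \<Rightarrow> complex \<Rightarrow> complex \<Rightarrow> complex \<Rightarrow> complex \<Rightarrow> complex" where
  "hyp4F3 a b c d e f g =
     (\<Sum>n. pochhammer a n * pochhammer b n * pochhammer c n * pochhammer d n /
          (fact n * pochhammer e n * pochhammer f n * pochhammer g n))"

definition sinpi :: "complex \<Rightarrow> complex" where
  "sinpi z = sin (of_real pi * z)"

definition Sinprod :: "complex list \<Rightarrow> complex" where
  "Sinprod zs = prod_list (map sinpi zs)"

definition A4 :: "complex \<Rightarrow> complex \<Rightarrow> complex \<Rightarrow> complex \<Rightarrow> complex" where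
  "A4 x y z w = rGamma x * rGamma y * rGamma z * rGamma w"

definition K_fun ::
  "complex \<Rightarrow> complex \<Rightarrow> complex \<Rightarrow> complex \<Rightarrow> complex \<Rightarrow> complex \<Rightarrow> complex \<Rightarrow> complex" where
  "K_fun a b c d e f g =
     hyp4F3 a b c d e f g / sinpi a *
       (rGamma a * rGamma (1 + a - e) * rGamma (1 + a - f) * rGamma (1 + a - g) *
        rGamma e * rGamma f * rGamma g)
   + hyp4F3 a (1 + a - e) (1 + a - f) (1 + a - g) (1 + a - b) (1 + a - c) (1 + a - d) / sinpi a *
       (rGamma a * rGamma b * rGamma c * rGamma d *
        rGamma (1 + a - b) * rGamma (1 + a - c) * rGamma (1 + a - d))"

definition K_defined ::
  "complex \<Rightarrow> complex \<Rightarrow> complex \<Rightarrow> complex \<Rightarrow> complex \<Rightarrow> complex \<Rightarrow> complex \<Rightarrow> bool" where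
  "K_defined a b c d e f g \<longleftrightarrow>
     sinpi a \<noteq> 0 \<and>
     e \<notin> \<int>\<^sub>\<le>\<^sub>0 \<and> f \<notin> \<int>\<^sub>\<le>\<^sub>0 \<and> g \<notin> \<int>\<^sub>\<le>\<^sub>0 \<and>
     1 + a - b \<notin> \<int>\<^sub>\<le>\<^sub>0 \<and> 1 + a - c \<notin> \<int>\<^sub>\<le>\<^sub>0 \<and> 1 + a - d \<notin> \<int>\<^sub>\<le>\<^sub>0"

definition L_fun ::
  "complex \<Rightarrow> complex \<Rightarrow> complex \<Rightarrow> complex \<Rightarrow> complex \<Rightarrow> complex \<Rightarrow> complex \<Rightarrow> complex" where
  "L_fun a b c d e f g =
     hyp4F3 a b c d e f g / sinpi e *
       (rGamma (1 + a - e) * rGamma (1 + b - e) * rGamma (1 + c - e) * rGamma (1 + d - e) *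
        rGamma e * rGamma f * rGamma g)
   - hyp4F3 (1 + a - e) (1 + b - e) (1 + c - e) (1 + d - e) (2 - e) (1 + f - e) (1 + g - e) / sinpi e *
       (rGamma a * rGamma b * rGamma c * rGamma d *
        rGamma (2 - e) * rGamma (1 + f - e) * rGamma (1 + g - e))"

definition L_defined ::
  "complex \<Rightarrow> complex \<Rightarrow> complex \<Rightarrow> complex \<Rightarrow> complex \<Rightarrow> complex \<Rightarrow> complex \<Rightarrow> bool" where
  "L_defined a b c d e f g \<longleftrightarrow>
     sinpi e \<noteq> 0 \<and>
     e \<notin> \<int>\<^sub>\<le>\<^sub>0 \<and> f \<notin> \<int>\<^sub>\<le>\<^sub>0 \<and> g \<notin> \<int>\<^sub>\<le>\<^sub>0 \<and>
     2 - e \<notin> \<int>\<^sub>\<le>\<^sub>0 \<and> 1 + f - e \<notin> \<int>\<^sub>\<le>\<^sub>0 \<and> 1 + g - e \<notin> \<int>\<^sub>\<le>\<^sub>0"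

definition B2 ::
  "complex \<Rightarrow> complex \<Rightarrow> complex \<Rightarrow> complex \<Rightarrow> complex \<Rightarrow> complex \<Rightarrow> complex \<Rightarrow> complex" where
  "B2 a b c d e f g =
     1 / of_real pi ^ 4 * Sinprod [f - a, g - a] *
     (Sinprod [b - a, c - a, d - a] + Sinprod [e - 2 * a, f - a, g - a])"

definition B4 ::
  "complex \<Rightarrow> complex \<Rightarrow> complex \<Rightarrow> complex \<Rightarrow> complex \<Rightarrow> complex \<Rightarrow> complex \<Rightarrow> complex" where
  "B4 a b c d e f g =
     1 / of_real pi ^ 4 * Sinprod [f - a, g - a] *
     (Sinprod [b, c, d] + Sinprod [e - a, f, g])"

end

(*
  Write U_i for the sum of
    u(t) = Gamma(a+t) Gamma(b+t) Gamma(c+t) Gamma(d+t) / (Gamma(1+t) Gamma(e+t) Gamma(f+t) Gamma(g+t))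
  over t = 1 - x, 2 - x, 3 - x, ..., where x = x_i is one of 1, e, f, g.
  Up to Gamma factors, L is a difference U_i - U_j, and K is U_i + D, where D sums the reflected
  terms over t in -a - {0, 1, ...}.

  Two facts generate all relations that are needed.
  (1) Expanding Gamma(c+t) Gamma(d+t) / (Gamma(f+t) Gamma(g+t)) by the nonterminating Saalschuetz theorem
      and exchanging the order of summation, the sum over t is again a nonterminating Saalschuetz sum;
      this is a two-term transformation of L. Applied twice, it gives
      L(a,b,c,d;e;f,g) = L(f-a,f-b,f-c,f-d;1+f-g;f,1+f-e).
  (2) The residues of Gamma(a+t) Gamma(-t) Gamma(1-e-t) Gamma(1-f-t) /
      (Gamma(1-b-t) Gamma(1-c-t) Gamma(1-d-t) Gamma(g+t)) add up to 0. This expresses K as a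
      combination of two L functions.

  Applying (2) to both K functions and identifying the L functions by (1) leaves a trigonometric
  identity. The convergence conditions in (1) and (2) hold on an open set of parameters; the relation
  extends to all parameters since, after multiplication by the sines, it is an identity between
  entire functions.
*)

theory Submission
  imports Defs "HOL-Complex_Analysis.Complex_Analysis"
begin

section \<open>Growth of the Gamma function\<close>

text \<open>No contour integral occurs. A Gamma quotient is truncated to a rational function, whose
  residues add up to a leading coefficient, and dominated convergence removes the truncation.
  Gauss's and Saalschuetz's sums come from contiguous relations, iterated to a limit that is known.
  Two windows for real parts result. \<open>0 < Re (e - a - b) <= 1\<close>: the Gauss series
  reached in the limit must converge, and the rescaled terms must be dominated.
  \<open>0 <= Re (g - a) <= 1\<close>: the weights left by the truncation must have a majorant that
  is linear in N. The base point of the continuation is one where all required instances of these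
  windows hold together. After identification, the expansions of the two K functions contain the
  same two L functions. Each \<open>B4\<close> is the coefficient of the L function that gets
  eliminated, and \<open>B2\<close> is what the elimination leaves. The continuation needs functions
  entire in the parameters, so lower parameters enter through \<open>rGamma\<close>, and the bounds
  for \<open>pochhammer\<close> and \<open>rGamma\<close> are uniform for bounded arguments.\<close>

abbreviation nonpole :: "complex \<Rightarrow> bool" where "nonpole z \<equiv> z \<notin> \<int>\<^sub>\<le>\<^sub>0"

text \<open>Squaring turns the claim into 1 + x <= exp x. It is applied to w = z / k, where the
  quadratic error is summable over k; this is what keeps the later constants independent of
  n.\<close>

lemma norm_one_plus_le: "norm (1 + w) \<le> exp (Re w + (norm w)\<^sup>2 / 2)" for w :: complex
proof -
  have "(norm (1 + w))\<^sup>2 = 1 + (2 * Re w + (norm w)\<^sup>2)"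
    unfolding cmod_power2 by (simp add: power2_eq_square algebra_simps)
  also have "\<dots> \<le> exp (2 * Re w + (norm w)\<^sup>2)"
    by (rule exp_ge_add_one_self)
  also have "\<dots> = (exp (Re w + (norm w)\<^sup>2 / 2))\<^sup>2"
    by (simp add: power2_eq_square flip: exp_add)
  finally show ?thesis
    by (rule power2_le_imp_le) simp
qed

text \<open>Since (1 - w) (1 + w) = 1 - w^2 has norm at least 1 - |w|^2, an upper bound for 1 - w
  yields one for the inverse of 1 + w. The restriction on \<open>w\<close> keeps 1 - |w|^2 away from
  0.\<close>

lemma inverse_norm_one_plus_le:
  fixes w :: complex
  assumes "norm w \<le> 1/2"
  shows "1 / norm (1 + w) \<le> exp (- Re w + 3 * (norm w)\<^sup>2)"
proof -
  define q where "q = (norm w)\<^sup>2"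
  have "q \<le> (1/2)\<^sup>2"
    unfolding q_def by (rule power_mono) (use assms in auto)
  hence q: "0 \<le> q" "q \<le> 1/2" by (auto simp: q_def power2_eq_square)
  have "1 = 1 - q + q" by simp
  have w: "1 - q > 0" using q by simp
  have "1 - q \<le> norm (1 - w\<^sup>2)"
    unfolding q_def using norm_triangle_ineq2[of 1 "w\<^sup>2"] by (simp add: norm_power)
  also have "1 - w\<^sup>2 = (1 + (-w)) * (1 + w)" by (simp add: power2_eq_square algebra_simps)
  finally have *: "1 - q \<le> norm (1 + (-w)) * norm (1 + w)" by (simp add: norm_mult)
  have nz: "norm (1 + w) > 0" using * w by auto
  have "1 / norm (1 + w) \<le> norm (1 + (-w)) * (1 / (1 - q))"
    using * w nz by (simp add: field_simps)
  also have "\<dots> \<le> exp (- Re w + q / 2) * exp (2 * q)"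
  proof (rule mult_mono)
    have "q * q \<le> 1 / 2 * q" using q by (intro mult_right_mono) auto
    hence "1 / (1 - q) \<le> 1 + 2 * q" using q by (simp add: field_simps)
    also have "\<dots> \<le> exp (2 * q)" by (rule exp_ge_add_one_self)
    finally show "1 / (1 - q) \<le> exp (2 * q)" .
    show "norm (1 + (-w)) \<le> exp (- Re w + q / 2)"
      using norm_one_plus_le[of "-w"] by (simp add: q_def)
  qed (use w in auto)
  also have "\<dots> \<le> exp (- Re w + 3 * q)" using q by (simp flip: exp_add)
  finally show ?thesis by (simp add: q_def)
qed

lemma harm_minus_ln_bounds:
  "harm n - ln (real n + 1) \<in> {0..1}"
proof -
  \<comment> \<open>The summand \<open>- 1 / (real n + 1)\<close> strengthens the claim so that the
    induction step follows from ln x <= x - 1.\<close>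
  have "harm n \<le> ln (real n + 1) + 1 - 1 / (real n + 1)"
  proof (induction n)
    case 0 show ?case by (simp add: harm_def)
  next
    case (Suc n)
    have "ln ((real n + 1) / (real n + 2)) \<le> (real n + 1) / (real n + 2) - 1"
      by (intro ln_le_minus_one) auto
    also have "\<dots> = - (1 / (real n + 2))" by (simp add: field_simps)
    finally have "1 / (real n + 2) \<le> ln (real n + 2) - ln (real n + 1)"
      by (simp add: ln_div)
    with Suc show ?case by (simp add: harm_Suc inverse_eq_divide add_ac)
  qed
  moreover have "1 / (real n + 1) \<ge> 0" by simp
  ultimately show ?thesis
    using ln_le_harm[of n] unfolding atLeastAtMost_iff by linarith
qed

text \<open>The harmonic number and the logarithm differ by at most 1, and the factor exp |x| pays
  for this whatever the sign of \<open>x\<close>.\<close>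

lemma exp_harm_le: "exp (x * harm n) \<le> exp \<bar>x\<bar> * (real n + 1) powr x"
proof -
  have "x * (harm n - ln (real n + 1)) \<le> \<bar>x * (harm n - ln (real n + 1))\<bar>"
    by (rule abs_ge_self)
  also have "\<dots> \<le> \<bar>x\<bar> * 1"
    unfolding abs_mult using harm_minus_ln_bounds[of n] by (intro mult_left_mono) auto
  finally have "x * harm n \<le> \<bar>x\<bar> + x * ln (real n + 1)"
    unfolding right_diff_distrib by linarith
  hence "exp (x * harm n) \<le> exp (\<bar>x\<bar> + x * ln (real n + 1))" by simp
  thus ?thesis by (simp add: powr_def exp_add)
qed

text \<open>Turns the quadratic errors of the factors 1 + z / k into telescoping increments.\<close>

lemma half_inverse_square_le: "1 / k\<^sup>2 / 2 \<le> 1 / k - 1 / (k + 1)" if "k \<ge> 1" for k :: real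
proof -
  have "k * (k + 1) \<le> k * (2 * k)" using that by (intro mult_left_mono) auto
  hence "1 / (2 * k\<^sup>2) \<le> 1 / (k * (k + 1))"
    using that by (intro divide_left_mono) (auto simp: power2_eq_square)
  also have "\<dots> = 1 / k - 1 / (k + 1)"
    using that by (simp add: field_simps)
  finally show ?thesis by simp
qed

text \<open>Apart from the first factor, the symbol is a product of k (1 + z / k), hence of size m!
  exp (Re z * harm m) up to a telescoping error. The constant depends on \<open>M\<close> but not on
  \<open>z\<close>, as the Weierstrass test will require.\<close>

lemma pochhammer_bound:
  obtains C where "C > 0"
    "\<And>z n. norm (z::complex) \<le> M \<Longrightarrow> norm (pochhammer z n) \<le> C * fact n * (real n + 1) powr (Re z - 1)"
proof -
  define M' where "M' = max M 1"
  have M': "M' \<ge> 1" "M' \<ge> M" by (auto simp: M'_def)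
  define C where "C = 2 * M' * exp (2 * M'\<^sup>2 + 2 * M')"
  have "norm (pochhammer z n) \<le> C * fact n * (real n + 1) powr (Re z - 1)"
    if z: "norm (z::complex) \<le> M" for z n
  proof (cases n)
    case 0
    have "1 * 1 \<le> 2 * M' * exp (2 * M'\<^sup>2 + 2 * M')"
      by (rule mult_mono) (use M' in simp_all)
    thus ?thesis by (simp add: 0 C_def)
  next
    case (Suc m)
    have zM: "norm z \<le> M'" "\<bar>Re z\<bar> \<le> M'" using z M' abs_Re_le_cmod[of z] by auto
    \<comment> \<open>The factor \<open>2 - 1 / real (Suc m)\<close> grows by exactly 1/k - 1/(k +
      1) in the step with k = m + 1, and stays below 2.\<close>
    have *: "norm (pochhammer z (Suc m)) \<le> M' * fact m * exp (Re z * harm m + M'\<^sup>2 * (2 - 1 / real (Suc m)))"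
    proof (induction m)
      case 0
      have "1 * M' \<le> exp (M'\<^sup>2) * M'" using M' by (intro mult_right_mono) auto
      thus ?case using zM by (simp add: harm_def mult_ac)
    next
      case (Suc m)
      let ?k = "real (Suc m)"
      have "norm (z + of_nat (Suc m)) = norm (of_nat (Suc m) * (1 + z / of_nat (Suc m)))"
        by (simp add: distrib_left add.commute del: of_nat_Suc)
      also have "\<dots> = ?k * norm (1 + z / of_nat (Suc m))" by (simp add: norm_mult del: of_nat_Suc)
      also have "\<dots> \<le> ?k * exp (Re (z / of_nat (Suc m)) + (norm (z / of_nat (Suc m)))\<^sup>2 / 2)"
        by (intro mult_left_mono norm_one_plus_le) auto
      also have "Re (z / of_nat (Suc m)) = Re z / ?k"
        by (metis Re_divide_of_nat)
      also have "(norm (z / of_nat (Suc m)))\<^sup>2 = (norm z)\<^sup>2 / ?k\<^sup>2"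
        by (simp add: norm_divide power_divide del: of_nat_Suc)
      also have "?k * exp (Re z / ?k + (norm z)\<^sup>2 / ?k\<^sup>2 / 2) \<le> ?k * exp (Re z / ?k + M'\<^sup>2 * (1 / ?k - 1 / (?k + 1)))"
      proof -
        have "(norm z)\<^sup>2 \<le> M'\<^sup>2" using zM by (intro power_mono) auto
        moreover have "1 / ?k\<^sup>2 / 2 \<le> 1 / ?k - 1 / (?k + 1)"
          by (rule half_inverse_square_le) simp
        ultimately have "(norm z)\<^sup>2 * (1 / ?k\<^sup>2 / 2) \<le> M'\<^sup>2 * (1 / ?k - 1 / (?k + 1))"
          by (rule mult_mono) simp_all
        hence "Re z / ?k + (norm z)\<^sup>2 / ?k\<^sup>2 / 2 \<le> Re z / ?k + M'\<^sup>2 * (1 / ?k - 1 / (?k + 1))"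
          by (simp only: add_left_mono times_divide_eq_right mult_1_right)
        thus ?thesis by (intro mult_left_mono) (simp_all del: of_nat_Suc)
      qed
      finally have "norm (z + of_nat (Suc m)) \<le> ?k * exp (Re z / ?k + M'\<^sup>2 * (1 / ?k - 1 / (?k + 1)))" .
      hence "norm (pochhammer z (Suc m)) * norm (z + of_nat (Suc m)) \<le>
             (M' * fact m * exp (Re z * harm m + M'\<^sup>2 * (2 - 1 / ?k))) * (?k * exp (Re z / ?k + M'\<^sup>2 * (1 / ?k - 1 / (?k + 1))))"
        by (rule mult_mono[OF Suc.IH]) (use M' in simp_all)
      also have "\<dots> = M' * fact (Suc m) * exp ((Re z * harm m + M'\<^sup>2 * (2 - 1 / ?k)) + (Re z / ?k + M'\<^sup>2 * (1 / ?k - 1 / (?k + 1))))"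
        by (simp add: exp_add)
      also have "(Re z * harm m + M'\<^sup>2 * (2 - 1 / ?k)) + (Re z / ?k + M'\<^sup>2 * (1 / ?k - 1 / (?k + 1))) =
           Re z * harm (Suc m) + M'\<^sup>2 * (2 - 1 / real (Suc (Suc m)))"
        by (simp add: harm_Suc algebra_simps inverse_eq_divide)
      finally show ?case by (simp add: pochhammer_Suc[of z "Suc m"] norm_mult)
    qed
    have "exp (Re z * harm m + M'\<^sup>2 * (2 - 1 / real (Suc m))) \<le> exp (Re z * harm n + (M' + 2 * M'\<^sup>2))"
    proof -
      have "- Re z / real (Suc m) \<le> \<bar>Re z\<bar> / real (Suc m)" by (intro divide_right_mono) auto
      also have "\<dots> \<le> \<bar>Re z\<bar>" by (simp add: field_simps)
      also have "\<dots> \<le> M'" by (rule zM)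
      finally have "Re z * harm m \<le> Re z * harm n + M'"
        by (simp add: Suc harm_Suc algebra_simps inverse_eq_divide)
      moreover have "M'\<^sup>2 * (2 - 1 / real (Suc m)) \<le> M'\<^sup>2 * 2" by (intro mult_left_mono) auto
      ultimately show ?thesis by simp
    qed
    also have "\<dots> \<le> exp (M' + 2 * M'\<^sup>2) * (exp M' * (real n + 1) powr Re z)"
    proof -
      have "exp (Re z * harm n) \<le> exp \<bar>Re z\<bar> * (real n + 1) powr Re z" by (rule exp_harm_le)
      also have "\<dots> \<le> exp M' * (real n + 1) powr Re z" using zM by (intro mult_right_mono) auto
      finally show ?thesis by (simp add: exp_add mult_ac)
    qed
    also have "\<dots> = exp (2 * M'\<^sup>2 + 2 * M') * (real n + 1) powr Re z"
      unfolding mult.assoc[symmetric] exp_add[symmetric] by (simp add: add_ac)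
    finally have **: "exp (Re z * harm m + M'\<^sup>2 * (2 - 1 / real (Suc m))) \<le> exp (2 * M'\<^sup>2 + 2 * M') * (real n + 1) powr Re z" .
    have "(1 / 2 :: real) * (real n + 1) \<le> real n" using Suc by simp
    hence "fact m * ((1 / 2 :: real) * (real n + 1)) \<le> fact m * real n" by (intro mult_left_mono) auto
    also have "\<dots> = fact n" by (simp add: Suc)
    finally have f: "fact m \<le> 2 * (fact n * (1 / (real n + 1)))"
      by (simp add: divide_simps)
    have "norm (pochhammer z n) \<le> M' * fact m * exp (Re z * harm m + M'\<^sup>2 * (2 - 1 / real (Suc m)))"
      using * by (simp only: Suc)
    also have "\<dots> \<le> M' * fact m * (exp (2 * M'\<^sup>2 + 2 * M') * (real n + 1) powr Re z)"
      by (rule mult_left_mono[OF **]) (use M' in simp)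
    also have "\<dots> \<le> M' * (2 * (fact n * (1 / (real n + 1)))) * (exp (2 * M'\<^sup>2 + 2 * M') * (real n + 1) powr Re z)"
      by (rule mult_right_mono[OF mult_left_mono[OF f]]) (use M' in simp_all)
    also have "\<dots> = C * fact n * (real n + 1) powr (Re z - 1)"
      by (simp add: C_def powr_diff)
    finally show ?thesis .
  qed
  moreover have "C > 0" using M' by (simp add: C_def)
  ultimately show ?thesis using that by blast
qed

text \<open>Passing from z + n to z + n + 1 divides by z + n, which is bounded below in the required
  way once |z / n| <= 1/2. The finitely many earlier indices are covered by compactness. Again the
  constant is uniform in \<open>z\<close>.\<close>

lemma rGamma_bound:
  obtains C where "C > 0"
    "\<And>z n. norm (z::complex) \<le> M \<Longrightarrow> norm (rGamma (z + of_nat n)) \<le> C * (real n + 1) powr (1 - Re z) / fact n"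
proof -
  define M' where "M' = max M 1"
  have M': "M' \<ge> 1" "M' \<ge> M" by (auto simp: M'_def)
  \<comment> \<open>Beyond index \<open>K\<close>, |z / n| <= 1/2 holds for all |z| <= M'.\<close>
  define K where "K = nat \<lceil>2 * M'\<rceil>"
  have K: "real K \<ge> 2 * M'" unfolding K_def by linarith
  have "bounded (rGamma ` cball (0::complex) (M' + K + 1))"
    by (intro compact_imp_bounded compact_continuous_image continuous_intros) auto
  then obtain B where "\<forall>y \<in> rGamma ` cball (0::complex) (M' + K + 1). norm y \<le> B"
    by (auto simp: bounded_iff)
  hence B: "norm (rGamma w) \<le> B" if "norm w \<le> M' + K + 1" for w :: complex
    using that by auto
  define B' where "B' = max B 1"
  \<comment> \<open>Chosen such that D / K! * exp (- M' * harm K) is the compactness bound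
    \<open>B'\<close>; up to index \<open>K\<close> the claimed bound is then at least
    \<open>B'\<close>.\<close>
  define D where "D = B' * fact K * exp (M' * harm K)"
  have D: "D > 0" "B' \<ge> 1" by (auto simp: D_def B'_def)
  define C where "C = D * exp (2 * M' + 12 * M'\<^sup>2)"
  have C: "C > 0" using D by (simp add: C_def)
  have *: "norm (rGamma (z + of_nat (Suc m))) \<le> D / fact m * exp (- Re z * harm m + 6 * M'\<^sup>2 * (2 - 1 / real (Suc m)))"
    if z: "norm (z::complex) \<le> M'" for z m
  proof (induction m)
    case (Suc m)
    let ?n = "real (Suc m)"
    show ?case
    proof (cases "Suc m \<le> K")
      case True
      have "norm (z + of_nat (Suc (Suc m))) \<le> norm z + norm (of_nat (Suc (Suc m)) :: complex)"
        by (rule norm_triangle_ineq)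
      also have "\<dots> = norm z + real (Suc (Suc m))" by (simp only: norm_of_nat)
      also have "\<dots> \<le> M' + K + 1" using z True by simp
      finally have "norm (rGamma (z + of_nat (Suc (Suc m)))) \<le> B'" 
        using B unfolding B'_def by (meson max.coboundedI1)
      also have "\<dots> = D / fact K * exp (- M' * harm K)" by (simp add: D_def exp_minus)
      also have "\<dots> \<le> D / fact (Suc m) * exp (- Re z * harm (Suc m) + 6 * M'\<^sup>2 * (2 - 1 / real (Suc (Suc m))))"
      proof (rule mult_mono)
        show "D / fact K \<le> D / fact (Suc m)"
          using D True by (intro divide_left_mono fact_mono) auto
        have "Re z * harm (Suc m) \<le> \<bar>Re z\<bar> * harm (Suc m)" by (intro mult_right_mono harm_nonneg) auto
        also have "\<dots> \<le> M' * harm K"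
          using z abs_Re_le_cmod[of z] M' True by (intro mult_mono harm_mono harm_nonneg) auto
        finally have "Re z * harm (Suc m) \<le> M' * harm K" .
        moreover have "0 \<le> 6 * M'\<^sup>2 * (2 - 1 / real (Suc (Suc m)))" by (simp add: field_simps)
        ultimately show "exp (- M' * harm K) \<le> exp (- Re z * harm (Suc m) + 6 * M'\<^sup>2 * (2 - 1 / real (Suc (Suc m))))"
          by simp
      qed (use D in auto)
      finally show ?thesis .
    next
      case False
      hence nK: "?n \<ge> 2 * M'" using K by linarith
      have n0: "?n > 0" by simp
      define w where "w = z / of_nat (Suc m)"
      have nw: "norm w = norm z / ?n" by (simp only: w_def norm_divide norm_of_nat)
      have "norm w \<le> M' / ?n" unfolding nw using z by (intro divide_right_mono) auto
      also have "\<dots> \<le> 1 / 2" using nK n0 by (simp add: divide_simps del: of_nat_Suc)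
      finally have w: "norm w \<le> 1 / 2" .
      have eq: "z + of_nat (Suc m) = of_nat (Suc m) * (1 + w)"
        by (simp add: w_def distrib_left add.commute del: of_nat_Suc)
      have "1 + w \<noteq> 0"
      proof
        assume "1 + w = 0"
        hence "w = - 1" by (simp add: add_eq_0_iff)
        with w show False by simp
      qed
      hence nz: "z + of_nat (Suc m) \<noteq> 0" unfolding eq by (simp del: of_nat_Suc)
      have "rGamma (z + of_nat (Suc m)) = (z + of_nat (Suc m)) * rGamma (z + of_nat (Suc (Suc m)))"
        using rGamma_plus1[of "z + of_nat (Suc m)"] by (simp add: add_ac)
      hence "norm (rGamma (z + of_nat (Suc (Suc m)))) = norm (rGamma (z + of_nat (Suc m))) * (1 / norm (z + of_nat (Suc m)))"
        using nz by (simp only: norm_mult) (simp del: of_nat_Suc)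
      also have "1 / norm (z + of_nat (Suc m)) = 1 / ?n * (1 / norm (1 + w))"
        unfolding eq by (simp add: norm_mult del: of_nat_Suc)
      also have "norm (rGamma (z + of_nat (Suc m))) * \<dots> \<le> (D / fact m * exp (- Re z * harm m + 6 * M'\<^sup>2 * (2 - 1 / ?n))) * (1 / ?n * exp (- Re w + 3 * (norm w)\<^sup>2))"
        using D by (intro mult_mono Suc.IH mult_left_mono inverse_norm_one_plus_le w) auto
      also have "\<dots> \<le> (D / fact m * exp (- Re z * harm m + 6 * M'\<^sup>2 * (2 - 1 / ?n))) * (1 / ?n * exp (- Re z / ?n + 6 * M'\<^sup>2 * (1 / ?n - 1 / (?n + 1))))"
      proof -
        have "(norm w)\<^sup>2 / 2 = (norm z)\<^sup>2 * (1 / ?n\<^sup>2 / 2)" by (simp add: nw power_divide del: of_nat_Suc)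
        also have "\<dots> \<le> M'\<^sup>2 * (1 / ?n - 1 / (?n + 1))"
          using z by (intro mult_mono half_inverse_square_le power_mono) auto
        finally have "3 * (norm w)\<^sup>2 \<le> 6 * M'\<^sup>2 * (1 / ?n - 1 / (?n + 1))" by (simp add: mult_ac)
        moreover have "Re w = Re z / ?n" by (simp only: w_def Re_divide_of_nat)
        ultimately have "- Re w + 3 * (norm w)\<^sup>2 \<le> - Re z / ?n + 6 * M'\<^sup>2 * (1 / ?n - 1 / (?n + 1))"
          by simp
        hence le: "exp (- Re w + 3 * (norm w)\<^sup>2) \<le> exp (- Re z / ?n + 6 * M'\<^sup>2 * (1 / ?n - 1 / (?n + 1)))"
          by (simp only: exp_le_cancel_iff)
        show ?thesis by (intro mult_left_mono le) (use D in auto)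
      qed
      also have "\<dots> = D / fact (Suc m) * exp ((- Re z * harm m + 6 * M'\<^sup>2 * (2 - 1 / ?n)) + (- Re z / ?n + 6 * M'\<^sup>2 * (1 / ?n - 1 / (?n + 1))))"
        unfolding exp_add by (simp add: mult_ac)
      also have "(- Re z * harm m + 6 * M'\<^sup>2 * (2 - 1 / ?n)) + (- Re z / ?n + 6 * M'\<^sup>2 * (1 / ?n - 1 / (?n + 1))) =
           - Re z * harm (Suc m) + 6 * M'\<^sup>2 * (2 - 1 / real (Suc (Suc m)))"
        by (simp add: harm_Suc algebra_simps inverse_eq_divide)
      finally show ?thesis .
    qed
  next
    case 0
    have "norm (z + 1) \<le> norm z + 1" using norm_triangle_ineq[of z 1] by simp
    also have "\<dots> \<le> M' + K + 1" using z by simp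
    finally have "norm (rGamma (z + 1)) \<le> B'" 
      using B unfolding B'_def by (meson max.coboundedI1)
    also have "\<dots> = B' * 1 * 1" by simp
    also have "\<dots> \<le> D" unfolding D_def
      using D M' by (intro mult_mono) (auto simp: harm_nonneg fact_ge_1)
    also have "\<dots> \<le> D * exp (6 * M'\<^sup>2)" using D by simp
    finally show ?case by (simp add: harm_def)
  qed
  have "norm (rGamma (z + of_nat n)) \<le> C * (real n + 1) powr (1 - Re z) / fact n"
    if z: "norm (z::complex) \<le> M" for z n
  proof (cases n)
    case 0
    have "norm z \<le> M' + K + 1" using z M' by simp
    hence "norm (rGamma z) \<le> B'" 
      using B unfolding B'_def by (meson max.coboundedI1)
    also have "\<dots> = B' * 1 * 1" by simp
    also have "\<dots> \<le> D" unfolding D_def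
      using D M' by (intro mult_mono) (auto simp: harm_nonneg fact_ge_1)
    also have "\<dots> \<le> C" unfolding C_def using D M' by simp
    finally show ?thesis by (simp add: 0)
  next
    case (Suc m)
    have zM: "norm z \<le> M'" "\<bar>Re z\<bar> \<le> M'" using z M' abs_Re_le_cmod[of z] by auto
    have "exp (- Re z * harm m + 6 * M'\<^sup>2 * (2 - 1 / real (Suc m))) \<le> exp (- Re z * harm n + (M' + 12 * M'\<^sup>2))"
    proof -
      have "Re z / real (Suc m) \<le> \<bar>Re z\<bar> / real (Suc m)" by (intro divide_right_mono) auto
      also have "\<dots> \<le> \<bar>Re z\<bar>" by (simp add: field_simps)
      also have "\<dots> \<le> M'" by (rule zM)
      finally have "- Re z * harm m \<le> - Re z * harm n + M'"
        by (simp add: Suc harm_Suc algebra_simps inverse_eq_divide)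
      moreover have "6 * M'\<^sup>2 * (2 - 1 / real (Suc m)) \<le> 6 * M'\<^sup>2 * 2" by (intro mult_left_mono) auto
      ultimately show ?thesis by simp
    qed
    also have "\<dots> \<le> exp (M' + 12 * M'\<^sup>2) * (exp M' * (real n + 1) powr (- Re z))"
    proof -
      have "exp (- Re z * harm n) \<le> exp \<bar>- Re z\<bar> * (real n + 1) powr (- Re z)" by (rule exp_harm_le)
      also have "\<dots> \<le> exp M' * (real n + 1) powr (- Re z)" using zM by (intro mult_right_mono) auto
      finally show ?thesis
        unfolding exp_add[of "- Re z * harm n"] mult.commute[of "exp (- Re z * harm n)"]
        by (intro mult_left_mono) auto
    qed
    also have "\<dots> = exp (2 * M' + 12 * M'\<^sup>2) * (real n + 1) powr (- Re z)"
      unfolding mult.assoc[symmetric] exp_add[symmetric] by (simp add: add_ac)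
    finally have **: "exp (- Re z * harm m + 6 * M'\<^sup>2 * (2 - 1 / real (Suc m))) \<le> exp (2 * M' + 12 * M'\<^sup>2) * (real n + 1) powr (- Re z)" .
    have "1 / fact m = real n / fact n" by (simp add: Suc del: of_nat_Suc)
    also have "\<dots> \<le> (real n + 1) / fact n" by (intro divide_right_mono) auto
    finally have f: "1 / fact m \<le> (real n + 1) / fact n" .
    have "norm (rGamma (z + of_nat n)) \<le> D / fact m * exp (- Re z * harm m + 6 * M'\<^sup>2 * (2 - 1 / real (Suc m)))"
      using *[OF zM(1), of m] by (simp only: Suc)
    also have "\<dots> = D * (1 / fact m) * exp (- Re z * harm m + 6 * M'\<^sup>2 * (2 - 1 / real (Suc m)))" by simp
    also have "\<dots> \<le> D * ((real n + 1) / fact n) * (exp (2 * M' + 12 * M'\<^sup>2) * (real n + 1) powr (- Re z))"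
      by (rule mult_mono[OF mult_left_mono[OF f] **]) (use D in simp_all)
    also have "\<dots> = C * ((real n + 1) * (real n + 1) powr (- Re z)) / fact n"
      by (simp add: C_def)
    also have "(real n + 1) * (real n + 1) powr (- Re z) = (real n + 1) powr (1 - Re z)"
      by (simp add: powr_diff powr_minus field_simps)
    finally show ?thesis .
  qed
  thus ?thesis using C that by blast
qed

lemma Gamma_bound:
  fixes z :: complex
  assumes "nonpole z"
  obtains C where "C > 0" "\<And>n. norm (Gamma (z + of_nat n)) \<le> C * fact n * (real n + 1) powr (Re z - 1)"
proof -
  obtain C where C: "C > 0"
    "\<And>w n. norm (w::complex) \<le> norm z \<Longrightarrow> norm (pochhammer w n) \<le> C * fact n * (real n + 1) powr (Re w - 1)"
    using pochhammer_bound by metis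
  have nz: "Gamma z \<noteq> 0" using assms by (simp add: Gamma_eq_zero_iff)
  show ?thesis
  proof (rule that)
    show "norm (Gamma z) * C > 0" using nz C by simp
    fix n
    have "Gamma (z + of_nat n) = Gamma z * pochhammer z n"
      using pochhammer_Gamma[OF assms, of n] nz by simp
    thus "norm (Gamma (z + of_nat n)) \<le> norm (Gamma z) * C * fact n * (real n + 1) powr (Re z - 1)"
      using mult_left_mono[OF C(2)[of z n] norm_ge_zero[of "Gamma z"]] by (simp add: norm_mult mult_ac)
  qed
qed

section \<open>Power bounds and limits of Gamma quotients\<close>

definition powr_bounded :: "real \<Rightarrow> (nat \<Rightarrow> complex) \<Rightarrow> bool" where
  "powr_bounded p f \<longleftrightarrow> (\<exists>C>0. \<forall>n. norm (f n) \<le> C * (real n + 1) powr p)"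

lemma powr_bounded_mult:
  assumes "powr_bounded p f" "powr_bounded q g"
  shows "powr_bounded (p + q) (\<lambda>n. f n * g n)"
proof -
  obtain C where C: "C > 0" "\<And>n. norm (f n) \<le> C * (real n + 1) powr p"
    using assms(1) by (auto simp: powr_bounded_def)
  obtain D where D: "D > 0" "\<And>n. norm (g n) \<le> D * (real n + 1) powr q"
    using assms(2) by (auto simp: powr_bounded_def)
  have "norm (f n * g n) \<le> C * D * (real n + 1) powr (p + q)" for n
  proof -
    have "norm (f n * g n) \<le> (C * (real n + 1) powr p) * (D * (real n + 1) powr q)"
      unfolding norm_mult by (rule mult_mono[OF C(2) D(2)]) (use C in auto)
    thus ?thesis by (simp add: powr_add mult_ac)
  qed
  moreover have "C * D > 0" using C D by simp
  ultimately show ?thesis unfolding powr_bounded_def by blast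
qed

lemma powr_bounded_Gamma_ratio:
  fixes z w :: complex
  assumes "nonpole z"
  shows "powr_bounded (Re z - Re w) (\<lambda>n. Gamma (z + of_nat n) * rGamma (w + of_nat n))"
proof -
  obtain C where C: "C > 0" "\<And>n. norm (Gamma (z + of_nat n)) \<le> C * fact n * (real n + 1) powr (Re z - 1)"
    using Gamma_bound[OF assms] by metis
  obtain D where D: "D > 0"
    "\<And>v n. norm (v::complex) \<le> norm w \<Longrightarrow> norm (rGamma (v + of_nat n)) \<le> D * (real n + 1) powr (1 - Re v) / fact n"
    using rGamma_bound by metis
  have "norm (Gamma (z + of_nat n) * rGamma (w + of_nat n)) \<le> C * D * (real n + 1) powr (Re z - Re w)" for n
  proof -
    have "norm (Gamma (z + of_nat n) * rGamma (w + of_nat n)) \<le>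
        (C * fact n * (real n + 1) powr (Re z - 1)) * (D * (real n + 1) powr (1 - Re w) / fact n)"
      unfolding norm_mult by (intro mult_mono C D) (use C in auto)
    also have "\<dots> = C * D * ((real n + 1) powr (Re z - 1) * (real n + 1) powr (1 - Re w))" by simp
    also have "(real n + 1) powr (Re z - 1) * (real n + 1) powr (1 - Re w) = (real n + 1) powr (Re z - Re w)"
      by (simp flip: powr_add)
    finally show ?thesis .
  qed
  moreover have "C * D > 0" using C D by simp
  ultimately show ?thesis unfolding powr_bounded_def by blast
qed

lemma not_nonpos_Int_add_of_nat:
  assumes "nonpole z"
  shows "z + of_nat n \<notin> (\<int>\<^sub>\<le>\<^sub>0 :: complex set)"
proof
  assume "z + of_nat n \<in> \<int>\<^sub>\<le>\<^sub>0"
  then obtain m where "z + of_nat n = - of_nat m" by (elim nonpos_Ints_cases')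
  hence "z = - of_nat (m + n)" by (simp add: algebra_simps)
  hence "z \<in> \<int>\<^sub>\<le>\<^sub>0" by (simp only: minus_of_nat_in_nonpos_Ints)
  thus False using assms by simp
qed

lemma Gamma_asymp:
  fixes z :: complex
  assumes "nonpole z"
  shows "(\<lambda>n. Gamma (z + of_nat n) / (fact (n - 1) * exp (z * of_real (ln (real n))))) \<longlonglongrightarrow> 1"
proof -
  have nz: "Gamma z \<noteq> 0" using assms by (simp add: Gamma_eq_zero_iff)
  have "(\<lambda>n. Gamma z * inverse (Gamma_series' z n)) \<longlonglongrightarrow> Gamma z * inverse (Gamma z)"
    by (intro tendsto_intros Gamma_series'_LIMSEQ nz)
  moreover have "Gamma z * inverse (Gamma_series' z n) = Gamma (z + of_nat n) / (fact (n - 1) * exp (z * of_real (ln (real n))))" for n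
    using pochhammer_Gamma[OF assms, of n] nz by (simp add: Gamma_series'_def)
  ultimately show ?thesis using nz by simp
qed

text \<open>Gamma (z + n) / Gamma (w + n) behaves like n^(z - w). The complex power is written as an
  exponential of \<open>ln (real n)\<close>, so that the exponents of several quotients simply add
  up and cancel.\<close>

lemma Gamma_shift_asymp:
  fixes z :: complex
  assumes "nonpole z" "nonpole w"
  shows "(\<lambda>n. Gamma (z + of_nat n) * rGamma (w + of_nat n) * exp ((w - z) * of_real (ln (real n)))) \<longlonglongrightarrow> 1"
proof -
  let ?f = "\<lambda>z n. Gamma (z + of_nat n) / (fact (n - 1) * exp (z * of_real (ln (real n))))"
  have "(\<lambda>n. ?f z n / ?f w n) \<longlonglongrightarrow> 1 / 1"
    by (intro tendsto_divide Gamma_asymp assms) auto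
  also have "(\<lambda>n. ?f z n / ?f w n) = (\<lambda>n. Gamma (z + of_nat n) * rGamma (w + of_nat n) * exp ((w - z) * of_real (ln (real n))))"
    by (auto simp: fun_eq_iff rGamma_inverse_Gamma left_diff_distrib exp_diff field_simps)
  finally show ?thesis by simp
qed

lemma Gamma_ratio3_asymp:
  fixes x1 x2 x3 y1 y2 y3 :: complex
  assumes "nonpole x1" "nonpole x2" "nonpole x3" "nonpole y1" "nonpole y2" "nonpole y3"
  shows "(\<lambda>n. Gamma (x1 + of_nat n) * Gamma (x2 + of_nat n) * Gamma (x3 + of_nat n) *
      rGamma (y1 + of_nat n) * rGamma (y2 + of_nat n) * rGamma (y3 + of_nat n) *
      exp ((y1 + y2 + y3 - x1 - x2 - x3) * of_real (ln (real n)))) \<longlonglongrightarrow> 1"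
proof -
  let ?f = "\<lambda>x y n. Gamma (x + of_nat n) * rGamma (y + of_nat n) * exp ((y - x) * of_real (ln (real n)))"
  have "(\<lambda>n. ?f x1 y1 n * (?f x2 y2 n * ?f x3 y3 n)) \<longlonglongrightarrow> 1 * (1 * 1)"
    by (intro tendsto_mult Gamma_shift_asymp assms)
  moreover have "exp ((y1 + y2 + y3 - x1 - x2 - x3) * l) = exp ((y1 - x1) * l) * (exp ((y2 - x2) * l) * exp ((y3 - x3) * l))" for l
    unfolding exp_add[symmetric] by (simp add: algebra_simps)
  ultimately show ?thesis by (simp only: mult_ac mult_1_right)
qed

lemma powr_bounded_Gamma_ratio3:
  fixes x1 x2 x3 y1 y2 y3 :: complex
  assumes "nonpole x1" "nonpole x2" "nonpole x3"
  shows "powr_bounded (Re (x1 + x2 + x3 - y1 - y2 - y3)) (\<lambda>n. Gamma (x1 + of_nat n) * Gamma (x2 + of_nat n) * Gamma (x3 + of_nat n) *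
      rGamma (y1 + of_nat n) * rGamma (y2 + of_nat n) * rGamma (y3 + of_nat n))"
proof -
  have "powr_bounded ((Re x1 - Re y1) + ((Re x2 - Re y2) + (Re x3 - Re y3)))
     (\<lambda>n. (Gamma (x1 + of_nat n) * rGamma (y1 + of_nat n)) *
       ((Gamma (x2 + of_nat n) * rGamma (y2 + of_nat n)) * (Gamma (x3 + of_nat n) * rGamma (y3 + of_nat n))))"
    by (intro powr_bounded_mult powr_bounded_Gamma_ratio assms)
  thus ?thesis by (simp add: algebra_simps)
qed

section \<open>Gauss's summation theorem\<close>

lemma summable_powr_shift: "p < -1 \<Longrightarrow> summable (\<lambda>n. (real n + 1) powr p)"
  using summable_real_powr_iff[of p] summable_Suc_iff[of "\<lambda>n. real n powr p"] by (simp add: add_ac)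

lemma summable_powr_bound:
  assumes "\<And>n. norm (f n) \<le> C * (real n + 1) powr p" "p < -1"
  shows "summable (\<lambda>n. norm (f n))"
proof (rule summable_comparison_test')
  show "summable (\<lambda>n. C * (real n + 1) powr p)"
    by (intro summable_mult summable_powr_shift assms)
qed (use assms in auto)

lemma summable_powr_bounded: "powr_bounded p f \<Longrightarrow> p < -1 \<Longrightarrow> summable (\<lambda>n. norm (f n))"
  unfolding powr_bounded_def using summable_powr_bound by blast

lemma telescope_suminf:
  fixes f :: "nat \<Rightarrow> complex"
  assumes "\<And>n. f n = G (Suc n) - G n" "(\<lambda>n. G (Suc n)) \<longlonglongrightarrow> L"
  shows "(\<Sum>n. f n) = L - G 0"
proof -
  have "G \<longlonglongrightarrow> L" using assms(2) by (rule LIMSEQ_imp_Suc)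
  from telescope_sums[OF this] have "f sums (L - G 0)" by (simp add: assms(1)[abs_def])
  thus ?thesis by (simp add: sums_iff)
qed

lemma Gamma_Suc_shift:
  assumes "nonpole z"
  shows "Gamma (z + of_nat (Suc n)) = (z + of_nat n) * Gamma (z + of_nat n :: complex)"
  using Gamma_plus1[OF not_nonpos_Int_add_of_nat[OF assms, of n]] by (simp add: add_ac)

lemma rGamma_Suc_shift: "(z + of_nat n) * rGamma (z + of_nat (Suc n)) = rGamma (z + of_nat n :: complex)"
  using rGamma_plus1[of "z + of_nat n"] by (simp add: add_ac)

lemma rGamma_one_minus:
  assumes "nonpole z"
  shows "rGamma (1 - z) = Gamma z * sinpi z / of_real pi"
proof -
  have nz: "Gamma z \<noteq> 0" using assms by (simp add: Gamma_eq_zero_iff)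
  have "rGamma z * rGamma (1 - z) = sinpi z / of_real pi"
    by (simp add: rGamma_reflection_complex sinpi_def)
  hence "Gamma z * (rGamma z * rGamma (1 - z)) = Gamma z * (sinpi z / of_real pi)" by (rule arg_cong)
  thus ?thesis using nz by (simp add: rGamma_inverse_Gamma[of z] flip: mult.assoc)
qed

lemma Re_pos_not_nonpos_Int: "Re z > 0 \<Longrightarrow> z \<notin> \<int>\<^sub>\<le>\<^sub>0"
  by (auto elim!: nonpos_Ints_cases)

text \<open>The terms of 2F1(a, b; e; 1) with Gamma functions in place of pochhammer symbols. The
  argument \<open>t\<close> is complex, so that the companion series starting at t = 1 - e sums the
  same function.\<close>

definition gauss_term :: "complex \<Rightarrow> complex \<Rightarrow> complex \<Rightarrow> complex \<Rightarrow> complex" where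
  "gauss_term a b e t = Gamma (a + t) * Gamma (b + t) * rGamma (1 + t) * rGamma (e + t)"

lemma powr_bounded_gauss_term:
  assumes "nonpole (a + u)" "nonpole (b + u)"
  shows "powr_bounded (Re a + Re b - Re e - 1) (\<lambda>n. gauss_term a b e (u + of_nat n))"
proof -
  have "powr_bounded ((Re (a + u) - Re (1 + u)) + (Re (b + u) - Re (e + u)))
     (\<lambda>n. (Gamma (a + u + of_nat n) * rGamma (1 + u + of_nat n)) * (Gamma (b + u + of_nat n) * rGamma (e + u + of_nat n)))"
    by (intro powr_bounded_mult powr_bounded_Gamma_ratio assms)
  thus ?thesis by (simp add: gauss_term_def algebra_simps)
qed

lemma gauss_term_bound:
  assumes "nonpole a" "nonpole b"
  obtains C where "C > 0" "\<And>n. norm (gauss_term a b e (of_nat n)) \<le> C * (real n + 1) powr (Re a + Re b - Re e - 1)"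
  using powr_bounded_gauss_term[of a 0 b e] assms unfolding powr_bounded_def by auto

lemma summable_norm_gauss_term:
  assumes "nonpole (a + u)" "nonpole (b + u)" "Re (e - a - b) > 0"
  shows "summable (\<lambda>n. norm (gauss_term a b e (u + of_nat n)))"
  by (rule summable_powr_bounded[OF powr_bounded_gauss_term]) (use assms in auto)

lemma summable_gauss_term:
  assumes "nonpole a" "nonpole b" "Re (e - a - b) > 0"
  shows "summable (\<lambda>n. gauss_term a b e (of_nat n))"
  using summable_norm_cancel[OF summable_norm_gauss_term[of a 0 b e]] assms by simp

text \<open>This combination of the terms for e + 1 and e is the forward difference of n times the
  term for e. The boundary value at 0 vanishes because of the factor n; the one at infinity has
  growth exponent Re (a + b - e), negative by \<open>re\<close>.\<close>

lemma gauss_contiguous: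
  assumes a: "nonpole a" and b: "nonpole b" and re: "Re (e - a - b) > 0"
  shows "(e - a) * (e - b) * (\<Sum>n. gauss_term a b (e + 1) (of_nat n)) = (e - a - b) * (\<Sum>n. gauss_term a b e (of_nat n))"
proof -
  define G where "G n = of_nat n * gauss_term a b e (of_nat n)" for n
  have eq: "(e - a) * (e - b) * gauss_term a b (e + 1) (of_nat n) - (e - a - b) * gauss_term a b e (of_nat n) = G (Suc n) - G n" for n
  proof -
    have 1: "rGamma (e + of_nat n) = (e + of_nat n) * rGamma (e + of_nat (Suc n))"
      by (simp only: rGamma_Suc_shift)
    have 2: "rGamma (e + 1 + of_nat n) = rGamma (e + of_nat (Suc n))" by (simp add: add_ac)
    have 3: "rGamma (1 + of_nat n) = (1 + of_nat n) * rGamma (1 + of_nat (Suc n) :: complex)"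
      by (simp only: rGamma_Suc_shift)
    have 4: "G (Suc n) = (1 + of_nat n) * gauss_term a b e (of_nat (Suc n))" by (simp add: G_def)
    show ?thesis
      unfolding 4 unfolding G_def gauss_term_def Gamma_Suc_shift[OF a] Gamma_Suc_shift[OF b] 1 2 3
      by (simp only: algebra_simps)
  qed
  have lim: "(\<lambda>n. G (Suc n)) \<longlonglongrightarrow> 0"
  proof -
    obtain C where C: "C > 0" "\<And>n. norm (gauss_term a b e (of_nat n)) \<le> C * (real n + 1) powr (Re a + Re b - Re e - 1)"
      using gauss_term_bound[OF a b, of e] by metis
    have "G \<longlonglongrightarrow> 0"
    proof (rule Lim_null_comparison)
      show "\<forall>\<^sub>F n in sequentially. norm (G n) \<le> C * (real n + 1) powr (Re a + Re b - Re e)"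
      proof (intro always_eventually allI)
        fix n
        have "norm (G n) = real n * norm (gauss_term a b e (of_nat n))" by (simp add: G_def norm_mult)
        also have "\<dots> \<le> (real n + 1) * (C * (real n + 1) powr (Re a + Re b - Re e - 1))"
          by (intro mult_mono C) auto
        also have "\<dots> = C * (real n + 1) powr (Re a + Re b - Re e)" by (simp add: powr_diff)
        finally show "norm (G n) \<le> C * (real n + 1) powr (Re a + Re b - Re e)" .
      qed
      have "filterlim (\<lambda>n. real n + 1) at_top sequentially"
        using filterlim_compose[OF filterlim_real_sequentially filterlim_Suc] by (simp add: add_ac)
      hence "(\<lambda>n. (real n + 1) powr (Re a + Re b - Re e)) \<longlonglongrightarrow> 0"
        using re by (intro tendsto_neg_powr) auto
      thus "(\<lambda>n. C * (real n + 1) powr (Re a + Re b - Re e)) \<longlonglongrightarrow> 0"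
        by (rule tendsto_mult_right_zero)
    qed
    thus ?thesis by (rule LIMSEQ_Suc)
  qed
  have s: "summable (\<lambda>n. gauss_term a b e (of_nat n))" "summable (\<lambda>n. gauss_term a b (e + 1) (of_nat n))"
    using re by (auto intro!: summable_gauss_term a b)
  have "(\<Sum>n. (e - a) * (e - b) * gauss_term a b (e + 1) (of_nat n) - (e - a - b) * gauss_term a b e (of_nat n)) = 0 - G 0"
    by (rule telescope_suminf[OF eq lim])
  also have "(\<Sum>n. (e - a) * (e - b) * gauss_term a b (e + 1) (of_nat n) - (e - a - b) * gauss_term a b e (of_nat n)) =
     (e - a) * (e - b) * (\<Sum>n. gauss_term a b (e + 1) (of_nat n)) - (e - a - b) * (\<Sum>n. gauss_term a b e (of_nat n))"
    by (simp only: suminf_diff[OF summable_mult[OF s(2)] summable_mult[OF s(1)], symmetric]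
        suminf_mult[OF s(1)] suminf_mult[OF s(2)])
  finally show ?thesis by (simp add: G_def)
qed

lemma norm_pochhammer_ge:
  assumes "x > 0" "Re e \<ge> x"
  shows "norm (pochhammer (of_real x) n :: complex) \<le> norm (pochhammer e n)"
proof (induction n)
  case (Suc n)
  have "norm (of_real x + of_nat n :: complex) = norm (of_real (x + real n) :: complex)" by simp
  also have "\<dots> = x + real n" using assms by (simp only: norm_of_real)
  also have "\<dots> \<le> Re (e + of_nat n)" using assms by simp
  also have "\<dots> \<le> norm (e + of_nat n)" by (rule complex_Re_le_cmod)
  finally show ?case using Suc by (simp add: pochhammer_Suc norm_mult mult_mono)
qed auto

text \<open>Dominated convergence for series, with a majorant that may be valid only from some
  \<open>N0\<close> on.\<close>

lemma tannery_sequentially: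
  fixes t :: "nat \<Rightarrow> nat \<Rightarrow> complex"
  assumes lim: "\<And>n. (\<lambda>N. t n N) \<longlonglongrightarrow> b n"
    and bound: "\<And>n N. N \<ge> N0 \<Longrightarrow> norm (t n N) \<le> M n" and M: "summable M"
  shows "(\<lambda>N. \<Sum>n. t n N) \<longlonglongrightarrow> (\<Sum>n. b n)"
proof -
  have "\<forall>\<^sub>F (n, N) in at_top \<times>\<^sub>F sequentially. norm (t n N) \<le> M n"
    unfolding eventually_prod_filter
    by (rule exI[of _ "\<lambda>_. True"], rule exI[of _ "\<lambda>N. N \<ge> N0"])
       (use bound in \<open>auto simp: eventually_ge_at_top\<close>)
  from tannerys_theorem[OF lim this M] show ?thesis by simp
qed

text \<open>The factor Gamma (e + N) turns the lower parameter into 1 / pochhammer (e + N) n, which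
  tends to 0 for n > 0. Only the term n = 0 survives.\<close>

lemma gauss_limit:
  assumes a: "nonpole a" and b: "nonpole b" and e: "nonpole e"
  shows "(\<lambda>N. Gamma (e + of_nat N) * (\<Sum>n. gauss_term a b (e + of_nat N) (of_nat n))) \<longlonglongrightarrow> Gamma a * Gamma b"
proof -
  \<comment> \<open>The majorant is the series with real lower parameter \<open>x\<close>: from
    \<open>N0\<close> on, Re (e + N) >= x, so the pochhammer symbols of e + N are at least as large
    as those of \<open>x\<close>, and x >= Re a + Re b + 1 makes the majorant converge.\<close>
  define x where "x = max (max (Re e) 1) (Re a + Re b + 1)"
  have x: "x \<ge> 1" "x \<ge> Re e" "x \<ge> Re a + Re b + 1" by (auto simp: x_def)
  define N0 where "N0 = nat \<lceil>x - Re e\<rceil>"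
  have N0: "Re (e + of_nat N) \<ge> x" if "N \<ge> N0" for N
    using that x unfolding N0_def by simp
  obtain C where C: "C > 0" "\<And>n. norm (gauss_term a b (of_real x) (of_nat n)) \<le> C * (real n + 1) powr (Re a + Re b - x - 1)"
    using gauss_term_bound[OF a b, of "of_real x"] by (metis Re_complex_of_real)
  define t where "t n N = Gamma (e + of_nat N) * gauss_term a b (e + of_nat N) (of_nat n)" for n N
  have eN: "nonpole (e + of_nat N)" for N by (rule not_nonpos_Int_add_of_nat[OF e])
  have xN: "nonpole (complex_of_real x)" by (rule Re_pos_not_nonpos_Int) (use x in simp)
  have ratio: "Gamma z * rGamma (z + of_nat n) = 1 / pochhammer z n" if "nonpole z" for z :: complex and n
    unfolding pochhammer_Gamma[OF that] by (simp add: rGamma_inverse_Gamma divide_inverse)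
  have t_eq: "t n N = Gamma (a + of_nat n) * Gamma (b + of_nat n) * rGamma (1 + of_nat n) / pochhammer (e + of_nat N) n" for n N
  proof -
    have "t n N = Gamma (a + of_nat n) * Gamma (b + of_nat n) * rGamma (1 + of_nat n) *
        (Gamma (e + of_nat N) * rGamma (e + of_nat N + of_nat n))"
      unfolding t_def gauss_term_def by (simp only: mult_ac)
    thus ?thesis unfolding ratio[OF eN] by simp
  qed
  have T: "((\<lambda>N. suminf (\<lambda>n. t n N)) \<longlongrightarrow> suminf (\<lambda>n. if n = 0 then Gamma a * Gamma b else 0)) sequentially"
  proof (rule tannery_sequentially)
    fix n
    show "(\<lambda>N. t n N) \<longlonglongrightarrow> (if n = 0 then Gamma a * Gamma b else 0)"
    proof (cases n)
      case (Suc m)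
      have "filterlim (\<lambda>N. pochhammer (e + of_nat N) n) at_infinity sequentially"
        unfolding Suc
      proof (induction m)
        case 0
        show ?case using tendsto_add_filterlim_at_infinity[OF tendsto_const[of e] tendsto_of_nat] by simp
      next
        case (Suc m)
        have "filterlim (\<lambda>N. (e + of_nat (Suc m)) + of_nat N) at_infinity sequentially"
          by (rule tendsto_add_filterlim_at_infinity[OF tendsto_const tendsto_of_nat])
        from filterlim_at_infinity_times[OF Suc this] show ?case
          by (simp add: pochhammer_Suc[of _ "Suc m"] add_ac)
      qed
      from tendsto_divide_0[OF tendsto_const this] show ?thesis
        unfolding t_eq[abs_def] using Suc by simp
    qed (simp add: t_eq)
  next
    show "norm (t n N) \<le> norm (Gamma (complex_of_real x)) * (C * (real n + 1) powr (Re a + Re b - x - 1))"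
      if N: "N \<ge> N0" for n N
    proof -
      define r where "r = norm (Gamma (a + of_nat n) * Gamma (b + of_nat n) * rGamma (1 + of_nat n))"
      have "norm (t n N) = r / norm (pochhammer (e + of_nat N) n)"
        by (simp add: t_eq r_def norm_divide)
      also have "\<dots> \<le> r / norm (pochhammer (complex_of_real x) n)"
      proof (rule divide_left_mono)
        show "norm (pochhammer (complex_of_real x) n) \<le> norm (pochhammer (e + of_nat N) n)"
          by (rule norm_pochhammer_ge) (use x N0[OF N] in auto)
        have "pochhammer (complex_of_real x) n \<noteq> 0" using xN pochhammer_eq_0_imp_nonpos_Int by blast
        moreover have "pochhammer (e + of_nat N) n \<noteq> 0" using eN pochhammer_eq_0_imp_nonpos_Int by blast
        ultimately show "0 < norm (pochhammer (e + of_nat N) n) * norm (pochhammer (complex_of_real x) n)" by simp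
      qed (simp add: r_def)
      also have "\<dots> = norm (Gamma (complex_of_real x) * gauss_term a b (of_real x) (of_nat n))"
      proof -
        have "Gamma (complex_of_real x) * gauss_term a b (of_real x) (of_nat n) = 
           (Gamma (a + of_nat n) * Gamma (b + of_nat n) * rGamma (1 + of_nat n)) * (Gamma (complex_of_real x) * rGamma (of_real x + of_nat n))"
          by (simp add: gauss_term_def)
        also have "norm \<dots> = r / norm (pochhammer (complex_of_real x) n)"
          unfolding ratio[OF xN] norm_mult[of "Gamma (a + of_nat n) * Gamma (b + of_nat n) * rGamma (1 + of_nat n)"] r_def[symmetric]
          by (simp add: norm_divide)
        finally show ?thesis ..
      qed
      also have "\<dots> \<le> norm (Gamma (complex_of_real x)) * (C * (real n + 1) powr (Re a + Re b - x - 1))"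
        unfolding norm_mult by (intro mult_left_mono C) auto
      finally show "norm (t n N) \<le> norm (Gamma (complex_of_real x)) * (C * (real n + 1) powr (Re a + Re b - x - 1))" .
    qed
    show "summable (\<lambda>n. norm (Gamma (complex_of_real x)) * (C * (real n + 1) powr (Re a + Re b - x - 1)))"
      using x by (intro summable_mult summable_powr_shift) auto
  qed
  have "suminf (\<lambda>n. t n N) = Gamma (e + of_nat N) * (\<Sum>n. gauss_term a b (e + of_nat N) (of_nat n))" if "N \<ge> N0" for N
    unfolding t_def using N0[OF that] x
    by (intro suminf_mult summable_gauss_term a b) auto
  hence ev: "\<forall>\<^sub>F N in sequentially. suminf (\<lambda>n. t n N) = Gamma (e + of_nat N) * (\<Sum>n. gauss_term a b (e + of_nat N) (of_nat n))"
    by (rule eventually_mono[OF eventually_ge_at_top[of N0]])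
  have "suminf (\<lambda>n. if n = 0 then Gamma a * Gamma b else 0) = Gamma a * Gamma b"
    by (subst suminf_finite[of "{0}"]) auto
  with T show ?thesis using tendsto_cong[OF ev] by simp
qed

text \<open>By the contiguous relation, the sum times the Gamma quotient in \<open>X\<close> is
  unchanged when e is raised by 1. Its value is therefore its limit, which
  \<open>gauss_limit\<close> supplies.\<close>

theorem gauss_summation:
  assumes a: "nonpole a" and b: "nonpole b" and e: "nonpole e" and ea: "nonpole (e - a)" and eb: "nonpole (e - b)"
    and re: "Re (e - a - b) > 0"
  shows "(\<Sum>n. gauss_term a b e (of_nat n)) = Gamma a * Gamma b * Gamma (e - a - b) * rGamma (e - a) * rGamma (e - b)"
proof -
  have eab: "nonpole (e - a - b)" by (rule Re_pos_not_nonpos_Int[OF re])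
  note ni = not_nonpos_Int_add_of_nat[OF ea] not_nonpos_Int_add_of_nat[OF eb] not_nonpos_Int_add_of_nat[OF e] not_nonpos_Int_add_of_nat[OF eab]
  define V where "V N = (\<Sum>n. gauss_term a b (e + of_nat N) (of_nat n))" for N
  define X where "X N = V N * Gamma (e - a + of_nat N) * Gamma (e - b + of_nat N) * rGamma (e - a - b + of_nat N)" for N
  have const: "X N = X 0" for N
  proof (induction N)
    case (Suc N)
    have "(e - a + of_nat N) * (e - b + of_nat N) * V (Suc N) = (e - a - b + of_nat N) * V N"
      using gauss_contiguous[OF a b, of "e + of_nat N"] re by (simp add: V_def algebra_simps)
    moreover have "rGamma (e - a - b + of_nat N) = (e - a - b + of_nat N) * rGamma (e - a - b + of_nat (Suc N))"
      by (simp only: rGamma_Suc_shift)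
    ultimately have "X N = ((e - a + of_nat N) * (e - b + of_nat N) * V (Suc N)) *
        (Gamma (e - a + of_nat N) * Gamma (e - b + of_nat N) * rGamma (e - a - b + of_nat (Suc N)))"
      unfolding X_def by (simp only: mult_ac)
    also have "\<dots> = X (Suc N)"
      unfolding X_def Gamma_Suc_shift[OF ea] Gamma_Suc_shift[OF eb] by (simp only: mult_ac)
    finally have "X (Suc N) = X N" ..
    with Suc show ?case by simp
  qed simp
  \<comment> \<open>The exponents a and -a of the two exponentials cancel, as do Gamma (e + N) and
    its reciprocal, so that \<open>X\<close> remains.\<close>
  have "(\<lambda>N. (Gamma (e + of_nat N) * V N) *
     ((Gamma (e - a + of_nat N) * rGamma (e + of_nat N) * exp ((e - (e - a)) * of_real (ln (real N)))) *
      (Gamma (e - b + of_nat N) * rGamma (e - a - b + of_nat N) * exp ((e - a - b - (e - b)) * of_real (ln (real N))))))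
     \<longlonglongrightarrow> (Gamma a * Gamma b) * (1 * 1)" (is "?f \<longlonglongrightarrow> _")
    unfolding V_def by (intro tendsto_mult gauss_limit a b e Gamma_shift_asymp ea eb eab)
  also have "?f = X"
    using ni by (auto simp: X_def fun_eq_iff exp_minus Gamma_eq_zero_iff rGamma_inverse_Gamma field_simps)
  finally have "X \<longlonglongrightarrow> Gamma a * Gamma b" by simp
  moreover have "X = (\<lambda>_. X 0)" using const by auto
  ultimately have "(\<lambda>_::nat. X 0) \<longlonglongrightarrow> Gamma a * Gamma b" by simp
  hence "X 0 = Gamma a * Gamma b" by (simp add: tendsto_const_iff)
  thus ?thesis using ni[of 0]
    by (simp add: X_def V_def rGamma_inverse_Gamma Gamma_eq_zero_iff field_simps)
qed

section \<open>The nonterminating Saalschuetz theorem\<close>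

text \<open>Numbers that agree modulo the integers up to sign avoid the integers together, so one
  nonintegrality condition excludes the poles of a whole family of Gamma factors.\<close>

lemma nonint_shift:
  assumes "x \<notin> \<int>" "y - x \<in> \<int> \<or> y + x \<in> \<int>"
  shows "y \<notin> (\<int>\<^sub>\<le>\<^sub>0 :: complex set)"
proof
  assume "y \<in> \<int>\<^sub>\<le>\<^sub>0"
  hence "y \<in> \<int>" using nonpos_Ints_subset_Ints by blast
  with assms show False
    by (metis Ints_diff add_diff_cancel_left' diff_diff_eq2 add_diff_cancel_right')
qed

lemma nonint_trans: "x \<notin> \<int> \<Longrightarrow> x - y \<in> \<int> \<or> x + y \<in> \<int> \<Longrightarrow> y \<notin> \<int>" for x y :: complex
  by (metis Ints_add Ints_diff add_diff_cancel_right' diff_add_cancel)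

lemma nonint_not_nonpos_Int: "x \<notin> \<int> \<Longrightarrow> x \<notin> \<int>\<^sub>\<le>\<^sub>0" for x :: complex
  using nonpos_Ints_subset_Ints by blast

lemma Ints_shift_iff:
  fixes x y :: complex
  shows "1 + x \<in> \<int> \<longleftrightarrow> x \<in> \<int>" "x + 1 \<in> \<int> \<longleftrightarrow> x \<in> \<int>" "1 - x \<in> \<int> \<longleftrightarrow> x \<in> \<int>" "2 - x \<in> \<int> \<longleftrightarrow> x \<in> \<int>"
    "1 + x - y \<in> \<int> \<longleftrightarrow> x - y \<in> \<int>"
proof -
  have *: "u \<in> \<int> \<longleftrightarrow> v \<in> \<int>" if "u - v \<in> \<int> \<or> u + v \<in> \<int>" for u v :: complex
    using nonint_trans[of u v] nonint_trans[of v u] that Ints_minus[of "u - v"] by (auto simp: add.commute)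
  show "1 + x \<in> \<int> \<longleftrightarrow> x \<in> \<int>" "x + 1 \<in> \<int> \<longleftrightarrow> x \<in> \<int>" "1 - x \<in> \<int> \<longleftrightarrow> x \<in> \<int>" "2 - x \<in> \<int> \<longleftrightarrow> x \<in> \<int>"
    "1 + x - y \<in> \<int> \<longleftrightarrow> x - y \<in> \<int>"
    by (intro *; simp)+
qed

definition saal :: "complex \<Rightarrow> complex \<Rightarrow> complex \<Rightarrow> complex \<Rightarrow> complex \<Rightarrow> complex \<Rightarrow> complex" where
  "saal a b c e f t = Gamma (a + t) * Gamma (b + t) * Gamma (c + t) * rGamma (1 + t) * rGamma (e + t) * rGamma (f + t)"

lemma saal_powr_bounded:
  assumes "nonpole (a + u)" "nonpole (b + u)" "nonpole (c + u)"
  shows "powr_bounded (Re a + Re b + Re c - Re e - Re f - 1) (\<lambda>n. saal a b c e f (u + of_nat n))"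
  using powr_bounded_Gamma_ratio3[OF assms, of "1 + u" "e + u" "f + u"] by (simp add: saal_def algebra_simps)

lemma saal_summable:
  assumes "f = 1 + a + b + c - e" "nonpole (a + u)" "nonpole (b + u)" "nonpole (c + u)"
  shows "summable (\<lambda>n. saal a b c e f (u + of_nat n))"
  by (rule summable_norm_cancel, rule summable_powr_bounded[OF saal_powr_bounded]) (use assms in auto)

text \<open>With the balance condition, the cubes and squares of t cancel in (a + t)(b + t)(c + t) -
  t (e - 1 + t)(f + t). What is left is linear in t and splits into multiples of c + t and f + t,
  which belong to the terms with (c + 1, f + 1) and (c, f).\<close>

lemma saal_contiguous:
  assumes f: "f = 1 + a + b + c - e"
    and ni: "nonpole (a + t)" "nonpole (b + t)" "nonpole (c + t)"
  defines "G \<equiv> \<lambda>t. Gamma (a + t) * Gamma (b + t) * Gamma (c + t) * rGamma t * rGamma (e - 1 + t) * rGamma (f + t)"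
  shows "(f - a) * (f - b) * saal a b (c + 1) e (f + 1) t - c * (1 + c - e) * saal a b c e f t = G (t + 1) - G t"
proof -
  define A B C p q r where "A = Gamma (a + t)" "B = Gamma (b + t)" "C = Gamma (c + t)"
    and "p = rGamma (1 + t)" "q = rGamma (e + t)" "r = rGamma (f + (t + 1))"
  note defs = this
  have 1: "Gamma (a + (t + 1)) = (a + t) * A" "Gamma (b + (t + 1)) = (b + t) * B" "Gamma (c + (t + 1)) = (c + t) * C"
    using Gamma_plus1[OF ni(1)] Gamma_plus1[OF ni(2)] Gamma_plus1[OF ni(3)] by (simp_all add: defs add_ac)
  have 2: "rGamma t = t * p" "rGamma (e - 1 + t) = (e - 1 + t) * q" "rGamma (f + t) = (f + t) * r"
    using rGamma_plus1[of t] rGamma_plus1[of "e - 1 + t"] rGamma_plus1[of "f + t"] by (simp_all add: defs add_ac)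
  have 3: "Gamma (c + 1 + t) = (c + t) * C" "rGamma (f + 1 + t) = r" "rGamma (t + 1) = p" "rGamma (e - 1 + (t + 1)) = q"
    using 1(3) by (simp_all add: defs add_ac)
  have "(f - a) * (f - b) * saal a b (c + 1) e (f + 1) t - c * (1 + c - e) * saal a b c e f t =
    A * B * C * p * q * r * ((f - a) * (f - b) * (c + t) - c * (1 + c - e) * (f + t))"
    unfolding saal_def 3 2 defs(1-5)[symmetric] by (simp add: algebra_simps)
  also have "(f - a) * (f - b) * (c + t) - c * (1 + c - e) * (f + t) = (a + t) * (b + t) * (c + t) - t * (e - 1 + t) * (f + t)"
    unfolding f by (simp add: algebra_simps)
  also have "A * B * C * p * q * r * \<dots> = G (t + 1) - G t"
    unfolding G_def 1 2 3 defs(6)[symmetric] unfolding defs(1-5)[symmetric] by (simp add: algebra_simps)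
  finally show ?thesis .
qed

text \<open>\<open>G\<close> vanishes at t = 0 and at t = 1 - e, through the factors rGamma t and
  rGamma (e - 1 + t), and tends to 1 by the balance condition. The right-hand side is the same for
  both starting points, so the difference of the two series satisfies a homogeneous
  recurrence.\<close>

lemma saal_telescope:
  assumes f: "f = 1 + a + b + c - e"
    and ni: "nonpole (a + u)" "nonpole (b + u)" "nonpole (c + u)" "nonpole (e + u)" "nonpole (f + u)" "nonpole (1 + u)"
    and u: "u = 0 \<or> u = 1 - e"
  shows "(f - a) * (f - b) * (\<Sum>n. saal a b (c + 1) e (f + 1) (u + of_nat n)) - c * (1 + c - e) * (\<Sum>n. saal a b c e f (u + of_nat n)) = 1"
proof -
  define G where "G t = Gamma (a + t) * Gamma (b + t) * Gamma (c + t) * rGamma t * rGamma (e - 1 + t) * rGamma (f + t)" for t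
  note ni' = ni[THEN not_nonpos_Int_add_of_nat]
  note ni1 = ni[THEN not_nonpos_Int_add_of_nat, of 1]
  have eq: "(f - a) * (f - b) * saal a b (c + 1) e (f + 1) (u + of_nat n) - c * (1 + c - e) * saal a b c e f (u + of_nat n) =
     G (u + of_nat (Suc n)) - G (u + of_nat n)" for n
    using saal_contiguous[OF f, of "u + of_nat n"] ni'[of n] by (simp add: G_def add_ac)
  have "1 + u + (e + u) + (f + u + of_nat 1) - (a + u + of_nat 1) - (b + u + of_nat 1) - (c + u + of_nat 1) = 0"
    by (simp add: f)
  with Gamma_ratio3_asymp[OF ni1(1-3) ni(6,4) ni1(5)] have lim: "(\<lambda>n. G (u + of_nat (Suc n))) \<longlonglongrightarrow> 1"
    by (simp add: G_def add_ac)
  have s: "summable (\<lambda>n. saal a b c e f (u + of_nat n))" by (rule saal_summable[OF f ni(1-3)])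
  have c1: "nonpole (c + 1 + u)" using ni1(3) by (simp add: add_ac)
  have s': "summable (\<lambda>n. saal a b (c + 1) e (f + 1) (u + of_nat n))"
    by (rule summable_norm_cancel, rule summable_powr_bounded[OF saal_powr_bounded]) (use ni c1 in \<open>auto simp: f\<close>)
  have "(\<Sum>n. (f - a) * (f - b) * saal a b (c + 1) e (f + 1) (u + of_nat n) - c * (1 + c - e) * saal a b c e f (u + of_nat n)) = 1 - G (u + of_nat 0)"
    by (rule telescope_suminf[OF eq lim])
  also have "G (u + of_nat 0) = 0" using u by (auto simp: G_def)
  finally show ?thesis
    by (simp only: suminf_diff[OF summable_mult[OF s'] summable_mult[OF s], symmetric]
        suminf_mult[OF s] suminf_mult[OF s'] diff_zero)
qed

text \<open>When c and f are both raised by N, the quotient Gamma (c + N + t) / Gamma (f + N + t)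
  loses its dependence on t in the limit, and a Gauss series remains. Re (e - a - b) <= 1 says that
  Re c <= Re f; the bound for \<open>Q (N + n)\<close> is then at most that for \<open>Q N\<close>,
  which compensates the growth of \<open>R N\<close>.\<close>

lemma saal_tannery:
  assumes f: "f = 1 + a + b + c - e" and re: "Re (e - a - b) > 0" "Re (e - a - b) \<le> 1"
    and ni: "nonpole (a + u)" "nonpole (b + u)" "nonpole (c + u)" "nonpole (f + u)" "nonpole c" "nonpole f"
  shows "(\<lambda>N. Gamma (f + of_nat N) * rGamma (c + of_nat N) * (\<Sum>n. saal a b (c + of_nat N) e (f + of_nat N) (u + of_nat n))) \<longlonglongrightarrow>
     (\<Sum>n. Gamma (a + u + of_nat n) * Gamma (b + u + of_nat n) * rGamma (1 + u + of_nat n) * rGamma (e + u + of_nat n))"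
proof -
  define v where "v n = Gamma (a + u + of_nat n) * Gamma (b + u + of_nat n) * rGamma (1 + u + of_nat n) * rGamma (e + u + of_nat n)" for n
  define R where "R N = Gamma (f + of_nat N) * rGamma (c + of_nat N)" for N
  define Q where "Q N = Gamma (c + u + of_nat N) * rGamma (f + u + of_nat N)" for N
  define t where "t n N = R N * saal a b (c + of_nat N) e (f + of_nat N) (u + of_nat n)" for n N
  have t_eq: "t n N = v n * (R N * Q (N + n))" for n N
    by (simp add: t_def v_def Q_def saal_def add_ac mult_ac)
  have sv: "summable (\<lambda>n. norm (v n))"
    using summable_norm_gauss_term[OF ni(1,2) re(1)] by (simp add: v_def gauss_term_def add.assoc)
  have "powr_bounded (Re f - Re c) R" unfolding R_def by (intro powr_bounded_Gamma_ratio ni)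
  then obtain C where C: "C > 0" "\<And>n. norm (R n) \<le> C * (real n + 1) powr (Re f - Re c)"
    by (auto simp: powr_bounded_def)
  have "powr_bounded (Re (c + u) - Re (f + u)) Q" unfolding Q_def by (intro powr_bounded_Gamma_ratio ni)
  then obtain D where D: "D > 0" "\<And>n. norm (Q n) \<le> D * (real n + 1) powr (Re c - Re f)"
    by (auto simp: powr_bounded_def)
  have le: "Re c - Re f \<le> 0" using re(2) by (simp add: f)
  have T: "(\<lambda>N. \<Sum>n. t n N) \<longlonglongrightarrow> (\<Sum>n. v n)"
  proof (rule tannery_sequentially)
    fix n
    have cn: "nonpole (c + u + of_nat n)" "nonpole (f + u + of_nat n)"
      by (intro not_nonpos_Int_add_of_nat ni)+
    have "(\<lambda>N. v n * ((Gamma (f + of_nat N) * rGamma (c + of_nat N) * exp ((c - f) * of_real (ln (real N)))) *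
      (Gamma (c + u + of_nat n + of_nat N) * rGamma (f + u + of_nat n + of_nat N) * exp (((f + u + of_nat n) - (c + u + of_nat n)) * of_real (ln (real N))))))
       \<longlonglongrightarrow> v n * (1 * 1)" (is "?f \<longlonglongrightarrow> _")
      by (intro tendsto_mult tendsto_const Gamma_shift_asymp cn ni)
    also have "?f =
      (\<lambda>N. t n N)"
    proof
      fix N
      let ?l = "complex_of_real (ln (real N))"
      have e: "exp ((c - f) * ?l) * exp (((f + u + of_nat n) - (c + u + of_nat n)) * ?l) = 1"
        unfolding exp_add[symmetric] by (simp add: algebra_simps)
      have g: "x * y * u * (x' * y' * v) = x * y * (x' * y') * (u * v)" for x y u x' y' v :: complex
        by (simp only: mult_ac)
      show "?f N = t n N"
        unfolding g e t_eq R_def Q_def by (simp add: add_ac)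
    qed
    finally show "(\<lambda>N. t n N) \<longlonglongrightarrow> v n" by simp
  next
    fix n N :: nat
    have "norm (R N * Q (N + n)) \<le> (C * (real N + 1) powr (Re f - Re c)) * (D * (real (N + n) + 1) powr (Re c - Re f))"
      unfolding norm_mult by (rule mult_mono[OF C(2) D(2)]) (use C in auto)
    also have "\<dots> \<le> (C * (real N + 1) powr (Re f - Re c)) * (D * (real N + 1) powr (Re c - Re f))"
      using C D le by (intro mult_left_mono powr_mono2') auto
    also have "\<dots> = C * D * ((real N + 1) powr (Re f - Re c) * (real N + 1) powr (Re c - Re f))" by simp
    also have "(real N + 1) powr (Re f - Re c) * (real N + 1) powr (Re c - Re f) = 1"
      unfolding powr_add[symmetric] by simp
    finally have "norm (R N * Q (N + n)) \<le> C * D" by simp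
    thus "norm (t n N) \<le> norm (v n) * (C * D)"
      unfolding t_eq norm_mult[of "v n"] by (intro mult_left_mono) auto
  next
    show "summable (\<lambda>n. norm (v n) * (C * D))" by (intro summable_mult2 sv)
  qed
  have "(\<Sum>n. t n N) = R N * (\<Sum>n. saal a b (c + of_nat N) e (f + of_nat N) (u + of_nat n))" for N
    unfolding t_def
  proof (rule suminf_mult, rule summable_norm_cancel, rule summable_powr_bounded[OF saal_powr_bounded])
    show "nonpole (c + of_nat N + u)" using not_nonpos_Int_add_of_nat[OF ni(3), of N] by (simp add: add_ac)
  qed (use ni in \<open>auto simp: f\<close>)
  with T show ?thesis by (simp add: R_def v_def)
qed

text \<open>Neither series alone has a closed form here, but the inhomogeneous terms of
  \<open>saal_telescope\<close> cancel in their difference. Multiplied by \<open>r N\<close>, the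
  difference for c + N, f + N is independent of N, and its limit is a difference of two Gauss
  sums.\<close>

theorem nonterminating_saalschutz:
  assumes f: "f = 1 + a + b + c - e" and re: "Re (e - a - b) > 0" "Re (e - a - b) \<le> 1"
    and ni: "a \<notin> \<int>" "b \<notin> \<int>" "c \<notin> \<int>" "e \<notin> \<int>" "f \<notin> \<int>"
      "a - e \<notin> \<int>" "b - e \<notin> \<int>" "c - e \<notin> \<int>" "f - e \<notin> \<int>" "f - a \<notin> \<int>" "f - b \<notin> \<int>"
  shows "(\<Sum>n. saal a b c e f (of_nat n)) - (\<Sum>n. saal a b c e f (1 - e + of_nat n)) =
     Gamma a * Gamma b * Gamma c * Gamma (1 + a - e) * Gamma (1 + b - e) * Gamma (1 + c - e) *
     (sinpi e / of_real pi) * rGamma (f - a) * rGamma (f - b) * rGamma (f - c)"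
proof -
  have fa: "nonpole (f - a)" and fb: "nonpole (f - b)" and c: "nonpole c" and ff: "nonpole f"
    and ce: "nonpole (1 + c - e)" and a: "nonpole a" and b: "nonpole b" and ee: "nonpole e"
    and ae: "nonpole (1 + a - e)" and be: "nonpole (1 + b - e)" and fe: "nonpole (1 + f - e)" and e2: "nonpole (2 - e)"
    and ea: "nonpole (e - a)" and eb: "nonpole (e - b)" and a1: "nonpole (1 - a)" and b1: "nonpole (1 - b)"
    using ni[THEN nonint_shift] by auto
  define W where "W N u = (\<Sum>n. saal a b (c + of_nat N) e (f + of_nat N) (u + of_nat n))" for N u
  define r where "r N = Gamma (f - a + of_nat N) * Gamma (f - b + of_nat N) * rGamma (c + of_nat N) * rGamma (1 + c - e + of_nat N)" for N
  define X where "X N = (W N 0 - W N (1 - e)) * r N" for N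
  have const: "X N = X 0" for N
  proof (induction N)
    case (Suc N)
    have tel: "(f - a + of_nat N) * (f - b + of_nat N) * W (Suc N) u = 1 + (c + of_nat N) * (1 + c - e + of_nat N) * W N u"
      if "u = 0 \<or> u = 1 - e" for u
    proof -
      have h1: "nonpole (c + of_nat N)" "nonpole (c + of_nat N + (1 - e))"
          "nonpole (f + of_nat N)" "nonpole (f + of_nat N + (1 - e))"
        using c[THEN not_nonpos_Int_add_of_nat, of N] ce[THEN not_nonpos_Int_add_of_nat, of N]
          ff[THEN not_nonpos_Int_add_of_nat, of N] fe[THEN not_nonpos_Int_add_of_nat, of N]
        by (simp_all add: algebra_simps)
      have h2: "nonpole (a + (1 - e))" "nonpole (b + (1 - e))" "nonpole (1 + (1 - e))"
        using ae be e2 by (simp_all add: algebra_simps)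
      have "(f + of_nat N - a) * (f + of_nat N - b) * (\<Sum>n. saal a b (c + of_nat N + 1) e (f + of_nat N + 1) (u + of_nat n)) - 
         (c + of_nat N) * (1 + (c + of_nat N) - e) * (\<Sum>n. saal a b (c + of_nat N) e (f + of_nat N) (u + of_nat n)) = 1"
      proof (rule saal_telescope)
        show "f + of_nat N = 1 + a + b + (c + of_nat N) - e" by (simp add: f)
        show "nonpole (c + of_nat N + u)" "nonpole (f + of_nat N + u)"
          using that h1 by auto
      qed (use that a b ae be ee e2 h2 in auto)
      thus ?thesis by (simp add: W_def algebra_simps)
    qed
    have rc: "(c + of_nat N) * rGamma (c + of_nat (Suc N)) = rGamma (c + of_nat N)"
      "(1 + c - e + of_nat N) * rGamma (1 + c - e + of_nat (Suc N)) = rGamma (1 + c - e + of_nat N)"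
      by (rule rGamma_Suc_shift)+
    have "X (Suc N) = ((f - a + of_nat N) * (f - b + of_nat N) * W (Suc N) 0 - (f - a + of_nat N) * (f - b + of_nat N) * W (Suc N) (1 - e)) *
       (Gamma (f - a + of_nat N) * Gamma (f - b + of_nat N) * rGamma (c + of_nat (Suc N)) * rGamma (1 + c - e + of_nat (Suc N)))"
      unfolding X_def r_def Gamma_Suc_shift[OF fa] Gamma_Suc_shift[OF fb] by (simp only: algebra_simps)
    also have "(f - a + of_nat N) * (f - b + of_nat N) * W (Suc N) 0 - (f - a + of_nat N) * (f - b + of_nat N) * W (Suc N) (1 - e) =
        (c + of_nat N) * (1 + c - e + of_nat N) * (W N 0 - W N (1 - e))"
      unfolding tel[OF disjI1[OF refl]] tel[OF disjI2[OF refl]] by (simp add: right_diff_distrib)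
    also have "\<dots> * (Gamma (f - a + of_nat N) * Gamma (f - b + of_nat N) * rGamma (c + of_nat (Suc N)) * rGamma (1 + c - e + of_nat (Suc N))) = X N"
      unfolding X_def r_def rc[symmetric] by (simp only: mult_ac)
    finally show ?case using Suc by simp
  qed simp
  define S where "S u = (\<Sum>n. Gamma (a + u + of_nat n) * Gamma (b + u + of_nat n) * rGamma (1 + u + of_nat n) * rGamma (e + u + of_nat n))" for u
  have lim: "(\<lambda>N. Gamma (f + of_nat N) * rGamma (c + of_nat N) * W N u) \<longlonglongrightarrow> S u" if "u = 0 \<or> u = 1 - e" for u
  proof -
    have h: "nonpole (a + (1 - e))" "nonpole (b + (1 - e))" "nonpole (c + (1 - e))" "nonpole (f + (1 - e))"
      using ae be ce fe by (simp_all add: algebra_simps)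
    show ?thesis unfolding W_def S_def
      by (rule saal_tannery[OF f re]) (use that a b c ff h in auto)
  qed
  \<comment> \<open>By the balance condition the exponents of the two exponentials are a and -a and
    cancel.\<close>
  have "(\<lambda>N. (Gamma (f + of_nat N) * rGamma (c + of_nat N) * W N 0 - Gamma (f + of_nat N) * rGamma (c + of_nat N) * W N (1 - e)) *
     ((Gamma (f - a + of_nat N) * rGamma (f + of_nat N) * exp ((f - (f - a)) * of_real (ln (real N)))) *
      (Gamma (f - b + of_nat N) * rGamma (1 + c - e + of_nat N) * exp ((1 + c - e - (f - b)) * of_real (ln (real N))))))
     \<longlonglongrightarrow> (S 0 - S (1 - e)) * (1 * 1)" (is "?f \<longlonglongrightarrow> _")
    by (intro tendsto_mult tendsto_diff lim Gamma_shift_asymp fa fb ff ce) auto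
  also have "?f = X"
  proof
    fix N
    let ?l = "complex_of_real (ln (real N))"
    have e: "exp ((f - (f - a)) * ?l) * exp ((1 + c - e - (f - b)) * ?l) = 1"
      unfolding exp_add[symmetric] f by (simp add: algebra_simps)
    have "Gamma (f + of_nat N) * rGamma (f + of_nat N) = 1"
      using ff[THEN not_nonpos_Int_add_of_nat, of N] by (simp add: rGamma_inverse_Gamma Gamma_eq_zero_iff)
    note e = e this
    have g: "(G * k * w - G * k * w') * (x * G' * u * (x' * y' * v)) = (G * G') * (u * v) * ((w - w') * (x * x' * k * y'))" for x G G' k w w' u x' y' v :: complex
      by (simp only: algebra_simps)
    show "?f N = X N"
      unfolding g e X_def r_def by simp
  qed
  finally have "X \<longlonglongrightarrow> S 0 - S (1 - e)" by simp
  moreover have "X = (\<lambda>_. X 0)" using const by auto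
  ultimately have "(\<lambda>_::nat. X 0) \<longlonglongrightarrow> S 0 - S (1 - e)" by simp
  hence X0: "X 0 = S 0 - S (1 - e)" by (simp add: tendsto_const_iff)
  have S0: "S 0 = Gamma a * Gamma b * Gamma (e - a - b) * rGamma (e - a) * rGamma (e - b)"
    using gauss_summation[OF a b ee ea eb re(1)] by (simp add: S_def gauss_term_def)
  have S1: "S (1 - e) = Gamma (1 + a - e) * Gamma (1 + b - e) * Gamma (e - a - b) * rGamma (1 - a) * rGamma (1 - b)"
    using gauss_summation[OF ae be e2] a1 b1 re(1) by (simp add: S_def gauss_term_def algebra_simps)
  have eab: "nonpole (e - a - b)" by (rule Re_pos_not_nonpos_Int[OF re(1)])
  have R: "rGamma (e - a) = Gamma (1 + a - e) * sinpi (e - a) / of_real pi"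
    "rGamma (e - b) = Gamma (1 + b - e) * sinpi (e - b) / of_real pi"
    "rGamma (1 - a) = Gamma a * sinpi a / of_real pi"
    "rGamma (1 - b) = Gamma b * sinpi b / of_real pi"
    "rGamma (f - c) = Gamma (e - a - b) * sinpi (e - a - b) / of_real pi"
  proof -
    have s: "sinpi (1 - z) = sinpi z" for z
      by (simp add: sinpi_def right_diff_distrib sin_diff)
    show "rGamma (e - a) = Gamma (1 + a - e) * sinpi (e - a) / of_real pi"
      using rGamma_one_minus[OF ae] s[of "e - a"] by (simp add: algebra_simps)
    show "rGamma (e - b) = Gamma (1 + b - e) * sinpi (e - b) / of_real pi"
      using rGamma_one_minus[OF be] s[of "e - b"] by (simp add: algebra_simps)
    show "rGamma (f - c) = Gamma (e - a - b) * sinpi (e - a - b) / of_real pi"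
      using rGamma_one_minus[OF eab] by (simp add: f algebra_simps)
  qed (use rGamma_one_minus[OF a] rGamma_one_minus[OF b] in auto)
  \<comment> \<open>After reflection the two Gauss values share all Gamma factors and differ only in
    these products of sines.\<close>
  have trig: "sinpi (e - a) * sinpi (e - b) - sinpi a * sinpi b = sinpi e * sinpi (e - a - b)"
  proof -
    have *: "sin (x - y) * sin (x - z) - sin y * sin z = sin x * sin (x - y - z)" for x y z :: complex
      unfolding sin_diff cos_diff using sin_cos_squared_add[of x] by algebra
    show ?thesis using *[of "of_real pi * e" "of_real pi * a" "of_real pi * b"]
      by (simp add: sinpi_def right_diff_distrib)
  qed
  have r0: "r 0 \<noteq> 0" unfolding r_def using fa fb c ce by (simp add: Gamma_eq_zero_iff rGamma_inverse_Gamma)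
  have "S 0 - S (1 - e) = Gamma a * Gamma b * Gamma (1 + a - e) * Gamma (1 + b - e) * (sinpi e / of_real pi) * rGamma (f - c)"
  proof -
    have "S 0 - S (1 - e) = Gamma a * Gamma b * Gamma (1 + a - e) * Gamma (1 + b - e) * Gamma (e - a - b) / (of_real pi)\<^sup>2 *
       (sinpi (e - a) * sinpi (e - b) - sinpi a * sinpi b)"
      unfolding S0 S1 R by (simp add: field_simps power2_eq_square)
    thus ?thesis unfolding trig R by (simp add: power2_eq_square)
  qed
  hence *: "(W 0 0 - W 0 (1 - e)) * r 0 = Gamma a * Gamma b * Gamma (1 + a - e) * Gamma (1 + b - e) * (sinpi e / of_real pi) * rGamma (f - c)"
    using X0 by (simp add: X_def)
  have "W 0 0 - W 0 (1 - e) = ((W 0 0 - W 0 (1 - e)) * r 0) * (Gamma c * Gamma (1 + c - e) * rGamma (f - a) * rGamma (f - b))"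
    using fa fb c ce by (simp add: r_def rGamma_inverse_Gamma Gamma_eq_zero_iff field_simps)
  also have "\<dots> = Gamma a * Gamma b * Gamma c * Gamma (1 + a - e) * Gamma (1 + b - e) * Gamma (1 + c - e) *
     (sinpi e / of_real pi) * rGamma (f - a) * rGamma (f - b) * rGamma (f - c)"
    unfolding * by (simp only: mult_ac)
  finally show ?thesis by (simp add: W_def)
qed

section \<open>Two-term transformations of L\<close>

lemma double_sum_swap:
  fixes h :: "nat \<Rightarrow> nat \<Rightarrow> complex"
  assumes bound: "\<And>n m. norm (h n m) \<le> A n * B m" and A: "summable A" and B: "summable B"
    and nonneg: "\<And>n. A n \<ge> 0" "\<And>m. B m \<ge> 0"
  shows "summable (h n)" "summable (\<lambda>n. \<Sum>m. h n m)" "(\<Sum>n. \<Sum>m. h n m) = (\<Sum>m. \<Sum>n. h n m)"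
proof -
  have s1: "summable (\<lambda>m. norm (h n m))" for n
    by (rule summable_comparison_test'[where g = "\<lambda>m. A n * B m"]) (use bound B in \<open>auto intro: summable_mult\<close>)
  have s2: "summable (\<lambda>n. norm (h n m))" for m
    by (rule summable_comparison_test'[where g = "\<lambda>n. A n * B m"]) (use bound A in \<open>auto intro: summable_mult2\<close>)
  have le: "(\<Sum>m. norm (h n m)) \<le> A n * suminf B" for n
    using suminf_le[OF bound s1 summable_mult[OF B]] by (simp add: suminf_mult[OF B])
  have sA: "summable (\<lambda>n. \<Sum>m. norm (h n m))"
    by (rule summable_comparison_test'[where g = "\<lambda>n. A n * suminf B"])
       (use le s1 A in \<open>auto intro!: summable_mult2 simp: suminf_nonneg\<close>)
  have "norm (\<Sum>m. h n m) \<le> (\<Sum>m. norm (h n m))" for n by (rule summable_norm[OF s1])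
  show "summable (h n)" by (rule summable_norm_cancel[OF s1])
  have sB: "summable (\<lambda>n. norm (\<Sum>m. h n m))"
    by (rule summable_comparison_test'[OF sA]) (use summable_norm[OF s1] in auto)
  show "summable (\<lambda>n. \<Sum>m. h n m)" by (rule summable_norm_cancel[OF sB])
  have le': "(\<Sum>n. norm (h n m)) \<le> suminf A * B m" for m
    using suminf_le[OF bound s2 summable_mult2[OF A]] by (simp add: suminf_mult2[OF A])
  have sB': "summable (\<lambda>m. norm (\<Sum>n. h n m))"
  proof (rule summable_comparison_test'[where g = "\<lambda>m. suminf A * B m"])
    show "norm (norm (\<Sum>n. h n m)) \<le> suminf A * B m" for m
      using summable_norm[OF s2, of m] le'[of m] by simp
  qed (intro summable_mult B)
  have hs: "(\<lambda>(n, m). h n m) summable_on UNIV \<times> UNIV"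
  proof (rule abs_summable_summable, subst Infinite_Sum.abs_summable_on_Sigma_iff, intro conjI ballI)
    show "(\<lambda>m. norm (case (n, m) of (n, m) \<Rightarrow> h n m)) summable_on UNIV" for n
      using s1[of n] by (simp add: summable_on_UNIV_nonneg_real_iff)
    have "infsum (\<lambda>m. norm (h n m)) UNIV = (\<Sum>m. norm (h n m))" for n
      using s1[of n] by (metis has_sum_imp_sums has_sum_infsum norm_ge_zero summable_on_UNIV_nonneg_real_iff sums_unique)
    thus "(\<lambda>n. norm (infsum (\<lambda>m. norm (case (n, m) of (n, m) \<Rightarrow> h n m)) UNIV)) summable_on UNIV"
      using sA s1 by (simp add: summable_on_UNIV_nonneg_real_iff suminf_nonneg)
  qed
  have inf1: "infsum (h n) UNIV = (\<Sum>m. h n m)" for n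
    using norm_summable_imp_summable_on[OF s1, of n] by (metis has_sum_imp_sums has_sum_infsum sums_unique)
  have inf2: "infsum (\<lambda>n. h n m) UNIV = (\<Sum>n. h n m)" for m
    using norm_summable_imp_summable_on[OF s2, of m] by (metis has_sum_imp_sums has_sum_infsum sums_unique)
  have inf3: "infsum g UNIV = suminf g" if "summable (\<lambda>n. norm (g n))" for g :: "nat \<Rightarrow> complex"
    using norm_summable_imp_summable_on[OF that] by (metis has_sum_imp_sums has_sum_infsum sums_unique)
  show "(\<Sum>n. \<Sum>m. h n m) = (\<Sum>m. \<Sum>n. h n m)"
    using infsum_swap_banach[OF hs] by (simp add: inf1 inf2 inf3[OF sB] inf3[OF sB'])
qed

definition u4 :: "complex \<Rightarrow> complex \<Rightarrow> complex \<Rightarrow> complex \<Rightarrow> complex \<Rightarrow> complex \<Rightarrow> complex \<Rightarrow> complex \<Rightarrow> complex" where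
  "u4 a b c d e f g t = Gamma (a + t) * Gamma (b + t) * Gamma (c + t) * Gamma (d + t) *
     rGamma (1 + t) * rGamma (e + t) * rGamma (f + t) * rGamma (g + t)"

text \<open>The balance condition makes the growth exponent equal to -2, whatever the
  parameters.\<close>

lemma u4_summable_norm:
  assumes "e + f + g = 1 + a + b + c + d" "nonpole (a + u)" "nonpole (b + u)" "nonpole (c + u)" "nonpole (d + u)"
  shows "summable (\<lambda>n. norm (u4 a b c d e f g (u + of_nat n)))"
proof -
  have eq: "Re (a + u + (b + u) + (c + u) - (e + u) - (f + u) - (g + u)) + (Re (d + u) - Re (1 + u)) = - 2"
    using arg_cong[OF assms(1), of Re] by simp
  have "powr_bounded (- 2) (\<lambda>n. u4 a b c d e f g (u + of_nat n))"
    using powr_bounded_mult[OF powr_bounded_Gamma_ratio3[OF assms(2-4), of "e + u" "f + u" "g + u"]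
      powr_bounded_Gamma_ratio[OF assms(5), of "1 + u"], unfolded eq]
    by (simp add: u4_def add.assoc mult_ac)
  thus ?thesis by (rule summable_powr_bounded) simp
qed

lemma u4_summable:
  assumes "e + f + g = 1 + a + b + c + d" "nonpole (a + u)" "nonpole (b + u)" "nonpole (c + u)" "nonpole (d + u)"
  shows "summable (\<lambda>n. u4 a b c d e f g (u + of_nat n))"
  by (rule summable_norm_cancel[OF u4_summable_norm[OF assms]])

text \<open>The kernel \<open>M t k\<close> is a Saalschuetz term in k for fixed t and also in t for
  fixed k. Each direction needs a difference of two series, with k from 0 and 1 - Z and t from 0 and
  1 - e, so four double sums are combined. One window for the real parts serves both directions
  because Z - X - Y = e - a - b.\<close>

lemma pair_series_transform:
  assumes bal: "e + f + g = 1 + a + b + c + d" and re: "Re (e - a - b) > 0" "Re (e - a - b) < 1"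
    and ni: "a \<notin> \<int>" "b \<notin> \<int>" "c \<notin> \<int>" "d \<notin> \<int>" "e \<notin> \<int>" "f \<notin> \<int>" "g \<notin> \<int>"
      "a - e \<notin> \<int>" "b - e \<notin> \<int>" "c - e \<notin> \<int>" "d - e \<notin> \<int>" "f - e \<notin> \<int>" "g - e \<notin> \<int>"
      "c - d \<notin> \<int>" "g - c \<notin> \<int>" "g - d \<notin> \<int>" "f - c \<notin> \<int>" "f - d \<notin> \<int>"
      "f + g - c \<notin> \<int>" "f + g - d \<notin> \<int>" "f + g - c - e \<notin> \<int>" "f + g - d - e \<notin> \<int>"
      "a + c - e \<notin> \<int>" "a + d - e \<notin> \<int>" "b + c - e \<notin> \<int>" "b + d - e \<notin> \<int>"
  shows "Gamma (g - d) * Gamma (f - d) * Gamma (g - c) * Gamma (f - c) * sinpi (1 + c - d) *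
      ((\<Sum>n. u4 a b c d e f g (of_nat n)) - (\<Sum>n. u4 a b c d e f g (1 - e + of_nat n))) =
    Gamma a * Gamma b * Gamma (1 + a - e) * Gamma (1 + b - e) * sinpi e *
      ((\<Sum>n. u4 c (1 + c - e) (g - d) (f - d) (1 + c - d) (1 + b + c - e) (1 + a + c - e) (of_nat n)) -
       (\<Sum>n. u4 c (1 + c - e) (g - d) (f - d) (1 + c - d) (1 + b + c - e) (1 + a + c - e) (1 - (1 + c - d) + of_nat n)))"
proof -
  define s where "s = f + g - c - d"
  have s: "s = 1 + a + b - e" using bal by (simp add: s_def algebra_simps)
  have g: "g = 1 + a + b + c + d - e - f" using bal by (simp add: algebra_simps)
  \<comment> \<open>With these values the Saalschuetz sum over k produces Gamma (c + t) Gamma (d +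
    t) / (Gamma (f + t) Gamma (g + t)), the part of \<open>u4\<close> that \<open>p\<close>
    lacks.\<close>
  define X Y Z where XYZ: "X = g - d" "Y = f - d" "Z = 1 + c - d"
  define p where "p t = gauss_term a b e t" for t
  define q where "q k = gauss_term X Y Z k" for k
  define M where "M t k = p t * q k * (Gamma (c + t + k) * rGamma (s + c + t + k))" for t k
  define \<kappa>1 where "\<kappa>1 = Gamma X * Gamma Y * Gamma (1 + X - Z) * Gamma (1 + Y - Z) * (sinpi Z / of_real pi) * rGamma s"
  define \<kappa>2 where "\<kappa>2 = Gamma a * Gamma b * Gamma (1 + a - e) * Gamma (1 + b - e) * (sinpi e / of_real pi) * rGamma s"
  have M1: "M t k = p t * saal X Y (c + t) Z (s + c + t) k" for t k
    by (simp add: M_def q_def gauss_term_def saal_def mult_ac)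
  have M2: "M t k = q k * saal a b (c + k) e (s + c + k) t" for t k
    by (simp add: M_def p_def gauss_term_def saal_def mult_ac add_ac)
  have ns: "x + t \<notin> \<int>" if "x \<notin> \<int>" "x - e \<notin> \<int>" "u = 0 \<or> u = 1 - e" "t = u + of_nat n" for x t u :: complex and n
    using that(3)
  proof
    assume "u = 0" thus ?thesis using that(4) by (intro nonint_trans[OF that(1)]) auto
  next
    assume "u = 1 - e"
    hence "(x - e) - (x + t) = - of_nat (Suc n)" using that(4) by simp
    also have "\<dots> \<in> \<int>" by (simp del: of_nat_Suc)
    finally show ?thesis by (intro nonint_trans[OF that(2)]) auto
  qed
  have nk: "x + k \<notin> \<int>" if "x \<notin> \<int>" "x + d - c \<notin> \<int>" "\<kappa> = 0 \<or> \<kappa> = 1 - Z" "k = \<kappa> + of_nat n" for x k \<kappa> :: complex and n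
    using that(3)
  proof
    assume "\<kappa> = 0" thus ?thesis using that(4) by (intro nonint_trans[OF that(1)]) auto
  next
    assume "\<kappa> = 1 - Z"
    hence "(x + d - c) - (x + k) = - of_nat n" using that(4) by (simp add: XYZ)
    also have "\<dots> \<in> \<int>" by simp
    finally show ?thesis by (intro nonint_trans[OF that(2)]) auto
  qed
  have ZXY: "Z - X - Y = e - a - b" by (simp add: XYZ g)
  have niZ: "X \<notin> \<int>" "Y \<notin> \<int>" "Z \<notin> \<int>" "X - Z \<notin> \<int>" "Y - Z \<notin> \<int>"
  proof -
    show "X \<notin> \<int>" "Y \<notin> \<int>" using ni by (simp_all add: XYZ)
    show "Z \<notin> \<int>" by (rule nonint_trans[OF ni(14)]) (simp add: XYZ)
    show "X - Z \<notin> \<int>" by (rule nonint_trans[OF ni(15)]) (simp add: XYZ)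
    show "Y - Z \<notin> \<int>" by (rule nonint_trans[OF ni(17)]) (simp add: XYZ)
  qed
  have P1: "(\<Sum>m. M t (0 + of_nat m)) - (\<Sum>m. M t (1 - Z + of_nat m)) = \<kappa>1 * u4 a b c d e f g t"
    if t: "u = 0 \<or> u = 1 - e" "t = u + of_nat n" for t u n
  proof -
    have ct: "c + t \<notin> \<int>" "d + t \<notin> \<int>" "f + t \<notin> \<int>" "g + t \<notin> \<int>" "f + g - c + t \<notin> \<int>" "f + g - d + t \<notin> \<int>"
      by (rule ns[OF _ _ t], use ni in simp, use ni in simp)+
    have eqs: "1 + (c + t) - Z = d + t" "s + c + t - X = f + t" "s + c + t - Y = g + t" "s + c + t - (c + t) = s"
      by (simp_all add: XYZ s_def)
    have bal': "s + c + t = 1 + X + Y + (c + t) - Z" by (simp add: s_def XYZ)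
    have n1: "s + c + t \<notin> \<int>" using ct(6) by (simp add: s_def algebra_simps)
    have n2: "c + t - Z \<notin> \<int>" by (rule nonint_trans[OF ct(2)]) (simp add: XYZ)
    have n3: "s + c + t - Z \<notin> \<int>" by (rule nonint_trans[OF ct(5)]) (simp add: XYZ s_def)
    have n4: "s + c + t - X \<notin> \<int>" "s + c + t - Y \<notin> \<int>" using ct unfolding eqs by simp_all
    have sm: "summable (\<lambda>m. saal X Y (c + t) Z (s + c + t) (0 + of_nat m))"
       by (rule saal_summable[OF bal']) (use niZ ct nonint_not_nonpos_Int in simp_all)
    have sm': "summable (\<lambda>m. saal X Y (c + t) Z (s + c + t) (1 - Z + of_nat m))"
    proof (rule saal_summable[OF bal'])
      show "nonpole (X + (1 - Z))" by (rule nonint_shift[OF niZ(4)]) simp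
      show "nonpole (Y + (1 - Z))" by (rule nonint_shift[OF niZ(5)]) simp
      show "nonpole (c + t + (1 - Z))" by (rule nonint_shift[OF n2]) simp
    qed
    have "(\<Sum>m. saal X Y (c + t) Z (s + c + t) (of_nat m)) - (\<Sum>m. saal X Y (c + t) Z (s + c + t) (1 - Z + of_nat m)) =
       Gamma X * Gamma Y * Gamma (c + t) * Gamma (1 + X - Z) * Gamma (1 + Y - Z) * Gamma (1 + (c + t) - Z) *
       (sinpi Z / of_real pi) * rGamma (s + c + t - X) * rGamma (s + c + t - Y) * rGamma (s + c + t - (c + t))"
      by (rule nonterminating_saalschutz[OF bal']) (use re niZ ct n1 n2 n3 n4 ZXY in simp_all)
    hence "p t * ((\<Sum>m. saal X Y (c + t) Z (s + c + t) (0 + of_nat m)) - (\<Sum>m. saal X Y (c + t) Z (s + c + t) (1 - Z + of_nat m))) =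
       \<kappa>1 * u4 a b c d e f g t"
      unfolding eqs by (simp add: p_def gauss_term_def \<kappa>1_def u4_def mult_ac)
    thus ?thesis unfolding M1 by (simp only: suminf_mult[OF sm] suminf_mult[OF sm'] right_diff_distrib)
  qed
  have P2: "(\<Sum>n. M (0 + of_nat n) k) - (\<Sum>n. M (1 - e + of_nat n) k) =
       \<kappa>2 * u4 c (1 + c - e) X Y Z (1 + b + c - e) (1 + a + c - e) k"
    if k: "\<kappa> = 0 \<or> \<kappa> = 1 - Z" "k = \<kappa> + of_nat m" for k \<kappa> m
  proof -
    have cs: "c + k \<notin> \<int>" "(c - e) + k \<notin> \<int>" "(f + g - d) + k \<notin> \<int>" "(f + g - d - e) + k \<notin> \<int>" "(b + c - e) + k \<notin> \<int>" "(a + c - e) + k \<notin> \<int>"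
      by (rule nk[OF _ _ k], use ni in \<open>simp add: algebra_simps\<close>, use ni in \<open>simp add: algebra_simps\<close>)+
    have eqs: "1 + (c + k) - e = 1 + c - e + k" "s + c + k - a = 1 + b + c - e + k" "s + c + k - b = 1 + a + c - e + k" "s + c + k - (c + k) = s"
      by (simp_all add: s)
    have bal': "s + c + k = 1 + a + b + (c + k) - e" by (simp add: s)
    have n1: "s + c + k \<notin> \<int>" using cs(3) by (simp add: s_def algebra_simps)
    have n2: "c + k - e \<notin> \<int>" using cs(2) by (simp add: algebra_simps)
    have n3: "s + c + k - e \<notin> \<int>" using cs(4) by (simp add: s_def algebra_simps)
    have n4: "s + c + k - a \<notin> \<int>" by (rule nonint_trans[OF cs(5)]) (simp add: s)
    have n5: "s + c + k - b \<notin> \<int>" by (rule nonint_trans[OF cs(6)]) (simp add: s)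
    have sm: "summable (\<lambda>m. saal a b (c + k) e (s + c + k) (0 + of_nat m))"
       by (rule saal_summable[OF bal']) (use ni cs nonint_not_nonpos_Int in simp_all)
    have sm': "summable (\<lambda>m. saal a b (c + k) e (s + c + k) (1 - e + of_nat m))"
    proof (rule saal_summable[OF bal'])
      show "nonpole (a + (1 - e))" by (rule nonint_shift[of "a - e"]) (use ni in simp_all)
      show "nonpole (b + (1 - e))" by (rule nonint_shift[of "b - e"]) (use ni in simp_all)
      show "nonpole (c + k + (1 - e))" by (rule nonint_shift[OF n2]) simp
    qed
    have "(\<Sum>m. saal a b (c + k) e (s + c + k) (of_nat m)) - (\<Sum>m. saal a b (c + k) e (s + c + k) (1 - e + of_nat m)) =
       Gamma a * Gamma b * Gamma (c + k) * Gamma (1 + a - e) * Gamma (1 + b - e) * Gamma (1 + (c + k) - e) *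
       (sinpi e / of_real pi) * rGamma (s + c + k - a) * rGamma (s + c + k - b) * rGamma (s + c + k - (c + k))"
      by (rule nonterminating_saalschutz[OF bal' re(1) less_imp_le[OF re(2)]]) (use ni cs n1 n2 n3 n4 n5 in simp_all)
    hence "q k * ((\<Sum>m. saal a b (c + k) e (s + c + k) (0 + of_nat m)) - (\<Sum>m. saal a b (c + k) e (s + c + k) (1 - e + of_nat m))) =
       \<kappa>2 * u4 c (1 + c - e) X Y Z (1 + b + c - e) (1 + a + c - e) k"
      unfolding eqs by (simp add: q_def gauss_term_def \<kappa>2_def u4_def mult_ac)
    thus ?thesis unfolding M2 by (simp only: suminf_mult[OF sm] suminf_mult[OF sm'] right_diff_distrib)
  qed
  have bd: "\<exists>A B. summable A \<and> summable B \<and> (\<forall>n. A n \<ge> 0) \<and> (\<forall>m. B m \<ge> 0) \<and>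
      (\<forall>n m. norm (M (u + of_nat n) (\<kappa> + of_nat m)) \<le> A n * B m)"
    if u: "u = 0 \<or> u = 1 - e" and \<kappa>: "\<kappa> = 0 \<or> \<kappa> = 1 - Z" for u \<kappa>
  proof -
    have "c + u \<notin> \<int>" "c + u + d - c \<notin> \<int>"
      using ns[OF ni(3,10) u, of "u" 0] ns[OF ni(4,11) u, of "u" 0] by (simp_all add: algebra_simps)
    from nk[OF this \<kappa>, of \<kappa> 0] have "c + u + \<kappa> \<notin> \<int>" by simp
    hence "powr_bounded (Re (c + u + \<kappa>) - Re (s + c + u + \<kappa>)) (\<lambda>n. Gamma (c + u + \<kappa> + of_nat n) * rGamma (s + c + u + \<kappa> + of_nat n))"
      by (intro powr_bounded_Gamma_ratio nonint_not_nonpos_Int)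
    then obtain D where D: "D > 0" "\<And>n. norm (Gamma (c + u + \<kappa> + of_nat n) * rGamma (s + c + u + \<kappa> + of_nat n)) \<le> D * (real n + 1) powr (- Re s)"
      by (auto simp: powr_bounded_def)
    \<comment> \<open>Besides the two Gauss terms, the kernel contains a factor depending on n + m
      only, with growth exponent - Re s < 0. It is bounded, so a product of two Gauss series
      dominates the double series.\<close>
    have D': "norm (Gamma (c + u + \<kappa> + of_nat n) * rGamma (s + c + u + \<kappa> + of_nat n)) \<le> D" for n
    proof -
      have "(real n + 1) powr (- Re s) \<le> (real n + 1) powr 0"
        by (rule powr_mono) (use re(2) in \<open>auto simp: s\<close>)
      hence "D * (real n + 1) powr (- Re s) \<le> D * 1" using D(1) by (intro mult_left_mono) auto
      with D(2)[of n] show ?thesis by simp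
    qed
    have A: "summable (\<lambda>n. norm (p (u + of_nat n)))" unfolding p_def
      by (rule summable_norm_gauss_term) (use ns[OF ni(1,8) u, of "u" 0] ns[OF ni(2,9) u, of "u" 0] re nonint_not_nonpos_Int in simp_all)
    have XY: "X + d - c \<notin> \<int>" "Y + d - c \<notin> \<int>" using ni by (simp_all add: XYZ)
    have B: "summable (\<lambda>n. D * norm (q (\<kappa> + of_nat n)))" unfolding q_def
      by (intro summable_mult summable_norm_gauss_term)
         (use nk[OF niZ(1) XY(1) \<kappa>, of "\<kappa>" 0] nk[OF niZ(2) XY(2) \<kappa>, of "\<kappa>" 0] re ZXY nonint_not_nonpos_Int in simp_all)
    have "norm (M (u + of_nat n) (\<kappa> + of_nat m)) \<le> norm (p (u + of_nat n)) * (D * norm (q (\<kappa> + of_nat m)))" for n m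
    proof -
      have "M (u + of_nat n) (\<kappa> + of_nat m) = p (u + of_nat n) * (q (\<kappa> + of_nat m) *
          (Gamma (c + u + \<kappa> + of_nat (n + m)) * rGamma (s + c + u + \<kappa> + of_nat (n + m))))"
        by (simp add: M_def add_ac mult_ac)
      also have "norm \<dots> \<le> norm (p (u + of_nat n)) * (norm (q (\<kappa> + of_nat m)) * D)"
        unfolding norm_mult[of "p (u + of_nat n)"] norm_mult[of "q (\<kappa> + of_nat m)"]
        by (intro mult_left_mono D') auto
      finally show ?thesis by (simp add: mult_ac)
    qed
    with A B D(1) show ?thesis by (intro exI[of _ "\<lambda>n. norm (p (u + of_nat n))"] exI[of _ "\<lambda>n. D * norm (q (\<kappa> + of_nat n))"]) auto
  qed
  define D where "D u \<kappa> = (\<Sum>n. \<Sum>m. M (u + of_nat n) (\<kappa> + of_nat m))" for u \<kappa>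
  define D' where "D' u \<kappa> = (\<Sum>m. \<Sum>n. M (u + of_nat n) (\<kappa> + of_nat m))" for u \<kappa>
  have DD: "D u \<kappa> = D' u \<kappa>" "summable (\<lambda>n. \<Sum>m. M (u + of_nat n) (\<kappa> + of_nat m))"
     "summable (\<lambda>m. \<Sum>n. M (u + of_nat n) (\<kappa> + of_nat m))"
    if u: "u = 0 \<or> u = 1 - e" and \<kappa>: "\<kappa> = 0 \<or> \<kappa> = 1 - Z" for u \<kappa>
  proof -
    obtain A B where AB: "summable A" "summable B" "\<And>n. A n \<ge> 0" "\<And>m. B m \<ge> 0" "\<And>n m. norm (M (u + of_nat n) (\<kappa> + of_nat m)) \<le> A n * B m"
      using bd[OF u \<kappa>] by blast
    show "D u \<kappa> = D' u \<kappa>" "summable (\<lambda>n. \<Sum>m. M (u + of_nat n) (\<kappa> + of_nat m))"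
      unfolding D_def D'_def using double_sum_swap[of "\<lambda>n m. M (u + of_nat n) (\<kappa> + of_nat m)" A B] AB by auto
    show "summable (\<lambda>m. \<Sum>n. M (u + of_nat n) (\<kappa> + of_nat m))"
      using double_sum_swap(2)[of "\<lambda>m n. M (u + of_nat n) (\<kappa> + of_nat m)" B A] AB by (auto simp: mult.commute)
  qed
  have U: "\<kappa>1 * (\<Sum>n. u4 a b c d e f g (u + of_nat n)) = D u 0 - D u (1 - Z)" if u: "u = 0 \<or> u = 1 - e" for u
  proof -
    have sm: "summable (\<lambda>n. u4 a b c d e f g (u + of_nat n))"
      by (rule u4_summable[OF bal])
         (use ns[OF ni(1,8) u, of "u" 0] ns[OF ni(2,9) u, of "u" 0] ns[OF ni(3,10) u, of "u" 0] ns[OF ni(4,11) u, of "u" 0] nonint_not_nonpos_Int in simp_all)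
    have "\<kappa>1 * (\<Sum>n. u4 a b c d e f g (u + of_nat n)) = (\<Sum>n. (\<Sum>m. M (u + of_nat n) (0 + of_nat m)) - (\<Sum>m. M (u + of_nat n) (1 - Z + of_nat m)))"
      unfolding P1[OF u refl] suminf_mult[OF sm] ..
    also have "\<dots> = D u 0 - D u (1 - Z)"
      unfolding D_def using u by (intro suminf_diff[symmetric] DD) auto
    finally show ?thesis .
  qed
  have U': "\<kappa>2 * (\<Sum>n. u4 c (1 + c - e) X Y Z (1 + b + c - e) (1 + a + c - e) (\<kappa> + of_nat n)) = D' 0 \<kappa> - D' (1 - e) \<kappa>"
    if \<kappa>: "\<kappa> = 0 \<or> \<kappa> = 1 - Z" for \<kappa>
  proof -
    have cc: "c + d - c \<notin> \<int>" "1 + c - e \<notin> \<int>" "1 + c - e + d - c \<notin> \<int>"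
    proof -
      show "c + d - c \<notin> \<int>" using ni by simp
      show "1 + c - e \<notin> \<int>" by (rule nonint_trans[OF ni(10)]) simp
      show "1 + c - e + d - c \<notin> \<int>" by (rule nonint_trans[OF ni(11)]) simp
    qed
    have XY: "X + d - c \<notin> \<int>" "Y + d - c \<notin> \<int>" using ni by (simp_all add: XYZ)
    have bal': "Z + (1 + b + c - e) + (1 + a + c - e) = 1 + c + (1 + c - e) + X + Y"
      by (simp add: XYZ g)
    have sm: "summable (\<lambda>n. u4 c (1 + c - e) X Y Z (1 + b + c - e) (1 + a + c - e) (\<kappa> + of_nat n))"
      by (rule u4_summable[OF bal'])
         (use nk[OF ni(3) cc(1) \<kappa>, of "\<kappa>" 0] nk[OF cc(2,3) \<kappa>, of "\<kappa>" 0] nk[OF niZ(1) XY(1) \<kappa>, of "\<kappa>" 0] nk[OF niZ(2) XY(2) \<kappa>, of "\<kappa>" 0] nonint_not_nonpos_Int in simp_all)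
    have "\<kappa>2 * (\<Sum>n. u4 c (1 + c - e) X Y Z (1 + b + c - e) (1 + a + c - e) (\<kappa> + of_nat n)) = (\<Sum>m. (\<Sum>n. M (0 + of_nat n) (\<kappa> + of_nat m)) - (\<Sum>n. M (1 - e + of_nat n) (\<kappa> + of_nat m)))"
      unfolding P2[OF \<kappa> refl] suminf_mult[OF sm] ..
    also have "\<dots> = D' 0 \<kappa> - D' (1 - e) \<kappa>"
      unfolding D'_def using \<kappa> by (intro suminf_diff[symmetric] DD) auto
    finally show ?thesis .
  qed
  have "\<kappa>1 * ((\<Sum>n. u4 a b c d e f g (of_nat n)) - (\<Sum>n. u4 a b c d e f g (1 - e + of_nat n))) =
    \<kappa>2 * ((\<Sum>n. u4 c (1 + c - e) X Y Z (1 + b + c - e) (1 + a + c - e) (of_nat n)) -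
       (\<Sum>n. u4 c (1 + c - e) X Y Z (1 + b + c - e) (1 + a + c - e) (1 - Z + of_nat n)))"
    using U[of 0] U[of "1 - e"] U'[of 0] U'[of "1 - Z"] DD(1)[of 0 0] DD(1)[of 0 "1 - Z"] DD(1)[of "1 - e" 0] DD(1)[of "1 - e" "1 - Z"]
    by (simp add: right_diff_distrib)
  \<comment> \<open>Both constants contain \<open>rGamma s\<close>. It can be cancelled because Re s
    > 0, by the strict upper bound on Re (e - a - b).\<close>
  moreover have "rGamma s \<noteq> 0"
    using Re_pos_not_nonpos_Int[of s] re(2) by (simp add: s rGamma_inverse_Gamma Gamma_eq_zero_iff)
  moreover have "1 + X - Z = g - c" "1 + Y - Z = f - c" by (simp_all add: XYZ)
  ultimately show ?thesis unfolding \<kappa>1_def \<kappa>2_def unfolding XYZ by (simp add: mult_ac)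
qed

section \<open>The series regularised at its lower parameters, and L in terms of it\<close>

definition hyp_term :: "complex \<Rightarrow> complex \<Rightarrow> complex \<Rightarrow> complex \<Rightarrow> complex \<Rightarrow> complex \<Rightarrow> complex \<Rightarrow> nat \<Rightarrow> complex" where
  "hyp_term a b c d e f g n = pochhammer a n * pochhammer b n * pochhammer c n * pochhammer d n / fact n *
     (rGamma (e + of_nat n) * rGamma (f + of_nat n) * rGamma (g + of_nat n))"

text \<open>The series divided by the Gamma functions of its lower parameters. Unlike
  \<open>hyp4F3\<close> it has no poles on the balanced hyperplane, which is what the analytic
  continuation needs.\<close>

definition hyp_reg :: "complex \<Rightarrow> complex \<Rightarrow> complex \<Rightarrow> complex \<Rightarrow> complex \<Rightarrow> complex \<Rightarrow> complex \<Rightarrow> complex" where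
  "hyp_reg a b c d e f g = (\<Sum>n. hyp_term a b c d e f g n)"

text \<open>The bounds for \<open>pochhammer\<close> and \<open>rGamma\<close> combine to exponent
  -2 by the balance condition. Since \<open>C\<close> depends only on a common bound
  \<open>M\<close> for the parameters, this is a majorant for locally uniform convergence.\<close>

lemma hyp_term_bound:
  obtains C where "C > 0"
    "\<And>a b c d e f g n. norm a \<le> M \<Longrightarrow> norm b \<le> M \<Longrightarrow> norm c \<le> M \<Longrightarrow> norm d \<le> M \<Longrightarrow> norm e \<le> M \<Longrightarrow> norm f \<le> M \<Longrightarrow> norm g \<le> M \<Longrightarrow>
       e + f + g = 1 + a + b + c + d \<Longrightarrow> norm (hyp_term a b c d e f g n) \<le> C * (real n + 1) powr (-2)"
proof -
  obtain C where C: "C > 0"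
    "\<And>z n. norm (z::complex) \<le> M \<Longrightarrow> norm (pochhammer z n) \<le> C * fact n * (real n + 1) powr (Re z - 1)"
    using pochhammer_bound by metis
  obtain D where D: "D > 0"
    "\<And>z n. norm (z::complex) \<le> M \<Longrightarrow> norm (rGamma (z + of_nat n)) \<le> D * (real n + 1) powr (1 - Re z) / fact n"
    using rGamma_bound by metis
  show ?thesis
  proof (rule that)
    show "C ^ 4 * D ^ 3 > 0" using C D by simp
    fix a b c d e f g :: complex and n :: nat
    assume M: "norm a \<le> M" "norm b \<le> M" "norm c \<le> M" "norm d \<le> M" "norm e \<le> M" "norm f \<le> M" "norm g \<le> M"
      and bal: "e + f + g = 1 + a + b + c + d"
    let ?N = "real n + 1"
    have "norm (hyp_term a b c d e f g n) \<le>
      (C * fact n * ?N powr (Re a - 1)) * (C * fact n * ?N powr (Re b - 1)) * (C * fact n * ?N powr (Re c - 1)) * (C * fact n * ?N powr (Re d - 1)) / fact n *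
      ((D * ?N powr (1 - Re e) / fact n) * (D * ?N powr (1 - Re f) / fact n) * (D * ?N powr (1 - Re g) / fact n))"
      unfolding hyp_term_def norm_mult norm_divide norm_fact
      by (intro mult_mono divide_right_mono C D M) (use C D in auto)
    also have "\<dots> = C ^ 4 * D ^ 3 * (?N powr (Re a - 1) * ?N powr (Re b - 1) * ?N powr (Re c - 1) * ?N powr (Re d - 1) *
        ?N powr (1 - Re e) * ?N powr (1 - Re f) * ?N powr (1 - Re g))"
      by (simp add: power_def numeral_eq_Suc field_simps)
    also have "?N powr (Re a - 1) * ?N powr (Re b - 1) * ?N powr (Re c - 1) * ?N powr (Re d - 1) *
        ?N powr (1 - Re e) * ?N powr (1 - Re f) * ?N powr (1 - Re g) =
      ?N powr ((Re a - 1) + (Re b - 1) + (Re c - 1) + (Re d - 1) + (1 - Re e) + (1 - Re f) + (1 - Re g))"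
      by (simp only: powr_add)
    also have "(Re a - 1) + (Re b - 1) + (Re c - 1) + (Re d - 1) + (1 - Re e) + (1 - Re f) + (1 - Re g) = -2"
      using arg_cong[OF bal, of Re] unfolding plus_complex.sel one_complex.sel by linarith
    finally show "norm (hyp_term a b c d e f g n) \<le> C ^ 4 * D ^ 3 * ?N powr (-2)" .
  qed
qed

lemma hyp_term_summable:
  assumes "e + f + g = 1 + a + b + c + d"
  shows "summable (hyp_term a b c d e f g)"
proof -
  define M where "M = norm a + norm b + norm c + norm d + norm e + norm f + norm g"
  obtain C where "C > 0" "\<And>n. norm (hyp_term a b c d e f g n) \<le> C * (real n + 1) powr (-2)"
  proof (rule hyp_term_bound[of M])
    fix C assume C: "C > 0" "\<And>a b c d e f g n. norm a \<le> M \<Longrightarrow> norm b \<le> M \<Longrightarrow> norm c \<le> M \<Longrightarrow> norm d \<le> M \<Longrightarrow> norm e \<le> M \<Longrightarrow> norm f \<le> M \<Longrightarrow> norm g \<le> M \<Longrightarrow>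
       e + f + g = 1 + a + b + c + d \<Longrightarrow> norm (hyp_term a b c d e f g n) \<le> C * (real n + 1) powr (-2)"
    show ?thesis by (rule that[OF C(1)], rule C(2)) (use assms in \<open>auto simp: M_def\<close>)
  qed
  thus ?thesis using summable_norm_cancel[OF summable_powr_bound[of "hyp_term a b c d e f g" C "-2"]] by simp
qed

lemma hyp_reg_eq:
  assumes bal: "e + f + g = 1 + a + b + c + d" and ni: "nonpole e" "nonpole f" "nonpole g"
  shows "hyp_reg a b c d e f g = hyp4F3 a b c d e f g * (rGamma e * rGamma f * rGamma g)"
proof -
  have r: "rGamma (z + of_nat n) = rGamma z / pochhammer z n" if "nonpole z" for z :: complex and n
  proof -
    have "pochhammer z n \<noteq> 0" using that pochhammer_eq_0_imp_nonpos_Int by blast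
    thus ?thesis using pochhammer_rGamma[of z n] by simp
  qed
  have eq: "hyp_term a b c d e f g n = (rGamma e * rGamma f * rGamma g) *
     (pochhammer a n * pochhammer b n * pochhammer c n * pochhammer d n / (fact n * pochhammer e n * pochhammer f n * pochhammer g n))" for n
    unfolding hyp_term_def r[OF ni(1)] r[OF ni(2)] r[OF ni(3)] by (simp add: mult_ac)
  have nz: "rGamma e * rGamma f * rGamma g \<noteq> 0" using ni by (simp add: rGamma_inverse_Gamma Gamma_eq_zero_iff)
  have "summable (\<lambda>n. (rGamma e * rGamma f * rGamma g) *
     (pochhammer a n * pochhammer b n * pochhammer c n * pochhammer d n / (fact n * pochhammer e n * pochhammer f n * pochhammer g n)))"
    using hyp_term_summable[OF bal] by (simp only: eq[abs_def])
  hence "summable (\<lambda>n. pochhammer a n * pochhammer b n * pochhammer c n * pochhammer d n / (fact n * pochhammer e n * pochhammer f n * pochhammer g n))"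
    by (simp only: summable_cmult_iff nz simp_thms)
  from suminf_mult[OF this, of "rGamma e * rGamma f * rGamma g"] show ?thesis
    unfolding hyp_reg_def hyp4F3_def mult.commute[of _ "rGamma e * rGamma f * rGamma g"] eq[abs_def] .
qed

lemma suminf_u4:
  assumes bal: "e + f + g = 1 + a + b + c + d" and ni: "nonpole a" "nonpole b" "nonpole c" "nonpole d"
  shows "(\<Sum>n. u4 a b c d e f g (of_nat n)) = Gamma a * Gamma b * Gamma c * Gamma d * hyp_reg a b c d e f g"
proof -
  have G: "Gamma (z + of_nat n) = Gamma z * pochhammer z n" if "nonpole z" for z :: complex and n
    using pochhammer_Gamma[OF that, of n] that by (simp add: Gamma_eq_zero_iff)
  have 1: "rGamma (1 + of_nat n) = (1 / fact n :: complex)" for n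
    by (simp add: rGamma_inverse_Gamma Gamma_fact divide_inverse)
  have "u4 a b c d e f g (of_nat n) = (Gamma a * Gamma b * Gamma c * Gamma d) * hyp_term a b c d e f g n" for n
    unfolding u4_def hyp_term_def G[OF ni(1)] G[OF ni(2)] G[OF ni(3)] G[OF ni(4)] 1 by simp
  thus ?thesis using suminf_mult[OF hyp_term_summable[OF bal]] by (simp add: hyp_reg_def)
qed

lemma u4_shift: "u4 a b c d e f g (1 - e + t) = u4 (1 + a - e) (1 + b - e) (1 + c - e) (1 + d - e) (2 - e) (1 + f - e) (1 + g - e) t"
  by (simp add: u4_def algebra_simps)

lemma L_fun_reg:
  assumes bal: "e + f + g = 1 + a + b + c + d"
    and ni: "nonpole e" "nonpole f" "nonpole g" "nonpole (2 - e)" "nonpole (1 + f - e)" "nonpole (1 + g - e)"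
  shows "L_fun a b c d e f g =
    (hyp_reg a b c d e f g * (rGamma (1 + a - e) * rGamma (1 + b - e) * rGamma (1 + c - e) * rGamma (1 + d - e))
     - hyp_reg (1 + a - e) (1 + b - e) (1 + c - e) (1 + d - e) (2 - e) (1 + f - e) (1 + g - e) *
         (rGamma a * rGamma b * rGamma c * rGamma d)) / sinpi e"
proof -
  have g: "g = 1 + a + b + c + d - e - f" using bal by (simp add: algebra_simps)
  have bal': "2 - e + (1 + f - e) + (1 + g - e) = 1 + (1 + a - e) + (1 + b - e) + (1 + c - e) + (1 + d - e)"
    by (simp add: g)
  show ?thesis
    unfolding hyp_reg_eq[OF bal ni(1-3)] hyp_reg_eq[OF bal' ni(4-6)] L_fun_def
    by (simp add: diff_divide_distrib mult_ac)
qed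

lemma sinpi_nonzero: "z \<notin> \<int> \<Longrightarrow> sinpi z \<noteq> 0"
proof -
  assume z: "z \<notin> \<int>"
  have "sinpi z = of_real pi * (rGamma z * rGamma (1 - z))"
    by (simp add: rGamma_reflection_complex sinpi_def)
  moreover have "nonpole z" "nonpole (1 - z)" using z[THEN nonint_shift] by auto
  ultimately show "sinpi z \<noteq> 0" by (simp add: rGamma_inverse_Gamma Gamma_eq_zero_iff)
qed

lemma Gamma_rGamma4:
  assumes "nonpole x" "nonpole y" "nonpole z" "nonpole w"
  shows "(Gamma x * Gamma y * Gamma z * Gamma w) * (rGamma x * rGamma y * rGamma z * rGamma w) = (1 :: complex)"
  using assms by (simp add: rGamma_inverse_Gamma Gamma_eq_zero_iff field_simps)

lemma L_fun_series:
  assumes bal: "e + f + g = 1 + a + b + c + d"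
    and ni: "a \<notin> \<int>" "b \<notin> \<int>" "c \<notin> \<int>" "d \<notin> \<int>" "e \<notin> \<int>" "f \<notin> \<int>" "g \<notin> \<int>"
      "a - e \<notin> \<int>" "b - e \<notin> \<int>" "c - e \<notin> \<int>" "d - e \<notin> \<int>" "f - e \<notin> \<int>" "g - e \<notin> \<int>"
  shows "sinpi e * (Gamma a * Gamma b * Gamma c * Gamma d) * (Gamma (1 + a - e) * Gamma (1 + b - e) * Gamma (1 + c - e) * Gamma (1 + d - e)) *
      L_fun a b c d e f g = (\<Sum>n. u4 a b c d e f g (of_nat n)) - (\<Sum>n. u4 a b c d e f g (1 - e + of_nat n))"
proof -
  have g: "g = 1 + a + b + c + d - e - f" using bal by (simp add: algebra_simps)
  have bal': "2 - e + (1 + f - e) + (1 + g - e) = 1 + (1 + a - e) + (1 + b - e) + (1 + c - e) + (1 + d - e)"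
    by (simp add: g)
  have n: "nonpole a" "nonpole b" "nonpole c" "nonpole d" "nonpole e" "nonpole f" "nonpole g" "nonpole (2 - e)"
     "nonpole (1 + a - e)" "nonpole (1 + b - e)" "nonpole (1 + c - e)" "nonpole (1 + d - e)" "nonpole (1 + f - e)" "nonpole (1 + g - e)"
    by (rule nonint_not_nonpos_Int, simp add: ni Ints_shift_iff)+
  have s: "sinpi e \<noteq> 0" by (rule sinpi_nonzero[OF ni(5)])
  have alg: "s * P * Q * ((H * q - H' * p) / s) = P * H - Q * H'" if "s \<noteq> 0" "P * p = 1" "Q * q = 1" for s P Q H H' p q :: complex
  proof -
    have "s * P * Q * ((H * q - H' * p) / s) = P * Q * (H * q - H' * p)"
      using that(1) by simp
    also have "\<dots> = P * H * (Q * q) - Q * H' * (P * p)" by (simp add: algebra_simps)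
    finally show ?thesis unfolding that by simp
  qed
  show ?thesis
    unfolding suminf_u4[OF bal n(1-4)] u4_shift suminf_u4[OF bal' n(9-12)] L_fun_reg[OF bal n(5-8) n(13-14)]
    by (rule alg[OF s]; rule Gamma_rGamma4; fact n)
qed

text \<open>In the normalisation of L, both sides of \<open>pair_series_transform\<close> carry the
  same twelve Gamma factors and two sines, so the transformation holds without any factor.\<close>

lemma L_fun_transform:
  assumes bal: "e + f + g = 1 + a + b + c + d" and re: "Re (e - a - b) > 0" "Re (e - a - b) < 1"
    and ni: "a \<notin> \<int>" "b \<notin> \<int>" "c \<notin> \<int>" "d \<notin> \<int>" "e \<notin> \<int>" "f \<notin> \<int>" "g \<notin> \<int>"
      "a - e \<notin> \<int>" "b - e \<notin> \<int>" "c - e \<notin> \<int>" "d - e \<notin> \<int>" "f - e \<notin> \<int>" "g - e \<notin> \<int>"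
      "c - d \<notin> \<int>" "g - c \<notin> \<int>" "g - d \<notin> \<int>" "f - c \<notin> \<int>" "f - d \<notin> \<int>"
      "f + g - c \<notin> \<int>" "f + g - d \<notin> \<int>" "f + g - c - e \<notin> \<int>" "f + g - d - e \<notin> \<int>"
      "a + c - e \<notin> \<int>" "a + d - e \<notin> \<int>" "b + c - e \<notin> \<int>" "b + d - e \<notin> \<int>"
  shows "L_fun a b c d e f g = L_fun c (1 + c - e) (g - d) (f - d) (1 + c - d) (1 + b + c - e) (1 + a + c - e)"
proof -
  have g: "g = 1 + a + b + c + d - e - f" using bal by (simp add: algebra_simps)
  have bal': "(1 + c - d) + (1 + b + c - e) + (1 + a + c - e) = 1 + c + (1 + c - e) + (g - d) + (f - d)"
    by (simp add: g)
  have n: "nonpole a" "nonpole b" "nonpole c" "nonpole d" "nonpole (1 + a - e)" "nonpole (1 + b - e)" "nonpole (1 + c - e)" "nonpole (1 + d - e)" "nonpole (g - c)" "nonpole (g - d)" "nonpole (f - c)" "nonpole (f - d)"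
    by (rule nonint_not_nonpos_Int, simp add: ni Ints_shift_iff)+
  have n': "1 + c - e \<notin> \<int>" "1 + c - d \<notin> \<int>" "1 + b + c - e \<notin> \<int>" "1 + a + c - e \<notin> \<int>" "c - (1 + c - d) \<notin> \<int>" "1 + c - e - (1 + c - d) \<notin> \<int>"
    "g - d - (1 + c - d) \<notin> \<int>" "f - d - (1 + c - d) \<notin> \<int>" "1 + b + c - e - (1 + c - d) \<notin> \<int>" "1 + a + c - e - (1 + c - d) \<notin> \<int>"
    by (rule nonint_trans[OF ni(10)], simp, rule nonint_trans[OF ni(14)], simp, rule nonint_trans[OF ni(25)], simp, rule nonint_trans[OF ni(23)], simp,
        rule nonint_trans[OF ni(4)], simp, rule nonint_trans[OF ni(11)], simp, rule nonint_trans[OF ni(15)], simp, rule nonint_trans[OF ni(17)], simp,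
        rule nonint_trans[OF ni(26)], simp, rule nonint_trans[OF ni(24)], simp)
  have se: "sinpi e \<noteq> 0" "sinpi (1 + c - d) \<noteq> 0" by (intro sinpi_nonzero ni n')+
  have eqs: "1 + c - (1 + c - d) = d" "1 + (1 + c - e) - (1 + c - d) = 1 + d - e" "1 + (g - d) - (1 + c - d) = g - c"
    "1 + (f - d) - (1 + c - d) = f - c" by simp_all
  note A = L_fun_series[OF bal ni(1-13)]
  note B = L_fun_series[OF bal' ni(3) n'(1) ni(16) ni(18) n'(2-10), unfolded eqs]
  have "Gamma (g - d) * Gamma (f - d) * Gamma (g - c) * Gamma (f - c) * sinpi (1 + c - d) *
      (sinpi e * (Gamma a * Gamma b * Gamma c * Gamma d) * (Gamma (1 + a - e) * Gamma (1 + b - e) * Gamma (1 + c - e) * Gamma (1 + d - e)) *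
      L_fun a b c d e f g) =
    Gamma a * Gamma b * Gamma (1 + a - e) * Gamma (1 + b - e) * sinpi e *
      (sinpi (1 + c - d) * (Gamma c * Gamma (1 + c - e) * Gamma (g - d) * Gamma (f - d)) * (Gamma d * Gamma (1 + d - e) * Gamma (g - c) * Gamma (f - c)) *
       L_fun c (1 + c - e) (g - d) (f - d) (1 + c - d) (1 + b + c - e) (1 + a + c - e))"
    unfolding A B by (rule pair_series_transform[OF bal re ni])
  also have "Gamma (g - d) * Gamma (f - d) * Gamma (g - c) * Gamma (f - c) * sinpi (1 + c - d) *
      (sinpi e * (Gamma a * Gamma b * Gamma c * Gamma d) * (Gamma (1 + a - e) * Gamma (1 + b - e) * Gamma (1 + c - e) * Gamma (1 + d - e)) *
      L_fun a b c d e f g) = Gamma a * Gamma b * Gamma (1 + a - e) * Gamma (1 + b - e) * sinpi e *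
      (sinpi (1 + c - d) * (Gamma c * Gamma (1 + c - e) * Gamma (g - d) * Gamma (f - d)) * (Gamma d * Gamma (1 + d - e) * Gamma (g - c) * Gamma (f - c)) *
       L_fun a b c d e f g)"
    by (simp only: mult_ac)
  finally have "Gamma a * Gamma b * Gamma (1 + a - e) * Gamma (1 + b - e) * sinpi e *
      (sinpi (1 + c - d) * (Gamma c * Gamma (1 + c - e) * Gamma (g - d) * Gamma (f - d)) * (Gamma d * Gamma (1 + d - e) * Gamma (g - c) * Gamma (f - c)) *
       L_fun a b c d e f g) = Gamma a * Gamma b * Gamma (1 + a - e) * Gamma (1 + b - e) * sinpi e *
      (sinpi (1 + c - d) * (Gamma c * Gamma (1 + c - e) * Gamma (g - d) * Gamma (f - d)) * (Gamma d * Gamma (1 + d - e) * Gamma (g - c) * Gamma (f - c)) *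
       L_fun c (1 + c - e) (g - d) (f - d) (1 + c - d) (1 + b + c - e) (1 + a + c - e))" .
  thus ?thesis using n se by (simp add: Gamma_eq_zero_iff)
qed

lemma L_fun_perm:
  "L_fun a b c d e f g = L_fun b a c d e f g" "L_fun a b c d e f g = L_fun a c b d e f g"
  "L_fun a b c d e f g = L_fun a b d c e f g" "L_fun a b c d e f g = L_fun a b c d e g f"
  by (simp_all only: L_fun_def hyp4F3_def mult_ac)

text \<open>The composition of two instances of \<open>L_fun_transform\<close>. The window of the
  second one is that for e - c - d, hence the additional conditions on the real parts.\<close>

lemma L_fun_dual:
  assumes bal: "e + f + g = 1 + a + b + c + d" and re: "Re (e - a - b) > 0" "Re (e - a - b) < 1" "Re (e - c - d) > 0" "Re (e - c - d) < 1"
    and ni: "a \<notin> \<int>" "b \<notin> \<int>" "c \<notin> \<int>" "d \<notin> \<int>" "e \<notin> \<int>" "f \<notin> \<int>" "g \<notin> \<int>"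
      "a - e \<notin> \<int>" "b - e \<notin> \<int>" "c - e \<notin> \<int>" "d - e \<notin> \<int>" "f - e \<notin> \<int>" "g - e \<notin> \<int>"
      "c - d \<notin> \<int>" "g - c \<notin> \<int>" "g - d \<notin> \<int>" "f - c \<notin> \<int>" "f - d \<notin> \<int>"
      "f + g - c \<notin> \<int>" "f + g - d \<notin> \<int>" "f + g - c - e \<notin> \<int>" "f + g - d - e \<notin> \<int>"
      "a + c - e \<notin> \<int>" "a + d - e \<notin> \<int>" "b + c - e \<notin> \<int>" "b + d - e \<notin> \<int>"
      "f - g \<notin> \<int>" "g - a \<notin> \<int>" "g - b \<notin> \<int>" "f - a \<notin> \<int>" "f - b \<notin> \<int>"
      "c + g - e \<notin> \<int>" "c + f - e \<notin> \<int>" "d + g - e \<notin> \<int>" "d + f - e \<notin> \<int>"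
  shows "L_fun a b c d e f g = L_fun (f - a) (f - b) (f - c) (f - d) (1 + f - g) f (1 + f - e)"
proof -
  have g: "g = 1 + a + b + c + d - e - f" using bal by (simp add: algebra_simps)
  have eq: "(1 + c - d) - c - (1 + c - e) = e - c - d" by simp
  have "L_fun a b c d e f g = L_fun c (1 + c - e) (g - d) (f - d) (1 + c - d) (1 + b + c - e) (1 + a + c - e)"
    by (rule L_fun_transform[OF bal re(1,2) ni(1-26)])
  \<comment> \<open>The order of the last two upper parameters decides whether the second
    transformation leads to 1 + f - g or to 1 + g - f.\<close>
  also have "\<dots> = L_fun c (1 + c - e) (f - d) (g - d) (1 + c - d) (1 + b + c - e) (1 + a + c - e)"
    by (rule L_fun_perm)
  also have "\<dots> = L_fun (f - d) (1 + (f - d) - (1 + c - d)) (1 + a + c - e - (g - d)) (1 + b + c - e - (g - d)) (1 + (f - d) - (g - d))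
      (1 + (1 + c - e) + (f - d) - (1 + c - d)) (1 + c + (f - d) - (1 + c - d))"
  proof (rule L_fun_transform)
    show "(1 + c - d) + (1 + b + c - e) + (1 + a + c - e) = 1 + c + (1 + c - e) + (f - d) + (g - d)"
      by (simp add: g)
    show "Re ((1 + c - d) - c - (1 + c - e)) > 0" "Re ((1 + c - d) - c - (1 + c - e)) < 1" unfolding eq by (fact re)+
    show "c \<notin> \<int>" "f - d \<notin> \<int>" "g - d \<notin> \<int>" by (fact ni)+
    show "1 + c - e \<notin> \<int>" by (rule nonint_trans[OF ni(10)]) simp
    show "1 + c - d \<notin> \<int>" by (rule nonint_trans[OF ni(14)]) simp
    show "1 + b + c - e \<notin> \<int>" by (rule nonint_trans[OF ni(25)]) simp
    show "1 + a + c - e \<notin> \<int>" by (rule nonint_trans[OF ni(23)]) simp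
    show "c - (1 + c - d) \<notin> \<int>" by (rule nonint_trans[OF ni(4)]) simp
    show "1 + c - e - (1 + c - d) \<notin> \<int>" by (rule nonint_trans[OF ni(11)]) simp
    show "f - d - (1 + c - d) \<notin> \<int>" by (rule nonint_trans[OF ni(17)]) simp
    show "g - d - (1 + c - d) \<notin> \<int>" by (rule nonint_trans[OF ni(15)]) simp
    show "1 + b + c - e - (1 + c - d) \<notin> \<int>" by (rule nonint_trans[OF ni(26)]) simp
    show "1 + a + c - e - (1 + c - d) \<notin> \<int>" by (rule nonint_trans[OF ni(24)]) simp
    show "f - d - (g - d) \<notin> \<int>" by (rule nonint_trans[OF ni(27)]) simp
    show "1 + a + c - e - (f - d) \<notin> \<int>" by (rule nonint_trans[OF ni(29)]) (simp add: g)
    show "1 + a + c - e - (g - d) \<notin> \<int>" by (rule nonint_trans[OF ni(31)]) (simp add: g)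
    show "1 + b + c - e - (f - d) \<notin> \<int>" by (rule nonint_trans[OF ni(28)]) (simp add: g)
    show "1 + b + c - e - (g - d) \<notin> \<int>" by (rule nonint_trans[OF ni(30)]) (simp add: g)
    show "1 + b + c - e + (1 + a + c - e) - (f - d) \<notin> \<int>" by (rule nonint_trans[OF ni(32)]) (simp add: g)
    show "1 + b + c - e + (1 + a + c - e) - (g - d) \<notin> \<int>" by (rule nonint_trans[OF ni(33)]) (simp add: g)
    show "1 + b + c - e + (1 + a + c - e) - (f - d) - (1 + c - d) \<notin> \<int>" by (rule nonint_trans[OF ni(34)]) (simp add: g)
    show "1 + b + c - e + (1 + a + c - e) - (g - d) - (1 + c - d) \<notin> \<int>" by (rule nonint_trans[OF ni(35)]) (simp add: g)
    show "c + (f - d) - (1 + c - d) \<notin> \<int>" by (rule nonint_trans[OF ni(6)]) simp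
    show "c + (g - d) - (1 + c - d) \<notin> \<int>" by (rule nonint_trans[OF ni(7)]) simp
    show "1 + c - e + (f - d) - (1 + c - d) \<notin> \<int>" by (rule nonint_trans[OF ni(12)]) simp
    show "1 + c - e + (g - d) - (1 + c - d) \<notin> \<int>" by (rule nonint_trans[OF ni(13)]) simp
  qed
  also have "\<dots> = L_fun (f - d) (f - c) (f - b) (f - a) (1 + f - g) (1 + f - e) f"
  proof -
    have "1 + (f - d) - (1 + c - d) = f - c" "1 + a + c - e - (g - d) = f - b" "1 + b + c - e - (g - d) = f - a"
      "1 + (f - d) - (g - d) = 1 + f - g" "1 + (1 + c - e) + (f - d) - (1 + c - d) = 1 + f - e" "1 + c + (f - d) - (1 + c - d) = f"
      by (simp_all add: g)
    thus ?thesis by (simp only:)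
  qed
  also have "\<dots> = L_fun (f - a) (f - b) (f - c) (f - d) (1 + f - g) f (1 + f - e)"
    by (simp only: L_fun_def hyp4F3_def mult_ac)
  finally show ?thesis .
qed

section \<open>A residue relation\<close>

text \<open>The summands are the residues of \<open>p\<close> divided by the product of all w - y.
  As \<open>p\<close> coincides with its Lagrange interpolant, comparing top coefficients gives
  their sum.\<close>

lemma lagrange_sum:
  fixes p :: "complex poly"
  assumes X: "finite X" and deg: "degree p < card X"
  shows "(\<Sum>x\<in>X. poly p x / (\<Prod>y\<in>X-{x}. x - y)) = coeff p (card X - 1)"
proof -
  define L where "L x = (\<Prod>y\<in>X-{x}. [:-y, 1:])" for x :: complex
  define q where "q = (\<Sum>x\<in>X. smult (poly p x / (\<Prod>y\<in>X-{x}. x - y)) (L x))"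
  have degL: "degree (L x) = card X - 1" "lead_coeff (L x) = 1" if "x \<in> X" for x
  proof -
    have "degree (L x) = (\<Sum>y\<in>X-{x}. degree [:-y, 1:])"
      unfolding L_def by (rule degree_prod_eq_sum_degree) auto
    thus "degree (L x) = card X - 1" using X that by simp
    show "lead_coeff (L x) = 1" unfolding L_def by (simp add: lead_coeff_prod)
  qed
  have q_eval: "poly q x = poly p x" if x: "x \<in> X" for x
  proof -
    have "poly q x = (\<Sum>z\<in>X. poly p z / (\<Prod>y\<in>X-{z}. z - y) * (\<Prod>y\<in>X-{z}. x - y))"
      by (simp add: q_def L_def poly_sum poly_prod)
    also have "\<dots> = (\<Sum>z\<in>X. if z = x then poly p x else 0)"
    proof (rule sum.cong)
      fix z assume z: "z \<in> X"
      show "poly p z / (\<Prod>y\<in>X-{z}. z - y) * (\<Prod>y\<in>X-{z}. x - y) = (if z = x then poly p x else 0)"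
      proof (cases "z = x")
        case True
        have "(\<Prod>y\<in>X-{x}. x - y) \<noteq> 0" using X by (auto simp: prod_zero_iff)
        with True show ?thesis by simp
      next
        case False
        hence "(\<Prod>y\<in>X-{z}. x - y) = 0" using X x by (intro prod_zero) auto
        thus ?thesis using False by simp
      qed
    qed simp
    finally show ?thesis using X x by simp
  qed
  have degq: "degree q \<le> card X - 1"
    unfolding q_def by (intro degree_sum_le X order.trans[OF degree_smult_le]) (use degL in auto)
  have "p = q"
  proof (rule poly_eqI_degree)
    show "poly p x = poly q x" if "x \<in> X" for x using q_eval[OF that] by simp
    show "degree p < card X" by (rule deg)
    show "degree q < card X" using degq deg by simp
  qed
  hence "coeff p (card X - 1) = coeff q (card X - 1)" by simp
  also have "\<dots> = (\<Sum>x\<in>X. poly p x / (\<Prod>y\<in>X-{x}. x - y) * coeff (L x) (card X - 1))"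
    by (simp add: q_def coeff_sum)
  also have "\<dots> = (\<Sum>x\<in>X. poly p x / (\<Prod>y\<in>X-{x}. x - y))"
    using degL by (intro sum.cong) auto
  finally show ?thesis ..
qed

text \<open>Applied with s = 1 and s = -1. The norm of the leading coefficient is enough, because
  only the norm of the total residue sum enters the limit.\<close>

lemma pochhammer_poly:
  fixes \<gamma> s :: complex
  assumes "norm s = 1"
  obtains p where "degree p = n" "norm (lead_coeff p) = 1" "\<And>t. poly p t = pochhammer (\<gamma> + s * t) n"
proof -
  have "\<exists>p. degree p = n \<and> norm (lead_coeff p) = 1 \<and> (\<forall>t. poly p t = pochhammer (\<gamma> + s * t) n)"
  proof (induction n)
    case 0
    show ?case by (rule exI[of _ 1]) simp
  next
    case (Suc n)
    then obtain p where p: "degree p = n" "norm (lead_coeff p) = 1" "\<And>t. poly p t = pochhammer (\<gamma> + s * t) n" by blast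
    have s: "s \<noteq> 0" using assms by auto
    have "p \<noteq> 0" using p(2) by auto
    hence "degree (p * [:\<gamma> + of_nat n, s:]) = Suc n" using s p(1) by (subst degree_mult_eq) auto
    moreover have "norm (lead_coeff (p * [:\<gamma> + of_nat n, s:])) = 1"
      unfolding lead_coeff_mult norm_mult using p(2) s assms by simp
    moreover have "poly (p * [:\<gamma> + of_nat n, s:]) t = pochhammer (\<gamma> + s * t) (Suc n)" for t
      by (simp add: p(3) pochhammer_Suc algebra_simps)
    ultimately show ?case by blast
  qed
  thus ?thesis using that by blast
qed

text \<open>The first n factors run from 1 - b - n up to -b and are, up to sign, those of
  \<open>pochhammer b n\<close>; the remaining ones start at 1 - b.\<close>

lemma pochhammer_reflect:
  fixes b :: complex
  assumes "n \<le> M"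
  shows "pochhammer (1 - b - of_nat n) M = (-1) ^ n * pochhammer b n * pochhammer (1 - b) (M - n)"
proof -
  have "pochhammer (1 - b - of_nat n) M = pochhammer (1 - b - of_nat n) n * pochhammer (1 - b - of_nat n + of_nat n) (M - n)"
    using assms by (rule pochhammer_product)
  also have "pochhammer (1 - b - of_nat n) n = (-1) ^ n * pochhammer b n"
    using pochhammer_minus'[of "- b" n] pochhammer_minus[of "b + of_nat n - 1" n] by (simp add: algebra_simps)
  finally show ?thesis by simp
qed

lemma prod_diff_self:
  assumes "n \<le> N"
  shows "(\<Prod>k\<in>{..N}-{n}. of_nat n - of_nat k :: complex) = (-1) ^ (N - n) * fact n * fact (N - n)"
  using assms
proof (induction N rule: dec_induct)
  case base
  have "(\<Prod>k\<in>{..n}-{n}. of_nat n - of_nat k :: complex) = (\<Prod>k\<in>{..<n}. of_nat (n - k))"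
    by (intro prod.cong) (auto simp: of_nat_diff)
  also have "\<dots> = of_nat (\<Prod>k\<in>{..<n}. n - k)" by simp
  also have "(\<Prod>k\<in>{..<n}. n - k) = fact n"
    by (simp add: fact_prod_rev atLeast0LessThan)
  finally show ?case by simp
next
  case (step N)
  have "{..Suc N} - {n} = insert (Suc N) ({..N} - {n})" using step by auto
  hence "(\<Prod>k\<in>{..Suc N}-{n}. of_nat n - of_nat k :: complex) = (of_nat n - of_nat (Suc N)) * (\<Prod>k\<in>{..N}-{n}. of_nat n - of_nat k)"
    by simp
  also have "of_nat n - of_nat (Suc N) = - (of_nat (Suc (N - n)) :: complex)"
    using step by (simp add: of_nat_diff)
  finally show ?case using step by (simp add: Suc_diff_le fact_Suc del: of_nat_Suc)
qed

text \<open>For fixed n the weight \<Phi> (N - n) \<Psi> (N + n) is asymptotic to N, by the limit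
  assumption with M = N - n. For a majorant, p, q >= 0 and p + q = 1 bound it by a multiple of (N -
  n + 1)^p (N + n + 1)^q, which is at most 2 (N + 1).\<close>

lemma weighted_limit:
  fixes h \<Phi> \<Psi> :: "nat \<Rightarrow> complex"
  assumes h: "summable (\<lambda>n. norm (h n))" and \<Phi>: "powr_bounded p \<Phi>" and \<Psi>: "powr_bounded q \<Psi>"
    and pq: "p + q = 1" "p \<ge> 0" "q \<ge> 0"
    and lim: "\<And>n. (\<lambda>M. \<Phi> M * \<Psi> (M + 2 * n) * exp (- of_real (ln (real M)))) \<longlonglongrightarrow> 1"
  shows "(\<lambda>N. (\<Sum>n\<le>N. h n * (\<Phi> (N - n) * \<Psi> (N + n))) / of_nat (Suc N)) \<longlonglongrightarrow> (\<Sum>n. h n)"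
proof -
  define t where "t n N = (if n \<le> N then h n * (\<Phi> (N - n) * \<Psi> (N + n)) / of_nat (Suc N) else 0)" for n N
  obtain C where C: "C > 0" "\<And>n. norm (\<Phi> n) \<le> C * (real n + 1) powr p"
    using \<Phi> by (auto simp: powr_bounded_def)
  obtain D where D: "D > 0" "\<And>n. norm (\<Psi> n) \<le> D * (real n + 1) powr q"
    using \<Psi> by (auto simp: powr_bounded_def)
  have "(\<lambda>N. \<Sum>n. t n N) \<longlonglongrightarrow> (\<Sum>n. h n)"
  proof (rule tannery_sequentially)
    fix n
    have "(\<lambda>M. of_nat (Suc n) / of_nat (M + Suc n) :: complex) \<longlonglongrightarrow> 0"
      by (rule LIMSEQ_ignore_initial_segment) (rule lim_const_over_n)
    hence "(\<lambda>M. 1 - of_nat (Suc n) / of_nat (M + Suc n) :: complex) \<longlonglongrightarrow> 1 - 0"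
      by (intro tendsto_intros)
    moreover have "1 - of_nat (Suc n) / of_nat (M + Suc n) = (of_nat M / of_nat (Suc (M + n)) :: complex)" for M
    proof -
      have "of_nat (Suc (M + n)) \<noteq> (0 :: complex)" by (simp only: of_nat_eq_0_iff)
      hence "1 - of_nat (Suc n) / of_nat (Suc (M + n)) = (of_nat (Suc (M + n)) - of_nat (Suc n)) / (of_nat (Suc (M + n)) :: complex)"
        by (simp add: diff_divide_distrib del: of_nat_Suc of_nat_add)
      thus ?thesis by simp
    qed
    ultimately have l: "(\<lambda>M. of_nat M / of_nat (Suc (M + n)) :: complex) \<longlonglongrightarrow> 1" by simp
    \<comment> \<open>The limit is taken along N = M + n, which removes the truncated subtraction N
      - n.\<close>
    have "(\<lambda>M. h n * (\<Phi> M * \<Psi> (M + 2 * n) * exp (- of_real (ln (real M)))) * (of_nat M / of_nat (Suc (M + n)))) \<longlonglongrightarrow> h n * 1 * 1"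
      by (intro tendsto_mult tendsto_const lim l)
    moreover have "\<forall>\<^sub>F M in sequentially. h n * (\<Phi> M * \<Psi> (M + 2 * n) * exp (- of_real (ln (real M)))) * (of_nat M / of_nat (Suc (M + n))) = t n (M + n)"
      using eventually_gt_at_top[of 0]
    proof eventually_elim
      case (elim M)
      have "exp (- of_real (ln (real M))) = (1 / of_nat M :: complex)"
        using elim by (simp add: exp_minus exp_of_real inverse_eq_divide)
      thus ?case using elim by (simp add: t_def mult_2 add_ac)
    qed
    ultimately have "(\<lambda>M. t n (M + n)) \<longlonglongrightarrow> h n"
      using tendsto_cong by fastforce
    thus "(\<lambda>N. t n N) \<longlonglongrightarrow> h n" by (rule LIMSEQ_offset)
  next
    fix n N :: nat
    show "norm (t n N) \<le> norm (h n) * (2 * C * D)"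
    proof (cases "n \<le> N")
      case True
      have "norm (\<Phi> (N - n)) \<le> C * (real N + 1) powr p"
        by (rule order.trans[OF C(2)]) (use C pq in \<open>auto intro!: mult_left_mono powr_mono2\<close>)
      moreover have "norm (\<Psi> (N + n)) \<le> 2 * D * (real N + 1) powr q"
      proof -
        have "(real (N + n) + 1) powr q \<le> (2 * (real N + 1)) powr q"
          using True pq by (intro powr_mono2) auto
        also have "\<dots> = 2 powr q * (real N + 1) powr q" by (subst powr_mult) auto
        also have "\<dots> \<le> 2 powr 1 * (real N + 1) powr q"
          using pq by (intro mult_right_mono powr_mono) auto
        finally have "D * (real (N + n) + 1) powr q \<le> D * (2 powr 1 * (real N + 1) powr q)"
          using D by (intro mult_left_mono) auto
        with D(2)[of "N + n"] show ?thesis by simp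
      qed
      ultimately have "norm (\<Phi> (N - n) * \<Psi> (N + n)) \<le> (C * (real N + 1) powr p) * (2 * D * (real N + 1) powr q)"
        unfolding norm_mult using C by (intro mult_mono) auto
      also have "\<dots> = 2 * C * D * ((real N + 1) powr p * (real N + 1) powr q)" by simp
      also have "(real N + 1) powr p * (real N + 1) powr q = real (Suc N)"
        unfolding powr_add[symmetric] pq by simp
      finally have "norm (\<Phi> (N - n) * \<Psi> (N + n)) / real (Suc N) \<le> 2 * C * D"
        by (simp add: divide_simps del: of_nat_Suc)
      hence "norm (h n) * (norm (\<Phi> (N - n) * \<Psi> (N + n)) / real (Suc N)) \<le> norm (h n) * (2 * C * D)"
        by (intro mult_left_mono) auto
      thus ?thesis using True by (simp add: t_def norm_mult norm_divide del: of_nat_Suc)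
    qed (use C D in \<open>simp add: t_def\<close>)
  next
    show "summable (\<lambda>n. norm (h n) * (2 * C * D))" by (intro summable_mult2 h)
  qed
  moreover have "(\<Sum>n. t n N) = (\<Sum>n\<le>N. h n * (\<Phi> (N - n) * \<Psi> (N + n))) / of_nat (Suc N)" for N
  proof -
    have "(\<Sum>n. t n N) = (\<Sum>n\<le>N. t n N)" by (rule suminf_finite) (auto simp: t_def)
    thus ?thesis by (simp add: t_def sum_divide_distrib)
  qed
  ultimately show ?thesis by simp
qed

section \<open>Residues of a rational truncation and their limits\<close>

lemma pochhammer_reflect_Gamma:
  assumes b: "b \<notin> \<int>" and n: "n \<le> M"
  shows "pochhammer (1 - b - of_nat n) M = (-1) ^ n * (sinpi b / of_real pi) * Gamma (b + of_nat n) * Gamma (1 - b + of_nat (M - n))"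
proof -
  have ni: "nonpole b" "nonpole (1 - b)" by (rule nonint_shift[OF b], simp)+
  have "Gamma b * Gamma (1 - b) = of_real pi / sinpi b"
    by (simp add: Gamma_reflection_complex sinpi_def)
  thus ?thesis
    unfolding pochhammer_reflect[OF n] pochhammer_Gamma[OF ni(1)] pochhammer_Gamma[OF ni(2)]
    using ni by (simp add: Gamma_eq_zero_iff field_simps)
qed

lemma pochhammer_shift_Gamma:
  fixes a :: complex
  assumes "a \<notin> \<int>"
  shows "pochhammer (a + of_nat n) M = Gamma (a + of_nat (M + n)) * rGamma (a + of_nat n)"
proof -
  have ni: "nonpole (a + of_nat n)" by (rule nonint_shift[OF assms]) simp
  show ?thesis unfolding pochhammer_Gamma[OF ni] by (simp add: rGamma_inverse_Gamma divide_inverse add_ac)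
qed

text \<open>The residues of a rational truncation of
  \<open>\<Gamma>(a + t) \<Gamma>(x - t) \<Gamma>(y - t) \<Gamma>(z - t) / (\<Gamma>(p - t) \<Gamma>(q - t) \<Gamma>(r - t) \<Gamma>(g + t))\<close>
  at \<open>t = x + n\<close> and at \<open>t = - a - n\<close>.\<close>

definition res_plus :: "nat \<Rightarrow> complex \<Rightarrow> complex \<Rightarrow> complex \<Rightarrow> complex \<Rightarrow> complex \<Rightarrow> complex \<Rightarrow> complex \<Rightarrow> complex \<Rightarrow> nat \<Rightarrow> complex" where
  "res_plus N a x y z p q r g n =
     pochhammer (p - x - of_nat n) (Suc N) * pochhammer (q - x - of_nat n) (Suc N) * pochhammer (r - x - of_nat n) N *
     pochhammer (g + x + of_nat n) (Suc N) /
     ((-1) ^ (N - n) * fact n * fact (N - n) * pochhammer (y - x - of_nat n) (Suc N) * pochhammer (z - x - of_nat n) (Suc N) *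
      pochhammer (a + x + of_nat n) (Suc N))"

definition res_minus :: "nat \<Rightarrow> complex \<Rightarrow> complex \<Rightarrow> complex \<Rightarrow> complex \<Rightarrow> complex \<Rightarrow> complex \<Rightarrow> complex \<Rightarrow> complex \<Rightarrow> nat \<Rightarrow> complex" where
  "res_minus N a x y z p q r g n =
     pochhammer (p + a + of_nat n) (Suc N) * pochhammer (q + a + of_nat n) (Suc N) * pochhammer (r + a + of_nat n) N *
     pochhammer (g - a - of_nat n) (Suc N) /
     (- ((-1) ^ (N - n) * fact n * fact (N - n)) * pochhammer (x + a + of_nat n) (Suc N) * pochhammer (y + a + of_nat n) (Suc N) *
      pochhammer (z + a + of_nat n) (Suc N))"

lemma prod_four_disjoint:
  assumes "finite A" "finite B" "finite C" "finite D" "A \<inter> B = {}" "A \<inter> C = {}" "A \<inter> D = {}" "B \<inter> C = {}" "B \<inter> D = {}" "C \<inter> D = {}" "x \<in> A"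
  shows "prod f (A \<union> B \<union> C \<union> D - {x}) = prod f (A - {x}) * prod f B * prod f C * (prod f D :: complex)"
proof -
  have "prod f (A \<union> B \<union> C \<union> D - {x}) = prod f (((A - {x}) \<union> B \<union> C) \<union> D)"
    by (rule arg_cong[of _ _ "prod f"]) (use assms in blast)
  also have "\<dots> = prod f ((A - {x}) \<union> B \<union> C) * prod f D"
    by (rule prod.union_disjoint) (use assms in auto)
  also have "prod f ((A - {x}) \<union> B \<union> C) = prod f ((A - {x}) \<union> B) * prod f C"
    by (rule prod.union_disjoint) (use assms in auto)
  also have "prod f ((A - {x}) \<union> B) = prod f (A - {x}) * prod f B"
    by (rule prod.union_disjoint) (use assms in auto)
  finally show ?thesis .
qed

lemma sum_four_disjoint:
  assumes "finite A" "finite B" "finite C" "finite D" "A \<inter> B = {}" "A \<inter> C = {}" "A \<inter> D = {}" "B \<inter> C = {}" "B \<inter> D = {}" "C \<inter> D = {}"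
  shows "sum f (A \<union> B \<union> C \<union> D) = sum f A + sum f B + sum f C + (sum f D :: 'a :: comm_monoid_add)"
proof -
  have "sum f (A \<union> B \<union> C \<union> D) = sum f (A \<union> B \<union> C) + sum f D"
    by (rule sum.union_disjoint) (use assms in auto)
  also have "sum f (A \<union> B \<union> C) = sum f (A \<union> B) + sum f C"
    by (rule sum.union_disjoint) (use assms in auto)
  also have "sum f (A \<union> B) = sum f A + sum f B"
    by (rule sum.union_disjoint) (use assms in auto)
  finally show ?thesis .
qed

text \<open>The denominator of the truncation has one more factor than the numerator, so the residues add up
  to plus or minus one, which vanishes in the limit after division by \<open>N + 1\<close>.\<close>

lemma finite_residue_sum:
  assumes ni: "x - y \<notin> \<int>" "x - z \<notin> \<int>" "y - z \<notin> \<int>" "a + x \<notin> \<int>" "a + y \<notin> \<int>" "a + z \<notin> \<int>"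
  shows "norm ((\<Sum>n\<le>N. res_plus N a x y z p q r g n) + (\<Sum>n\<le>N. res_plus N a y x z p q r g n) +
     (\<Sum>n\<le>N. res_plus N a z x y p q r g n) + (\<Sum>n\<le>N. res_minus N a x y z p q r g n)) = 1"
proof -
  define F where "F x = (\<lambda>k. x + of_nat k) ` {..N}" for x :: complex
  define A where "A = (\<lambda>k. - a - of_nat k) ` {..N}"
  have fin: "finite (F x)" "finite A" for x by (auto simp: F_def A_def)
  have injF: "inj_on (\<lambda>k. x + of_nat k) S" for x :: complex and S by (auto simp: inj_on_def)
  have injA: "inj_on (\<lambda>k. - a - of_nat k) S" for S by (auto simp: inj_on_def)
  have cards: "card (F x) = Suc N" "card A = Suc N" for x
    unfolding F_def A_def by (subst card_image; simp add: injF injA)+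
  have disjF: "F u \<inter> F v = {}" if "u - v \<notin> \<int>" for u v
  proof -
    have False if "u + of_nat k = v + of_nat l" for k l
    proof -
      have "u - v = of_nat l - of_nat k" using that by (simp add: algebra_simps)
      thus False using \<open>u - v \<notin> \<int>\<close> by simp
    qed
    thus ?thesis by (auto simp: F_def)
  qed
  have disjA: "F u \<inter> A = {}" if "a + u \<notin> \<int>" for u
  proof -
    have False if "u + of_nat k = - a - of_nat l" for k l
    proof -
      have "a + u = (u + of_nat k) + a - of_nat k" by simp
      hence "a + u = - of_nat l - of_nat k" unfolding that by simp
      thus False using \<open>a + u \<notin> \<int>\<close> by simp
    qed
    thus ?thesis by (auto simp: F_def A_def)
  qed
  have ni': "y - x \<notin> \<int>" "z - x \<notin> \<int>" "z - y \<notin> \<int>" using ni Ints_minus by (metis minus_diff_eq)+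
  note disj = disjF[OF ni(1)] disjF[OF ni(2)] disjF[OF ni(3)] disjF[OF ni'(1)] disjF[OF ni'(2)] disjF[OF ni'(3)] disjA[OF ni(4)] disjA[OF ni(5)] disjA[OF ni(6)]
  define X where "X = F x \<union> F y \<union> F z \<union> A"
  have cX: "card X = 4 * N + 4" unfolding X_def card_eq_sum
    by (subst sum_four_disjoint) (use fin disj cards in \<open>auto simp flip: card_eq_sum\<close>)
  \<comment> \<open>\<open>R\<close> alone has degree \<open>N\<close>. The product then has degree
    4 N + 3 against 4 N + 4 nodes, so the coefficient supplied by \<open>lagrange_sum\<close> is the
    leading one.\<close>
  obtain P Q R G :: "complex poly" where
    P: "degree P = Suc N" "norm (lead_coeff P) = 1" "\<And>t. poly P t = pochhammer (p + (-1) * t) (Suc N)" and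
    Q: "degree Q = Suc N" "norm (lead_coeff Q) = 1" "\<And>t. poly Q t = pochhammer (q + (-1) * t) (Suc N)" and
    R: "degree R = N" "norm (lead_coeff R) = 1" "\<And>t. poly R t = pochhammer (r + (-1) * t) N" and
    G: "degree G = Suc N" "norm (lead_coeff G) = 1" "\<And>t. poly G t = pochhammer (g + 1 * t) (Suc N)"
    by (metis pochhammer_poly[of "-1"] pochhammer_poly[of 1] norm_minus_cancel norm_one)
  define H where "H = P * Q * R * G"
  have nz: "P \<noteq> 0" "Q \<noteq> 0" "R \<noteq> 0" "G \<noteq> 0" using P(2) Q(2) R(2) G(2) by auto
  have dH: "degree H = 4 * N + 3" unfolding H_def using nz P(1) Q(1) R(1) G(1) by (simp add: degree_mult_eq)
  have card_deg: "card X - 1 = degree H" by (simp add: cX dH)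
  have lH: "norm (lead_coeff H) = 1" unfolding H_def lead_coeff_mult norm_mult P(2) Q(2) R(2) G(2) by simp
  have "(\<Sum>w\<in>X. poly H w / (\<Prod>v\<in>X-{w}. w - v)) = coeff H (card X - 1)"
    by (rule lagrange_sum) (use fin in \<open>auto simp: X_def[symmetric] cX dH\<close>, auto simp: X_def fin)
  hence n1: "norm (\<Sum>w\<in>X. poly H w / (\<Prod>v\<in>X-{w}. w - v)) = 1"
    using lH card_deg by (simp only:)
  have prodF: "(\<Prod>v\<in>F u. w - v) = (-1) ^ Suc N * pochhammer (u - w) (Suc N)" for u w
  proof -
    have "(\<Prod>v\<in>F u. w - v) = (\<Prod>k\<in>{..N}. - (u - w + of_nat k))"
      unfolding F_def by (subst prod.reindex[OF injF]) (auto intro!: prod.cong)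
    also have "\<dots> = (-1) ^ Suc N * (\<Prod>k\<in>{..N}. u - w + of_nat k)"
      by (subst prod_uminus) simp
    finally show ?thesis by (simp add: pochhammer_prod atLeast0LessThan lessThan_Suc_atMost)
  qed
  have prodA: "(\<Prod>v\<in>A. w - v) = pochhammer (a + w) (Suc N)" for w
    unfolding A_def by (subst prod.reindex[OF injA]) (simp add: pochhammer_prod atLeast0LessThan lessThan_Suc_atMost algebra_simps)
  have prodF': "(\<Prod>v\<in>F u - {u + of_nat n}. (u + of_nat n) - v) = (-1) ^ (N - n) * fact n * fact (N - n)" if "n \<le> N" for u n
  proof -
    have "F u - {u + of_nat n} = (\<lambda>k. u + of_nat k) ` ({..N} - {n})" by (auto simp: F_def)
    thus ?thesis using prod_diff_self[OF that] by (simp add: prod.reindex[OF injF])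
  qed
  have prodA': "(\<Prod>v\<in>A - {- a - of_nat n}. (- a - of_nat n) - v) = (-1) ^ N * ((-1) ^ (N - n) * fact n * fact (N - n))" if "n \<le> N" for n
  proof -
    have "A - {- a - of_nat n} = (\<lambda>k. - a - of_nat k) ` ({..N} - {n})" by (auto simp: A_def)
    hence "(\<Prod>v\<in>A - {- a - of_nat n}. (- a - of_nat n) - v) = (\<Prod>k\<in>{..N}-{n}. - (of_nat n - of_nat k))"
      by (simp add: prod.reindex[OF injA])
    also have "\<dots> = (-1) ^ N * (\<Prod>k\<in>{..N}-{n}. of_nat n - of_nat k)"
      using that by (subst prod_uminus) simp
    finally show ?thesis using prod_diff_self[OF that] by simp
  qed
  have term_plus: "(\<Sum>w\<in>F u. poly H w / (\<Prod>v\<in>X-{w}. w - v)) = (\<Sum>n\<le>N. res_plus N a u u' u'' p q r g n)"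
    if X: "X = F u \<union> F u' \<union> F u'' \<union> A" and d: "F u \<inter> F u' = {}" "F u \<inter> F u'' = {}" "F u \<inter> A = {}" "F u' \<inter> F u'' = {}" "F u' \<inter> A = {}" "F u'' \<inter> A = {}" for u u' u''
  proof -
    have "(\<Sum>w\<in>F u. poly H w / (\<Prod>v\<in>X-{w}. w - v)) = (\<Sum>n\<le>N. poly H (u + of_nat n) / (\<Prod>v\<in>X-{u + of_nat n}. (u + of_nat n) - v))"
      by (subst (1) F_def, subst sum.reindex[OF injF]) simp
    also have "\<dots> = (\<Sum>n\<le>N. res_plus N a u u' u'' p q r g n)"
    proof (rule sum.cong)
      fix n assume "n \<in> {..N}"
      hence n: "n \<le> N" by simp
      have "u + of_nat n \<in> F u" using n by (auto simp: F_def)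
      from prod_four_disjoint[OF fin(1) fin(1) fin(1) fin(2) d this, where f = "\<lambda>v. (u + of_nat n) - v"]
      have "(\<Prod>v\<in>X-{u + of_nat n}. (u + of_nat n) - v) = (-1) ^ (N - n) * fact n * fact (N - n) *
         ((-1) ^ Suc N * pochhammer (u' - (u + of_nat n)) (Suc N)) * ((-1) ^ Suc N * pochhammer (u'' - (u + of_nat n)) (Suc N)) * pochhammer (a + (u + of_nat n)) (Suc N)"
        unfolding X[symmetric] prodF prodA prodF'[OF n] .
      also have "\<dots> = ((-1) ^ Suc N * (-1) ^ Suc N) * ((-1) ^ (N - n) * fact n * fact (N - n) * pochhammer (u' - u - of_nat n) (Suc N) * pochhammer (u'' - u - of_nat n) (Suc N) * pochhammer (a + u + of_nat n) (Suc N))"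
        by (simp add: algebra_simps del: power_Suc)
      also have "(-1) ^ Suc N * (-1) ^ Suc N = (1 :: complex)" unfolding power_mult_distrib[symmetric] by simp
      finally show "poly H (u + of_nat n) / (\<Prod>v\<in>X-{u + of_nat n}. (u + of_nat n) - v) = res_plus N a u u' u'' p q r g n"
        unfolding res_plus_def H_def poly_mult P Q R G by (simp add: algebra_simps)
    qed simp
    finally show ?thesis .
  qed
  have term_minus: "(\<Sum>w\<in>A. poly H w / (\<Prod>v\<in>X-{w}. w - v)) = (\<Sum>n\<le>N. res_minus N a x y z p q r g n)"
  proof -
    have "(\<Sum>w\<in>A. poly H w / (\<Prod>v\<in>X-{w}. w - v)) = (\<Sum>n\<le>N. poly H (- a - of_nat n) / (\<Prod>v\<in>X-{- a - of_nat n}. (- a - of_nat n) - v))"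
      by (subst (1) A_def, subst sum.reindex[OF injA]) simp
    also have "\<dots> = (\<Sum>n\<le>N. res_minus N a x y z p q r g n)"
    proof (rule sum.cong)
      fix n assume "n \<in> {..N}"
      hence n: "n \<le> N" by simp
      have X': "X = A \<union> F x \<union> F y \<union> F z" by (auto simp: X_def)
      have mem: "- a - of_nat n \<in> A" using n by (auto simp: A_def)
      have "(\<Prod>v\<in>X-{- a - of_nat n}. (- a - of_nat n) - v) = (\<Prod>v\<in>A-{- a - of_nat n}. (- a - of_nat n) - v) *
           (\<Prod>v\<in>F x. (- a - of_nat n) - v) * (\<Prod>v\<in>F y. (- a - of_nat n) - v) * (\<Prod>v\<in>F z. (- a - of_nat n) - v)"
        unfolding X' by (rule prod_four_disjoint) (use fin disj mem in auto)
      \<comment> \<open>Three products over the rising sequences contribute (-1)^(N + 1) each and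
        the falling sequence contributes (-1)^N. Altogether this is the minus sign in
        \<open>res_minus\<close>.\<close>
      also have "\<dots> = ((-1) ^ Suc N * (-1) ^ Suc N) * ((-1) ^ N * (-1) ^ Suc N) * ((-1) ^ (N - n) * fact n * fact (N - n) *
           pochhammer (x + a + of_nat n) (Suc N) * pochhammer (y + a + of_nat n) (Suc N) * pochhammer (z + a + of_nat n) (Suc N))"
        unfolding prodF prodA'[OF n] by (simp add: algebra_simps del: power_Suc)
      also have "(-1) ^ Suc N * (-1) ^ Suc N = (1 :: complex)" unfolding power_mult_distrib[symmetric] by simp
      also have "(-1) ^ N * (-1) ^ Suc N = (-1 :: complex)" unfolding power_Suc by (simp flip: power_mult_distrib)
      finally show "poly H (- a - of_nat n) / (\<Prod>v\<in>X-{- a - of_nat n}. (- a - of_nat n) - v) = res_minus N a x y z p q r g n"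
        unfolding res_minus_def H_def poly_mult P Q R G by (simp add: algebra_simps)
    qed simp
    finally show ?thesis .
  qed
  have "(\<Sum>w\<in>X. poly H w / (\<Prod>v\<in>X-{w}. w - v)) =
     (\<Sum>w\<in>F x. poly H w / (\<Prod>v\<in>X-{w}. w - v)) + (\<Sum>w\<in>F y. poly H w / (\<Prod>v\<in>X-{w}. w - v)) +
     (\<Sum>w\<in>F z. poly H w / (\<Prod>v\<in>X-{w}. w - v)) + (\<Sum>w\<in>A. poly H w / (\<Prod>v\<in>X-{w}. w - v))" (is "_ = ?S")
  proof -
    have "(\<Sum>w\<in>F x \<union> F y \<union> F z \<union> A. \<phi> w) = (\<Sum>w\<in>F x. \<phi> w) + (\<Sum>w\<in>F y. \<phi> w) + (\<Sum>w\<in>F z. \<phi> w) + (\<Sum>w\<in>A. \<phi> w)" for \<phi> :: "complex \<Rightarrow> complex"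
      by (rule sum_four_disjoint) (use fin disj in auto)
    thus ?thesis by (simp only: X_def)
  qed
  also have "?S = (\<Sum>n\<le>N. res_plus N a x y z p q r g n) + (\<Sum>n\<le>N. res_plus N a y x z p q r g n) +
     (\<Sum>n\<le>N. res_plus N a z x y p q r g n) + (\<Sum>n\<le>N. res_minus N a x y z p q r g n)"
  proof -
    have 1: "X = F x \<union> F y \<union> F z \<union> A" "X = F y \<union> F x \<union> F z \<union> A" "X = F z \<union> F x \<union> F y \<union> A" by (auto simp: X_def)
    show ?thesis
      by (simp only: term_minus term_plus[OF 1(1)] term_plus[OF 1(2)] term_plus[OF 1(3)] disj)
  qed
  finally show ?thesis using n1 by simp
qed

text \<open>Sorts the factors by the index they depend on. Reflected pochhammer symbols split into a
  part in n and a part in N - n (\<open>\<Phi>\<close>), shifted ones into a part in n and a part in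
  N + n (\<open>\<Psi>\<close>); the parts in n form \<open>u4\<close>. The symbol for
  \<open>r\<close> has length N instead of N + 1, hence 1 - d next to 2 - b and 2 - c.\<close>

lemma res_plus_eq:
  assumes n: "n \<le> N"
    and A: "A = a + x" "b = 1 + x - p" "c = 1 + x - q" "d = 1 + x - r" "e = 1 + x - y" "f = 1 + x - z" "g' = g + x"
    and ni: "A \<notin> \<int>" "b \<notin> \<int>" "c \<notin> \<int>" "d \<notin> \<int>" "e \<notin> \<int>" "f \<notin> \<int>" "g' \<notin> \<int>"
  defines "\<Phi> \<equiv> \<lambda>M. Gamma (2 - b + of_nat M) * Gamma (2 - c + of_nat M) * Gamma (1 - d + of_nat M) *
      rGamma (1 + of_nat M) * rGamma (2 - e + of_nat M) * rGamma (2 - f + of_nat M)"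
    and "\<Psi> \<equiv> \<lambda>M. Gamma (g' + 1 + of_nat M) * rGamma (A + 1 + of_nat M)"
    and "\<kappa> \<equiv> (sinpi b / of_real pi) * (sinpi c / of_real pi) * (sinpi d / of_real pi) / ((sinpi e / of_real pi) * (sinpi f / of_real pi))"
  shows "res_plus N a x y z p q r g n = (-1) ^ N * (\<kappa> * u4 A b c d e f g' (of_nat n) * (\<Phi> (N - n) * \<Psi> (N + n)))"
proof -
  have eqs: "p - x - of_nat n = 1 - b - of_nat n" "q - x - of_nat n = 1 - c - of_nat n" "r - x - of_nat n = 1 - d - of_nat n"
    "y - x - of_nat n = 1 - e - of_nat n" "z - x - of_nat n = 1 - f - of_nat n" "g + x + of_nat n = g' + of_nat n" "a + x + of_nat n = A + of_nat n"
    by (simp_all add: A)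
  have n': "n \<le> Suc N" using n by simp
  have sh: "1 - w + of_nat (Suc N - n) = 2 - w + of_nat (N - n)" for w :: complex
    using n by (simp add: Suc_diff_le)
  have sh': "w + of_nat (Suc N + n) = w + 1 + of_nat (N + n)" for w :: complex by simp
  define s :: complex where "s = (-1) ^ n"
  define sn :: complex where "sn = (-1) ^ (N - n)"
  have im: "inverse ((-1) ^ k) = ((-1) ^ k :: complex)" for k by (simp flip: power_inverse)
  have ss: "s * s = 1" "inverse s = s" "inverse sn = sn" "s * sn = (-1) ^ N"
    using n by (simp_all add: s_def sn_def im flip: power_mult_distrib power_add)
  have fct: "fact m = inverse (rGamma (1 + of_nat m) :: complex)" for m
    by (simp add: rGamma_inverse_Gamma Gamma_fact)
  have inv: "inverse (Gamma w) = rGamma w" "inverse (rGamma w) = Gamma w" for w :: complex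
    by (simp_all add: rGamma_inverse_Gamma)
  have "res_plus N a x y z p q r g n =
     (s * (sinpi b / of_real pi) * Gamma (b + of_nat n) * Gamma (2 - b + of_nat (N - n))) *
     (s * (sinpi c / of_real pi) * Gamma (c + of_nat n) * Gamma (2 - c + of_nat (N - n))) *
     (s * (sinpi d / of_real pi) * Gamma (d + of_nat n) * Gamma (1 - d + of_nat (N - n))) *
     (Gamma (g' + 1 + of_nat (N + n)) * rGamma (g' + of_nat n)) /
     (sn * inverse (rGamma (1 + of_nat n)) * inverse (rGamma (1 + of_nat (N - n))) *
      (s * (sinpi e / of_real pi) * Gamma (e + of_nat n) * Gamma (2 - e + of_nat (N - n))) *
      (s * (sinpi f / of_real pi) * Gamma (f + of_nat n) * Gamma (2 - f + of_nat (N - n))) *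
      (Gamma (A + 1 + of_nat (N + n)) * rGamma (A + of_nat n)))"
    unfolding res_plus_def eqs pochhammer_reflect_Gamma[OF ni(2) n'] pochhammer_reflect_Gamma[OF ni(3) n'] pochhammer_reflect_Gamma[OF ni(4) n]
      pochhammer_reflect_Gamma[OF ni(5) n'] pochhammer_reflect_Gamma[OF ni(6) n'] pochhammer_shift_Gamma[OF ni(7)] pochhammer_shift_Gamma[OF ni(1)]
      sh sh' s_def sn_def fct ..
  also have "\<dots> = (s * s) * (s * s) * (s * sn) * (\<kappa> * u4 A b c d e f g' (of_nat n) * (\<Phi> (N - n) * \<Psi> (N + n)))"
    unfolding \<kappa>_def \<Phi>_def \<Psi>_def u4_def divide_inverse[of _ "_ * _"] inverse_mult_distrib inv ss(2,3)
    by (simp only: mult_ac)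
  finally show ?thesis unfolding ss by simp
qed

text \<open>At the poles -a - n the two kinds of factors change roles: among the parameter-dependent
  symbols only the one with \<open>g\<close> is reflected, so \<open>\<Phi>\<close> has one Gamma
  quotient and \<open>\<Psi>\<close> has three.\<close>

lemma res_minus_eq:
  assumes n: "n \<le> N"
    and A: "A1 = x + a" "A2 = y + a" "A3 = z + a" "D = 1 + a - g" "h1 = p + a" "h2 = q + a" "h3 = r + a"
    and ni: "A1 \<notin> \<int>" "A2 \<notin> \<int>" "A3 \<notin> \<int>" "D \<notin> \<int>" "h1 \<notin> \<int>" "h2 \<notin> \<int>" "h3 \<notin> \<int>"
  defines "\<Phi> \<equiv> \<lambda>M. Gamma (2 - D + of_nat M) * rGamma (1 + of_nat M)"
    and "\<Psi> \<equiv> \<lambda>M. Gamma (h1 + 1 + of_nat M) * Gamma (h2 + 1 + of_nat M) * Gamma (h3 + of_nat M) *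
      rGamma (A1 + 1 + of_nat M) * rGamma (A2 + 1 + of_nat M) * rGamma (A3 + 1 + of_nat M)"
  shows "res_minus N a x y z p q r g n = (-1) ^ N * (- (sinpi D / of_real pi) * u4 A1 A2 A3 D h1 h2 h3 (of_nat n) * (\<Phi> (N - n) * \<Psi> (N + n)))"
proof -
  have eqs: "p + a + of_nat n = h1 + of_nat n" "q + a + of_nat n = h2 + of_nat n" "r + a + of_nat n = h3 + of_nat n"
    "x + a + of_nat n = A1 + of_nat n" "y + a + of_nat n = A2 + of_nat n" "z + a + of_nat n = A3 + of_nat n" "g - a - of_nat n = 1 - D - of_nat n"
    by (simp_all add: A)
  have n': "n \<le> Suc N" using n by simp
  have sh: "1 - w + of_nat (Suc N - n) = 2 - w + of_nat (N - n)" for w :: complex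
    using n by (simp add: Suc_diff_le)
  have sh': "w + of_nat (Suc N + n) = w + 1 + of_nat (N + n)" for w :: complex by simp
  define s :: complex where "s = (-1) ^ n"
  define sn :: complex where "sn = (-1) ^ (N - n)"
  have im: "inverse ((-1) ^ k) = ((-1) ^ k :: complex)" for k by (simp flip: power_inverse)
  have ss: "inverse sn = sn" "s * sn = (-1) ^ N"
    using n by (simp_all add: s_def sn_def im flip: power_add)
  have fct: "fact m = inverse (rGamma (1 + of_nat m) :: complex)" for m
    by (simp add: rGamma_inverse_Gamma Gamma_fact)
  have inv: "inverse (Gamma w) = rGamma w" "inverse (rGamma w) = Gamma w" for w :: complex
    by (simp_all add: rGamma_inverse_Gamma)
  have "res_minus N a x y z p q r g n =
     (Gamma (h1 + 1 + of_nat (N + n)) * rGamma (h1 + of_nat n)) * (Gamma (h2 + 1 + of_nat (N + n)) * rGamma (h2 + of_nat n)) *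
     (Gamma (h3 + of_nat (N + n)) * rGamma (h3 + of_nat n)) *
     (s * (sinpi D / of_real pi) * Gamma (D + of_nat n) * Gamma (2 - D + of_nat (N - n))) /
     (- (sn * inverse (rGamma (1 + of_nat n)) * inverse (rGamma (1 + of_nat (N - n)))) *
      (Gamma (A1 + 1 + of_nat (N + n)) * rGamma (A1 + of_nat n)) * (Gamma (A2 + 1 + of_nat (N + n)) * rGamma (A2 + of_nat n)) *
      (Gamma (A3 + 1 + of_nat (N + n)) * rGamma (A3 + of_nat n)))"
    unfolding res_minus_def eqs pochhammer_reflect_Gamma[OF ni(4) n'] pochhammer_shift_Gamma[OF ni(1)] pochhammer_shift_Gamma[OF ni(2)] pochhammer_shift_Gamma[OF ni(3)]
      pochhammer_shift_Gamma[OF ni(5)] pochhammer_shift_Gamma[OF ni(6)] pochhammer_shift_Gamma[OF ni(7)]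
      sh sh' s_def sn_def fct ..
  also have "\<dots> = (s * sn) * (- (sinpi D / of_real pi) * u4 A1 A2 A3 D h1 h2 h3 (of_nat n) * (\<Phi> (N - n) * \<Psi> (N + n)))"
    unfolding \<Phi>_def \<Psi>_def u4_def divide_inverse[of _ "_ * _"] inverse_mult_distrib inverse_minus_eq inv ss(1)
    by (simp only: mult_ac mult_minus_left mult_minus_right)
  finally show ?thesis unfolding ss by simp
qed

text \<open>The exponents for \<open>weighted_limit\<close> are Re (1 + A - g') and Re (g' - A), and
  g' - A = g - a: this is the origin of the window for Re (g - a). The factor (-1)^N cancels the
  common sign of the residues.\<close>

lemma res_plus_limit:
  assumes A: "A = a + x" "b = 1 + x - p" "c = 1 + x - q" "d = 1 + x - r" "e = 1 + x - y" "f = 1 + x - z" "g' = g + x"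
    and ni: "A \<notin> \<int>" "b \<notin> \<int>" "c \<notin> \<int>" "d \<notin> \<int>" "e \<notin> \<int>" "f \<notin> \<int>" "g' \<notin> \<int>"
    and bal: "e + f + g' = 1 + A + b + c + d" and re: "0 \<le> Re (g' - A)" "Re (g' - A) \<le> 1"
  shows "(\<lambda>N. (-1) ^ N * (\<Sum>n\<le>N. res_plus N a x y z p q r g n) / of_nat (Suc N)) \<longlonglongrightarrow>
     (sinpi b / of_real pi) * (sinpi c / of_real pi) * (sinpi d / of_real pi) / ((sinpi e / of_real pi) * (sinpi f / of_real pi)) *
     (\<Sum>n. u4 A b c d e f g' (of_nat n))"
proof -
  define \<Phi> where "\<Phi> M = Gamma (2 - b + of_nat M) * Gamma (2 - c + of_nat M) * Gamma (1 - d + of_nat M) *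
      rGamma (1 + of_nat M) * rGamma (2 - e + of_nat M) * rGamma (2 - f + of_nat M)" for M
  define \<Psi> where "\<Psi> M = Gamma (g' + 1 + of_nat M) * rGamma (A + 1 + of_nat M)" for M
  define \<kappa> where "\<kappa> = (sinpi b / of_real pi) * (sinpi c / of_real pi) * (sinpi d / of_real pi) / ((sinpi e / of_real pi) * (sinpi f / of_real pi))"
  have g': "g' = 1 + A + b + c + d - e - f" using bal by (simp add: algebra_simps)
  have n: "nonpole (2 - b)" "nonpole (2 - c)" "nonpole (1 - d)" "nonpole (2 - e)" "nonpole (2 - f)" "nonpole (g' + 1)" "nonpole (A + 1)"
    by (rule nonint_not_nonpos_Int, simp add: ni Ints_shift_iff)+
  have n0: "nonpole (A + 0)" "nonpole (b + 0)" "nonpole (c + 0)" "nonpole (d + 0)" using ni nonint_not_nonpos_Int by auto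
  have lim: "(\<lambda>N. (\<Sum>n\<le>N. u4 A b c d e f g' (of_nat n) * (\<Phi> (N - n) * \<Psi> (N + n))) / of_nat (Suc N)) \<longlonglongrightarrow> (\<Sum>n. u4 A b c d e f g' (of_nat n))"
  proof (rule weighted_limit)
    show "summable (\<lambda>n. norm (u4 A b c d e f g' (of_nat n)))" using u4_summable_norm[OF bal n0] by simp
    have E: "2 - b + (2 - c) + (1 - d) - 1 - (2 - e) - (2 - f) = 1 + A - g'" by (simp add: g')
    show "powr_bounded (Re (1 + A - g')) \<Phi>"
      using powr_bounded_Gamma_ratio3[OF n(1-3), of 1 "2 - e" "2 - f", unfolded E] unfolding \<Phi>_def .
    have "powr_bounded (Re (g' + 1) - Re (A + 1)) \<Psi>" unfolding \<Psi>_def by (intro powr_bounded_Gamma_ratio n)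
    thus "powr_bounded (Re (g' - A)) \<Psi>" by simp
    show "Re (1 + A - g') + Re (g' - A) = 1" "0 \<le> Re (1 + A - g')" "0 \<le> Re (g' - A)" using re by simp_all
    fix m
    note nm = not_nonpos_Int_add_of_nat[OF n(6), of "2 * m"] not_nonpos_Int_add_of_nat[OF n(7), of "2 * m"]
    let ?l = "\<lambda>M. complex_of_real (ln (real M))"
    let ?u = "1 + (2 - e) + (2 - f) - (2 - b) - (2 - c) - (1 - d)" and ?v = "A + 1 + of_nat (2 * m) - (g' + 1 + of_nat (2 * m))"
    have "(\<lambda>M. (\<Phi> M * exp (?u * ?l M)) * (\<Psi> (M + 2 * m) * exp (?v * ?l M))) \<longlonglongrightarrow> 1 * 1"
    proof (rule tendsto_mult)
      show "(\<lambda>M. \<Phi> M * exp (?u * ?l M)) \<longlonglongrightarrow> 1"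
        unfolding \<Phi>_def by (rule Gamma_ratio3_asymp) (use n in auto)
      show "(\<lambda>M. \<Psi> (M + 2 * m) * exp (?v * ?l M)) \<longlonglongrightarrow> 1"
        using Gamma_shift_asymp[OF nm] by (simp add: \<Psi>_def add_ac)
    qed
    moreover have "exp (- ?l M) = exp (?u * ?l M) * exp (?v * ?l M)" for M
      unfolding exp_add[symmetric] g' by (simp add: algebra_simps)
    ultimately show "(\<lambda>M. \<Phi> M * \<Psi> (M + 2 * m) * exp (- ?l M)) \<longlonglongrightarrow> 1" by (simp only: mult_ac mult_1_right)
  qed
  have eq: "(-1) ^ N * (\<Sum>n\<le>N. res_plus N a x y z p q r g n) / of_nat (Suc N) =
     \<kappa> * ((\<Sum>n\<le>N. u4 A b c d e f g' (of_nat n) * (\<Phi> (N - n) * \<Psi> (N + n))) / of_nat (Suc N))" for N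
  proof -
    have "(\<Sum>n\<le>N. res_plus N a x y z p q r g n) = (\<Sum>n\<le>N. (-1) ^ N * (\<kappa> * u4 A b c d e f g' (of_nat n) * (\<Phi> (N - n) * \<Psi> (N + n))))"
      unfolding \<kappa>_def \<Phi>_def \<Psi>_def by (intro sum.cong refl res_plus_eq A ni) auto
    also have "\<dots> = (-1) ^ N * (\<kappa> * (\<Sum>n\<le>N. u4 A b c d e f g' (of_nat n) * (\<Phi> (N - n) * \<Psi> (N + n))))"
      unfolding sum_distrib_left by (simp only: mult.assoc)
    finally show ?thesis by (simp del: of_nat_Suc flip: mult.assoc power_mult_distrib)
  qed
  show ?thesis unfolding eq \<kappa>_def[symmetric] by (intro tendsto_mult tendsto_const lim)
qed

text \<open>Here the exponents are Re (1 - D) and Re D. As D = 1 + a - g, the window is the one of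
  \<open>res_plus_limit\<close> again.\<close>

lemma res_minus_limit:
  assumes A: "A1 = x + a" "A2 = y + a" "A3 = z + a" "D = 1 + a - g" "h1 = p + a" "h2 = q + a" "h3 = r + a"
    and ni: "A1 \<notin> \<int>" "A2 \<notin> \<int>" "A3 \<notin> \<int>" "D \<notin> \<int>" "h1 \<notin> \<int>" "h2 \<notin> \<int>" "h3 \<notin> \<int>"
    and bal: "h1 + h2 + h3 = 1 + A1 + A2 + A3 + D" and re: "0 \<le> Re D" "Re D \<le> 1"
  shows "(\<lambda>N. (-1) ^ N * (\<Sum>n\<le>N. res_minus N a x y z p q r g n) / of_nat (Suc N)) \<longlonglongrightarrow>
     - (sinpi D / of_real pi) * (\<Sum>n. u4 A1 A2 A3 D h1 h2 h3 (of_nat n))"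
proof -
  define \<Phi> where "\<Phi> M = Gamma (2 - D + of_nat M) * rGamma (1 + of_nat M)" for M
  define \<Psi> where "\<Psi> M = Gamma (h1 + 1 + of_nat M) * Gamma (h2 + 1 + of_nat M) * Gamma (h3 + of_nat M) *
      rGamma (A1 + 1 + of_nat M) * rGamma (A2 + 1 + of_nat M) * rGamma (A3 + 1 + of_nat M)" for M
  have D: "D = h1 + h2 + h3 - 1 - A1 - A2 - A3" using bal by (simp add: algebra_simps)
  have n: "nonpole (2 - D)" "nonpole (h1 + 1)" "nonpole (h2 + 1)" "nonpole h3" "nonpole (A1 + 1)" "nonpole (A2 + 1)" "nonpole (A3 + 1)"
    by (rule nonint_not_nonpos_Int, simp add: ni Ints_shift_iff)+
  have n0: "nonpole (A1 + 0)" "nonpole (A2 + 0)" "nonpole (A3 + 0)" "nonpole (D + 0)" using ni nonint_not_nonpos_Int by auto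
  have lim: "(\<lambda>N. (\<Sum>n\<le>N. u4 A1 A2 A3 D h1 h2 h3 (of_nat n) * (\<Phi> (N - n) * \<Psi> (N + n))) / of_nat (Suc N)) \<longlonglongrightarrow> (\<Sum>n. u4 A1 A2 A3 D h1 h2 h3 (of_nat n))"
  proof (rule weighted_limit)
    show "summable (\<lambda>n. norm (u4 A1 A2 A3 D h1 h2 h3 (of_nat n)))" using u4_summable_norm[OF bal n0] by simp
    have "powr_bounded (Re (2 - D) - Re 1) \<Phi>" unfolding \<Phi>_def by (intro powr_bounded_Gamma_ratio n)
    thus "powr_bounded (Re (1 - D)) \<Phi>" by simp
    have E: "h1 + 1 + (h2 + 1) + h3 - (A1 + 1) - (A2 + 1) - (A3 + 1) = D" by (simp add: D)
    show "powr_bounded (Re D) \<Psi>"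
      using powr_bounded_Gamma_ratio3[OF n(2-4), of "A1 + 1" "A2 + 1" "A3 + 1", unfolded E] unfolding \<Psi>_def .
    show "Re (1 - D) + Re D = 1" "0 \<le> Re (1 - D)" "0 \<le> Re D" using re by simp_all
    fix m
    note nm = n[THEN not_nonpos_Int_add_of_nat, of "2 * m"]
    let ?l = "\<lambda>M. complex_of_real (ln (real M))" and ?k = "of_nat (2 * m) :: complex"
    let ?u = "1 - (2 - D)" and ?v = "A1 + 1 + ?k + (A2 + 1 + ?k) + (A3 + 1 + ?k) - (h1 + 1 + ?k) - (h2 + 1 + ?k) - (h3 + ?k)"
    have "(\<lambda>M. (\<Phi> M * exp (?u * ?l M)) * (\<Psi> (M + 2 * m) * exp (?v * ?l M))) \<longlonglongrightarrow> 1 * 1"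
    proof (rule tendsto_mult)
      show "(\<lambda>M. \<Phi> M * exp (?u * ?l M)) \<longlonglongrightarrow> 1"
        unfolding \<Phi>_def by (rule Gamma_shift_asymp) (use n in auto)
      show "(\<lambda>M. \<Psi> (M + 2 * m) * exp (?v * ?l M)) \<longlonglongrightarrow> 1"
        using Gamma_ratio3_asymp[OF nm(2-7)] by (simp add: \<Psi>_def add_ac)
    qed
    moreover have "exp (- ?l M) = exp (?u * ?l M) * exp (?v * ?l M)" for M
      unfolding exp_add[symmetric] D by (simp add: algebra_simps)
    ultimately show "(\<lambda>M. \<Phi> M * \<Psi> (M + 2 * m) * exp (- ?l M)) \<longlonglongrightarrow> 1" by (simp only: mult_ac mult_1_right)
  qed
  have eq: "(-1) ^ N * (\<Sum>n\<le>N. res_minus N a x y z p q r g n) / of_nat (Suc N) =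
     - (sinpi D / of_real pi) * ((\<Sum>n\<le>N. u4 A1 A2 A3 D h1 h2 h3 (of_nat n) * (\<Phi> (N - n) * \<Psi> (N + n))) / of_nat (Suc N))" for N
  proof -
    have "(\<Sum>n\<le>N. res_minus N a x y z p q r g n) = (\<Sum>n\<le>N. (-1) ^ N * (- (sinpi D / of_real pi) * u4 A1 A2 A3 D h1 h2 h3 (of_nat n) * (\<Phi> (N - n) * \<Psi> (N + n))))"
      unfolding \<Phi>_def \<Psi>_def by (intro sum.cong refl res_minus_eq A ni) auto
    also have "\<dots> = (-1) ^ N * (- (sinpi D / of_real pi) * (\<Sum>n\<le>N. u4 A1 A2 A3 D h1 h2 h3 (of_nat n) * (\<Phi> (N - n) * \<Psi> (N + n))))"
      unfolding sum_distrib_left by (simp only: mult.assoc)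
    finally show ?thesis by (simp del: of_nat_Suc flip: mult.assoc power_mult_distrib)
  qed
  show ?thesis unfolding eq by (intro tendsto_mult tendsto_const lim)
qed

section \<open>Trigonometric identities for the coefficients\<close>

lemma sinpi_minus [simp]: "sinpi (- z) = - sinpi z"
  by (simp add: sinpi_def)

lemma sinpi_add_one: "sinpi (1 + z) = - sinpi z"
  by (simp add: sinpi_def distrib_left sin_add)

lemma sinpi_one_minus: "sinpi (1 - z) = sinpi z"
  using sinpi_add_one[of "-z"] by simp

lemma sinpi_two_minus: "sinpi (2 - z) = - sinpi z"
  using sinpi_add_one[of "1 - z"] by (simp add: sinpi_one_minus)

lemma sinpi_product_diff: "sinpi x * sinpi y - sinpi (x - z) * sinpi (y - z) = sinpi z * sinpi (x + y - z)"
proof -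
  have *: "sin x * sin y - sin (x - z) * sin (y - z) = sin z * sin (x + y - z)" for x y z :: complex
    unfolding sin_diff sin_add cos_diff cos_add using sin_cos_squared_add[of z] by algebra
  show ?thesis using *[of "of_real pi * x" "of_real pi * y" "of_real pi * z"]
    by (simp add: sinpi_def right_diff_distrib distrib_left)
qed

lemma sinpi_three_term: "sinpi x * sinpi (y - z) + sinpi z * sinpi (x - y) = sinpi y * sinpi (x - z)"
proof -
  have *: "sin x * sin (y - z) + sin z * sin (x - y) = sin y * sin (x - z)" for x y z :: complex
    unfolding sin_diff by algebra
  show ?thesis using *[of "of_real pi * x" "of_real pi * y" "of_real pi * z"]
    by (simp add: sinpi_def right_diff_distrib)
qed

text \<open>Divided by the sines of e, f and e - f, this evaluates the sum of the three coefficients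
  on the left of \<open>residue_relation\<close>. Replacing the products in b and c by
  \<open>sinpi_product_diff\<close> leaves addition formulas in d.\<close>

lemma sinpi_partial_fractions:
  "sinpi b * sinpi c * sinpi d * sinpi (e - f) + sinpi (b - e) * sinpi (c - e) * sinpi (d - e) * sinpi f
     - sinpi (b - f) * sinpi (c - f) * sinpi (d - f) * sinpi e =
   sinpi (b + c + d - e - f) * sinpi e * sinpi f * sinpi (e - f)"
proof -
  have 1: "sinpi (b - e) * sinpi (c - e) = sinpi b * sinpi c - sinpi e * sinpi (b + c - e)"
    "sinpi (b - f) * sinpi (c - f) = sinpi b * sinpi c - sinpi f * sinpi (b + c - f)"
    using sinpi_product_diff[of b c e] sinpi_product_diff[of b c f] by (simp_all add: algebra_simps)
  have 2: "sinpi d * sinpi (e - f) + sinpi f * sinpi (d - e) = sinpi e * sinpi (d - f)"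
    by (rule sinpi_three_term)
  have 3: "sinpi (d - f) * sinpi (b + c - f) - sinpi (d - e) * sinpi (b + c - e) = sinpi (e - f) * sinpi (b + c + d - e - f)"
    using sinpi_product_diff[of "d - f" "b + c - f" "e - f"] by (simp add: algebra_simps)
  show ?thesis unfolding 1 using 2 3 by algebra
qed

text \<open>The identity that produces \<open>B2\<close>: on the left stand the brackets of the two
  \<open>B4\<close> values, on the right the bracket of \<open>B2\<close>. It is
  \<open>sinpi_partial_fractions\<close> with a in place of f, combined with two addition
  formulas.\<close>

lemma sinpi_coefficients:
  assumes bal: "e + f + g = 1 + a + b + c + d"
  shows "sinpi a * (sinpi (e - b) * sinpi (e - c) * sinpi (e - d) + sinpi (f - a) * sinpi e * sinpi (g - e))
      - sinpi (e - a) * (sinpi b * sinpi c * sinpi d + sinpi (g - a) * sinpi f * sinpi e) =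
    - sinpi e * (sinpi (b - a) * sinpi (c - a) * sinpi (d - a) + sinpi (e - 2 * a) * sinpi (f - a) * sinpi (g - a))"
proof -
  define h where "h = b + c + d - e - f"
  have g: "g - a = 1 + h" "g - e = 1 + (h + a - e)" using bal by (simp_all add: h_def algebra_simps)
  have eb: "sinpi (e - w) = - sinpi (w - e)" for w using sinpi_minus[of "w - e"] by simp
  have 1: "sinpi b * sinpi c * sinpi d * sinpi (e - a) + sinpi (b - e) * sinpi (c - e) * sinpi (d - e) * sinpi a
     - sinpi (b - a) * sinpi (c - a) * sinpi (d - a) * sinpi e = sinpi (h + f - a) * sinpi e * sinpi a * sinpi (e - a)"
    using sinpi_partial_fractions[of b c d e a] by (simp add: h_def algebra_simps)
  have 2: "sinpi h * sinpi f - sinpi (h - a) * sinpi (f - a) = sinpi a * sinpi (h + f - a)"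
    by (rule sinpi_product_diff)
  have 3: "sinpi h * sinpi (e - 2 * a) + sinpi a * sinpi (h + a - e) = sinpi (e - a) * sinpi (h - a)"
    using sinpi_three_term[of h "e - a" a] by (simp add: algebra_simps)
  show ?thesis
    unfolding g sinpi_add_one eb[of b] eb[of c] eb[of d] using 1 2 3 by algebra
qed

text \<open>Three sequences of poles rise from t = 0, 1 - e and 1 - f, and one falls from t = -a.
  Multiplied by (-1)^N / (N + 1), each finite residue sum converges, while the total has norm 1 / (N
  + 1) and tends to 0.\<close>

lemma residue_relation:
  assumes bal: "e + f + g = 1 + a + b + c + d" and re: "0 \<le> Re (g - a)" "Re (g - a) \<le> 1"
    and ni: "a \<notin> \<int>" "b \<notin> \<int>" "c \<notin> \<int>" "d \<notin> \<int>" "e \<notin> \<int>" "f \<notin> \<int>" "g \<notin> \<int>"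
      "a - e \<notin> \<int>" "b - e \<notin> \<int>" "c - e \<notin> \<int>" "d - e \<notin> \<int>" "a - f \<notin> \<int>" "b - f \<notin> \<int>" "c - f \<notin> \<int>" "d - f \<notin> \<int>"
      "e - f \<notin> \<int>" "g - e \<notin> \<int>" "g - f \<notin> \<int>" "g - a \<notin> \<int>" "a - b \<notin> \<int>" "a - c \<notin> \<int>" "a - d \<notin> \<int>"
  defines "U \<equiv> \<Sum>n. u4 a b c d e f g (of_nat n)"
    and "Ue \<equiv> \<Sum>n. u4 (1 + a - e) (1 + b - e) (1 + c - e) (1 + d - e) (2 - e) (1 + f - e) (1 + g - e) (of_nat n)"
    and "Uf \<equiv> \<Sum>n. u4 (1 + a - f) (1 + b - f) (1 + c - f) (1 + d - f) (2 - f) (1 + e - f) (1 + g - f) (of_nat n)"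
    and "D \<equiv> \<Sum>n. u4 a (1 + a - e) (1 + a - f) (1 + a - g) (1 + a - b) (1 + a - c) (1 + a - d) (of_nat n)"
  shows "sinpi b * sinpi c * sinpi d / (sinpi e * sinpi f) * U
     - sinpi (b - e) * sinpi (c - e) * sinpi (d - e) / (sinpi e * sinpi (f - e)) * Ue
     - sinpi (b - f) * sinpi (c - f) * sinpi (d - f) / (sinpi f * sinpi (e - f)) * Uf = sinpi (g - a) * D"
proof -
  have g: "g = 1 + a + b + c + d - e - f" using bal by (simp add: algebra_simps)
  have "f - e \<notin> \<int>" "a - g \<notin> \<int>" by (rule nonint_trans[OF ni(16)], simp, rule nonint_trans[OF ni(19)], simp)
  hence n: "1 + a - e \<notin> \<int>" "1 + b - e \<notin> \<int>" "1 + c - e \<notin> \<int>" "1 + d - e \<notin> \<int>" "2 - e \<notin> \<int>" "1 + f - e \<notin> \<int>" "1 + g - e \<notin> \<int>"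
    "1 + a - f \<notin> \<int>" "1 + b - f \<notin> \<int>" "1 + c - f \<notin> \<int>" "1 + d - f \<notin> \<int>" "2 - f \<notin> \<int>" "1 + e - f \<notin> \<int>" "1 + g - f \<notin> \<int>"
    "1 + a - g \<notin> \<int>" "1 + a - b \<notin> \<int>" "1 + a - c \<notin> \<int>" "1 + a - d \<notin> \<int>"
    by (simp_all add: ni Ints_shift_iff)
  define S0 S1 S2 S3 where
    "S0 N = (\<Sum>n\<le>N. res_plus N a 0 (1 - e) (1 - f) (1 - b) (1 - c) (1 - d) g n)" and
    "S1 N = (\<Sum>n\<le>N. res_plus N a (1 - e) 0 (1 - f) (1 - b) (1 - c) (1 - d) g n)" and
    "S2 N = (\<Sum>n\<le>N. res_plus N a (1 - f) 0 (1 - e) (1 - b) (1 - c) (1 - d) g n)" and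
    "S3 N = (\<Sum>n\<le>N. res_minus N a 0 (1 - e) (1 - f) (1 - b) (1 - c) (1 - d) g n)" for N
  let ?\<pi> = "of_real pi :: complex"
  define k0 k1 k2 where "k0 = (sinpi b / ?\<pi>) * (sinpi c / ?\<pi>) * (sinpi d / ?\<pi>) / ((sinpi e / ?\<pi>) * (sinpi f / ?\<pi>))"
    and "k1 = (sinpi (1 + b - e) / ?\<pi>) * (sinpi (1 + c - e) / ?\<pi>) * (sinpi (1 + d - e) / ?\<pi>) / ((sinpi (2 - e) / ?\<pi>) * (sinpi (1 + f - e) / ?\<pi>))"
    and "k2 = (sinpi (1 + b - f) / ?\<pi>) * (sinpi (1 + c - f) / ?\<pi>) * (sinpi (1 + d - f) / ?\<pi>) / ((sinpi (2 - f) / ?\<pi>) * (sinpi (1 + e - f) / ?\<pi>))"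
  have L0: "(\<lambda>N. (-1) ^ N * S0 N / of_nat (Suc N)) \<longlonglongrightarrow> k0 * U"
    unfolding S0_def k0_def U_def by (rule res_plus_limit) (use ni bal re in simp_all)
  have L1: "(\<lambda>N. (-1) ^ N * S1 N / of_nat (Suc N)) \<longlonglongrightarrow> k1 * Ue"
    unfolding S1_def k1_def Ue_def by (rule res_plus_limit) (use n re in \<open>simp_all add: g\<close>)
  have L2: "(\<lambda>N. (-1) ^ N * S2 N / of_nat (Suc N)) \<longlonglongrightarrow> k2 * Uf"
    unfolding S2_def k2_def Uf_def by (rule res_plus_limit) (use n re in \<open>simp_all add: g\<close>)
  have L3: "(\<lambda>N. (-1) ^ N * S3 N / of_nat (Suc N)) \<longlonglongrightarrow> - (sinpi (1 + a - g) / ?\<pi>) * D"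
  proof -
    have "1 + a - b + (1 + a - c) + (1 + a - d) = 1 + a + (1 + a - e) + (1 + a - f) + (1 + a - g)" by (simp add: g)
    thus ?thesis unfolding S3_def D_def by (intro res_minus_limit ni n) (use re in simp_all)
  qed
  have one: "norm (S0 N + S1 N + S2 N + S3 N) = 1" for N
  proof -
    have m: "0 - (1 - e) \<notin> \<int>" "0 - (1 - f) \<notin> \<int>" "(1 - e) - (1 - f) \<notin> \<int>" "a + 0 \<notin> \<int>" "a + (1 - e) \<notin> \<int>" "a + (1 - f) \<notin> \<int>"
      by (rule nonint_trans[OF ni(5)], simp, rule nonint_trans[OF ni(6)], simp, rule nonint_trans[OF ni(16)], simp,
          rule nonint_trans[OF ni(1)], simp, rule nonint_trans[OF ni(8)], simp, rule nonint_trans[OF ni(12)], simp)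
    show ?thesis unfolding S0_def S1_def S2_def S3_def by (rule finite_residue_sum[OF m])
  qed
  define T where "T N = (-1) ^ N * S0 N / of_nat (Suc N) + (-1) ^ N * S1 N / of_nat (Suc N) + (-1) ^ N * S2 N / of_nat (Suc N) + (-1) ^ N * S3 N / of_nat (Suc N)" for N
  have "norm (T N) = 1 / real (Suc N)" for N
  proof -
    have "T N = (-1) ^ N * (S0 N + S1 N + S2 N + S3 N) / of_nat (Suc N)"
      unfolding T_def by (simp only: add_divide_distrib distrib_left)
    thus ?thesis
      by (simp only: one norm_divide norm_mult norm_power norm_minus_cancel norm_one power_one norm_of_nat mult_1_left)
  qed
  moreover have "(\<lambda>N. 1 / real (Suc N)) \<longlonglongrightarrow> 0"
    using LIMSEQ_Suc[OF lim_1_over_n[where 'a = real]] by simp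
  ultimately have "T \<longlonglongrightarrow> 0"
    unfolding tendsto_norm_zero_iff[symmetric, of T] by (simp only:)
  moreover have "T \<longlonglongrightarrow> k0 * U + k1 * Ue + k2 * Uf + - (sinpi (1 + a - g) / ?\<pi>) * D"
    unfolding T_def by (intro tendsto_add L0 L1 L2 L3)
  ultimately have "k0 * U + k1 * Ue + k2 * Uf + - (sinpi (1 + a - g) / ?\<pi>) * D = 0"
    using LIMSEQ_unique by blast
  hence main: "?\<pi> * k0 * U + ?\<pi> * k1 * Ue + ?\<pi> * k2 * Uf = sinpi (1 + a - g) * D"
    by (simp add: algebra_simps divide_simps)
  have s: "sinpi (1 + a - g) = sinpi (g - a)" using sinpi_one_minus[of "g - a"] by (simp add: algebra_simps)
  have sh: "sinpi (1 + x - y) = - sinpi (x - y)" for x y using sinpi_add_one[of "x - y"] by (simp add: algebra_simps)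
  have k0: "?\<pi> * k0 = sinpi b * sinpi c * sinpi d / (sinpi e * sinpi f)"
    by (simp add: k0_def)
  have k1: "?\<pi> * k1 = - (sinpi (b - e) * sinpi (c - e) * sinpi (d - e) / (sinpi e * sinpi (f - e)))"
    by (simp add: k1_def sh sinpi_two_minus)
  have k2: "?\<pi> * k2 = - (sinpi (b - f) * sinpi (c - f) * sinpi (d - f) / (sinpi f * sinpi (e - f)))"
    by (simp add: k2_def sh sinpi_two_minus)
  show ?thesis using main unfolding k0 k1 k2 s by simp
qed

section \<open>Expansion of K in terms of L\<close>

lemma K_fun_reg:
  assumes bal: "e + f + g = 1 + a + b + c + d"
    and ni: "nonpole e" "nonpole f" "nonpole g" "nonpole (1 + a - b)" "nonpole (1 + a - c)" "nonpole (1 + a - d)"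
  shows "K_fun a b c d e f g =
    (hyp_reg a b c d e f g * (rGamma a * rGamma (1 + a - e) * rGamma (1 + a - f) * rGamma (1 + a - g))
     + hyp_reg a (1 + a - e) (1 + a - f) (1 + a - g) (1 + a - b) (1 + a - c) (1 + a - d) *
         (rGamma a * rGamma b * rGamma c * rGamma d)) / sinpi a"
proof -
  have g: "g = 1 + a + b + c + d - e - f" using bal by (simp add: algebra_simps)
  have bal': "(1 + a - b) + (1 + a - c) + (1 + a - d) = 1 + a + (1 + a - e) + (1 + a - f) + (1 + a - g)"
    by (simp add: g)
  show ?thesis
    unfolding hyp_reg_eq[OF bal ni(1-3)] hyp_reg_eq[OF bal' ni(4-6)] K_fun_def
    by (simp add: add_divide_distrib mult_ac)
qed

lemma K_fun_series:
  assumes bal: "e + f + g = 1 + a + b + c + d"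
    and ni: "a \<notin> \<int>" "b \<notin> \<int>" "c \<notin> \<int>" "d \<notin> \<int>" "e \<notin> \<int>" "f \<notin> \<int>" "g \<notin> \<int>"
      "a - e \<notin> \<int>" "a - f \<notin> \<int>" "g - a \<notin> \<int>" "a - b \<notin> \<int>" "a - c \<notin> \<int>" "a - d \<notin> \<int>"
  shows "sinpi a * (Gamma a * Gamma (1 + a - e) * Gamma (1 + a - f) * Gamma (1 + a - g)) * (Gamma a * Gamma b * Gamma c * Gamma d) * K_fun a b c d e f g =
     (\<Sum>n. u4 a b c d e f g (of_nat n)) + (\<Sum>n. u4 a (1 + a - e) (1 + a - f) (1 + a - g) (1 + a - b) (1 + a - c) (1 + a - d) (of_nat n))"
proof -
  have g: "g = 1 + a + b + c + d - e - f" using bal by (simp add: algebra_simps)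
  have bal': "(1 + a - b) + (1 + a - c) + (1 + a - d) = 1 + a + (1 + a - e) + (1 + a - f) + (1 + a - g)"
    by (simp add: g)
  have "a - g \<notin> \<int>" by (rule nonint_trans[OF ni(10)]) simp
  hence n: "nonpole a" "nonpole b" "nonpole c" "nonpole d" "nonpole e" "nonpole f" "nonpole g"
    "nonpole (1 + a - e)" "nonpole (1 + a - f)" "nonpole (1 + a - g)" "nonpole (1 + a - b)" "nonpole (1 + a - c)" "nonpole (1 + a - d)"
    by - (rule nonint_not_nonpos_Int, simp add: ni Ints_shift_iff)+
  have s: "sinpi a \<noteq> 0" by (rule sinpi_nonzero[OF ni(1)])
  have alg: "s * Q * P * ((H * q + H' * p) / s) = P * H + Q * H'" if "s \<noteq> 0" "P * p = 1" "Q * q = 1" for s P Q H H' p q :: complex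
  proof -
    have "s * Q * P * ((H * q + H' * p) / s) = P * Q * (H * q + H' * p)"
      using that(1) by simp
    also have "\<dots> = P * H * (Q * q) + Q * H' * (P * p)" by (simp add: algebra_simps)
    finally show ?thesis unfolding that by simp
  qed
  show ?thesis
    unfolding suminf_u4[OF bal n(1-4)] suminf_u4[OF bal' n(1,8-10)] K_fun_reg[OF bal n(5-7) n(11-13)]
    by (rule alg[OF s]; rule Gamma_rGamma4; fact n)
qed

text \<open>K is U + D up to factors, and \<open>residue_relation\<close> expresses D by U, Ue and
  Uf. In the resulting expression for U + D the three coefficients add up to 0 (this is
  \<open>tr\<close>), so it depends only on the differences U - Uf and Ue - Uf, which are two L
  functions.\<close>

lemma K_fun_expansion:
  assumes bal: "e + f + g = 1 + a + b + c + d" and re: "0 \<le> Re (g - a)" "Re (g - a) \<le> 1"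
    and ni: "a \<notin> \<int>" "b \<notin> \<int>" "c \<notin> \<int>" "d \<notin> \<int>" "e \<notin> \<int>" "f \<notin> \<int>" "g \<notin> \<int>"
      "a - e \<notin> \<int>" "b - e \<notin> \<int>" "c - e \<notin> \<int>" "d - e \<notin> \<int>" "a - f \<notin> \<int>" "b - f \<notin> \<int>" "c - f \<notin> \<int>" "d - f \<notin> \<int>"
      "e - f \<notin> \<int>" "g - e \<notin> \<int>" "g - f \<notin> \<int>" "g - a \<notin> \<int>" "a - b \<notin> \<int>" "a - c \<notin> \<int>" "a - d \<notin> \<int>"
  shows "A4 (1 - a) (e - a) (f - a) (g - a) * A4 (1 + a - f) (1 + b - f) (1 + c - f) (1 + d - f) * (sinpi e * K_fun a b c d e f g) =
     B4 a b c d g f e * L_fun a b c d f e g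
     - sinpi (f - a) * A4 a b c d * A4 (e - a) (e - b) (e - c) (e - d) *
       L_fun (1 + a - e) (1 + b - e) (1 + c - e) (1 + d - e) (1 + f - e) (2 - e) (1 + g - e)"
proof -
  have g: "g = 1 + a + b + c + d - e - f" using bal by (simp add: algebra_simps)
  define U where "U = (\<Sum>n. u4 a b c d e f g (of_nat n))"
  define Ue where "Ue = (\<Sum>n. u4 (1 + a - e) (1 + b - e) (1 + c - e) (1 + d - e) (2 - e) (1 + f - e) (1 + g - e) (of_nat n))"
  define Uf where "Uf = (\<Sum>n. u4 (1 + a - f) (1 + b - f) (1 + c - f) (1 + d - f) (2 - f) (1 + e - f) (1 + g - f) (of_nat n))"
  define D where "D = (\<Sum>n. u4 a (1 + a - e) (1 + a - f) (1 + a - g) (1 + a - b) (1 + a - c) (1 + a - d) (of_nat n))"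
  define P where "P = Gamma a * Gamma b * Gamma c * Gamma d"
  define E where "E = Gamma (1 + a - e) * Gamma (1 + b - e) * Gamma (1 + c - e) * Gamma (1 + d - e)"
  define F where "F = Gamma (1 + a - f) * Gamma (1 + b - f) * Gamma (1 + c - f) * Gamma (1 + d - f)"
  define G where "G = Gamma a * Gamma (1 + a - e) * Gamma (1 + a - f) * Gamma (1 + a - g)"
  define K L1 L2 where "K = K_fun a b c d e f g" and "L1 = L_fun a b c d f e g"
    and "L2 = L_fun (1 + a - e) (1 + b - e) (1 + c - e) (1 + d - e) (1 + f - e) (2 - e) (1 + g - e)"
  define sg where "sg = sinpi (g - a)"
  define k0 ke kf where "k0 = sinpi b * sinpi c * sinpi d / (sinpi e * sinpi f)"
    and "ke = sinpi (b - e) * sinpi (c - e) * sinpi (d - e) / (sinpi e * sinpi (f - e))"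
    and "kf = sinpi (b - f) * sinpi (c - f) * sinpi (d - f) / (sinpi f * sinpi (e - f))"
  have fe: "f - e \<notin> \<int>" by (rule nonint_trans[OF ni(16)]) simp
  have nz: "sinpi e \<noteq> 0" "sinpi f \<noteq> 0" "sinpi (e - f) \<noteq> 0" "sinpi (f - e) \<noteq> 0" by (intro sinpi_nonzero ni fe)+
  have sef: "sinpi (f - e) = - sinpi (e - f)" using sinpi_minus[of "e - f"] by simp
  have "a - g \<notin> \<int>" by (rule nonint_trans[OF ni(19)]) simp
  hence n: "nonpole a" "nonpole b" "nonpole c" "nonpole d"
    "nonpole (1 + a - e)" "nonpole (1 + b - e)" "nonpole (1 + c - e)" "nonpole (1 + d - e)"
    "nonpole (1 + a - f)" "nonpole (1 + b - f)" "nonpole (1 + c - f)" "nonpole (1 + d - f)" "nonpole (1 + a - g)"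
    by - (rule nonint_not_nonpos_Int, simp add: ni Ints_shift_iff)+
  have KS: "sinpi a * G * P * K = U + D"
    unfolding G_def P_def K_def U_def D_def by (rule K_fun_series[OF bal]) (use ni in simp_all)
  have LS1: "sinpi f * P * F * L1 = U - Uf"
  proof -
    have "sinpi f * P * F * L1 = (\<Sum>n. u4 a b c d f e g (of_nat n)) - (\<Sum>n. u4 a b c d f e g (1 - f + of_nat n))"
      unfolding P_def F_def L1_def by (rule L_fun_series) (use bal ni in \<open>simp_all add: add_ac\<close>)
    also have "(\<Sum>n. u4 a b c d f e g (of_nat n)) = U" unfolding U_def u4_def by (simp only: mult_ac)
    also have "(\<Sum>n. u4 a b c d f e g (1 - f + of_nat n)) = Uf" unfolding Uf_def u4_shift ..
    finally show ?thesis .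
  qed
  have LS2: "sinpi (e - f) * E * F * L2 = Ue - Uf"
  proof -
    have eqs: "1 + (1 + w - e) - (1 + f - e) = 1 + w - f" for w by simp
    have eqs': "2 - (1 + f - e) = 1 + e - f" "1 + (2 - e) - (1 + f - e) = 2 - f" by simp_all
    have m: "1 + a - e \<notin> \<int>" "1 + b - e \<notin> \<int>" "1 + c - e \<notin> \<int>" "1 + d - e \<notin> \<int>" "1 + f - e \<notin> \<int>" "2 - e \<notin> \<int>" "1 + g - e \<notin> \<int>"
      "1 + a - e - (1 + f - e) \<notin> \<int>" "1 + b - e - (1 + f - e) \<notin> \<int>" "1 + c - e - (1 + f - e) \<notin> \<int>" "1 + d - e - (1 + f - e) \<notin> \<int>"
      "2 - e - (1 + f - e) \<notin> \<int>" "1 + g - e - (1 + f - e) \<notin> \<int>"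
      by (rule nonint_trans[OF ni(8)], simp, rule nonint_trans[OF ni(9)], simp, rule nonint_trans[OF ni(10)], simp, rule nonint_trans[OF ni(11)], simp,
        rule nonint_trans[OF ni(16)], simp, rule nonint_trans[OF ni(5)], simp, rule nonint_trans[OF ni(17)], simp,
        rule nonint_trans[OF ni(12)], simp, rule nonint_trans[OF ni(13)], simp, rule nonint_trans[OF ni(14)], simp, rule nonint_trans[OF ni(15)], simp,
        rule nonint_trans[OF ni(6)], simp, rule nonint_trans[OF ni(18)], simp)
    have bal': "(1 + f - e) + (2 - e) + (1 + g - e) = 1 + (1 + a - e) + (1 + b - e) + (1 + c - e) + (1 + d - e)" by (simp add: g)
    have "sinpi (1 + f - e) * E * F * L2 = (\<Sum>n. u4 (1 + a - e) (1 + b - e) (1 + c - e) (1 + d - e) (1 + f - e) (2 - e) (1 + g - e) (of_nat n)) -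
        (\<Sum>n. u4 (1 + a - f) (1 + b - f) (1 + c - f) (1 + d - f) (1 + e - f) (2 - f) (1 + g - f) (of_nat n))"
      using L_fun_series[OF bal' m] unfolding u4_shift eqs eqs' E_def F_def L2_def .
    also have "(\<Sum>n. u4 (1 + a - e) (1 + b - e) (1 + c - e) (1 + d - e) (1 + f - e) (2 - e) (1 + g - e) (of_nat n)) = Ue"
      unfolding Ue_def u4_def by (simp only: mult_ac)
    also have "(\<Sum>n. u4 (1 + a - f) (1 + b - f) (1 + c - f) (1 + d - f) (1 + e - f) (2 - f) (1 + g - f) (of_nat n)) = Uf"
      unfolding Uf_def u4_def by (simp only: mult_ac)
    also have "sinpi (1 + f - e) = sinpi (e - f)" using sinpi_one_minus[of "e - f"] by (simp add: algebra_simps)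
    finally show ?thesis .
  qed
  have rel: "k0 * U - ke * Ue - kf * Uf = sg * D"
    unfolding k0_def ke_def kf_def U_def Ue_def Uf_def D_def sg_def by (rule residue_relation[OF bal re ni])
  have tr: "k0 - ke - kf = - sg"
  proof -
    have sgh: "sg = - sinpi (b + c + d - e - f)"
      using sinpi_add_one[of "b + c + d - e - f"] by (simp add: sg_def g algebra_simps)
    have "(k0 - ke - kf) * (sinpi e * sinpi f * sinpi (e - f)) =
       sinpi b * sinpi c * sinpi d * sinpi (e - f) + sinpi (b - e) * sinpi (c - e) * sinpi (d - e) * sinpi f
     - sinpi (b - f) * sinpi (c - f) * sinpi (d - f) * sinpi e"
      using nz unfolding k0_def ke_def kf_def sef by (simp add: field_simps)
    also have "\<dots> = - sg * (sinpi e * sinpi f * sinpi (e - f))"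
      unfolding sinpi_partial_fractions sgh by simp
    finally have eq: "(k0 - ke - kf) * (sinpi e * sinpi f * sinpi (e - f)) = - sg * (sinpi e * sinpi f * sinpi (e - f))" .
    have "sinpi e * sinpi f * sinpi (e - f) \<noteq> 0" using nz by simp
    from mult_right_cancel[OF this] eq show ?thesis by (rule iffD1)
  qed
  have "sg * (U + D) = (sg + k0) * (U - Uf) - ke * (Ue - Uf)" using rel tr by algebra
  hence "sinpi e * (sg * (sinpi a * G * P * K)) = sinpi e * ((sg + k0) * (sinpi f * P * F * L1) - ke * (sinpi (e - f) * E * F * L2))"
    unfolding KS LS1 LS2 by simp
  also have "\<dots> = (sinpi e * sinpi f * sg + sinpi e * sinpi f * k0) * (P * F * L1) - sinpi e * sinpi (e - f) * ke * (E * F * L2)"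
    by (simp add: algebra_simps)
  also have "sinpi e * sinpi f * k0 = sinpi b * sinpi c * sinpi d" using nz by (simp add: k0_def)
  also have "sinpi e * sinpi (e - f) * ke = - (sinpi (b - e) * sinpi (c - e) * sinpi (d - e))" using nz by (simp add: ke_def sef)
  finally have main: "sinpi e * (sg * (sinpi a * G * P * K)) = (sinpi e * sinpi f * sg + sinpi b * sinpi c * sinpi d) * (P * F * L1)
      + sinpi (b - e) * sinpi (c - e) * sinpi (d - e) * (E * F * L2)" by simp
  let ?\<pi> = "of_real pi :: complex"
  have GrG: "Gamma w * rGamma w = 1" if "nonpole w" for w :: complex
    using that by (simp add: rGamma_inverse_Gamma Gamma_eq_zero_iff)
  have p: "P * A4 a b c d = 1" unfolding P_def A4_def by (rule Gamma_rGamma4; fact n)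
  have \<phi>: "F * A4 (1 + a - f) (1 + b - f) (1 + c - f) (1 + d - f) = 1"
    unfolding F_def A4_def by (rule Gamma_rGamma4; fact n)
  \<comment> \<open>By reflection each sine merges with a Gamma factor into an
    \<open>rGamma\<close>, so that the final coefficients are entire.\<close>
  have S1: "sinpi a * Gamma a = ?\<pi> * rGamma (1 - a)" using rGamma_one_minus[OF n(1)] by simp
  have S2: "sg * Gamma (1 + a - g) = ?\<pi> * rGamma (g - a)"
    using rGamma_one_minus[OF n(13)] sinpi_one_minus[of "g - a"] by (simp add: sg_def algebra_simps)
  have S3: "sinpi (w - e) * Gamma (1 + w - e) = - (?\<pi> * rGamma (e - w))" if "nonpole (1 + w - e)" for w
    using rGamma_one_minus[OF that] sinpi_add_one[of "w - e"] by (simp add: algebra_simps)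
  have S4: "?\<pi> * (rGamma (e - a) * rGamma (1 + a - e)) = sinpi (e - a)" "?\<pi> * (rGamma (f - a) * rGamma (1 + a - f)) = sinpi (f - a)"
    using rGamma_reflection_complex[of "e - a"] rGamma_reflection_complex[of "f - a"] by (simp_all add: sinpi_def algebra_simps)
  have G1: "Gamma (1 + a - e) * rGamma (1 + a - e) = 1" "Gamma (1 + a - f) * rGamma (1 + a - f) = 1" by (intro GrG n)+
  have VE: "sinpi (b - e) * sinpi (c - e) * sinpi (d - e) * E = - (?\<pi> ^ 3 * (rGamma (e - b) * rGamma (e - c) * rGamma (e - d)) * Gamma (1 + a - e))"
    using S3[OF n(6)] S3[OF n(7)] S3[OF n(8)] unfolding E_def by algebra
  have GG: "sg * sinpi a * G = ?\<pi>\<^sup>2 * rGamma (1 - a) * rGamma (g - a) * Gamma (1 + a - e) * Gamma (1 + a - f)"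
    using S1 S2 unfolding G_def by algebra
  define q \<psi> where "q = A4 a b c d" and "\<psi> = A4 (1 + a - f) (1 + b - f) (1 + c - f) (1 + d - f)"
  define N where "N = sinpi e * sinpi f * sg + sinpi b * sinpi c * sinpi d"
  have m1: "sinpi e * (?\<pi>\<^sup>2 * rGamma (1 - a) * rGamma (g - a) * Gamma (1 + a - e) * Gamma (1 + a - f)) * \<psi> * K =
      N * L1 - ?\<pi> ^ 3 * (rGamma (e - b) * rGamma (e - c) * rGamma (e - d)) * Gamma (1 + a - e) * q * L2"
    using main p \<phi> VE GG unfolding q_def[symmetric] \<psi>_def[symmetric] N_def by algebra
  \<comment> \<open>Multiplication by the sines of e - a and f - a supplies the missing entries of
    \<open>A4\<close> on the left and completes \<open>N\<close> to \<open>B4\<close> on the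
    right.\<close>
  have "?\<pi> ^ 4 * (A4 (1 - a) (e - a) (f - a) (g - a) * \<psi> * (sinpi e * K)) =
     sinpi (f - a) * sinpi (e - a) * N * L1 - ?\<pi> ^ 4 * (sinpi (f - a) * q * A4 (e - a) (e - b) (e - c) (e - d) * L2)"
    using m1 S4 G1 unfolding A4_def by algebra
  hence "A4 (1 - a) (e - a) (f - a) (g - a) * \<psi> * (sinpi e * K) =
     1 / ?\<pi> ^ 4 * (sinpi (f - a) * sinpi (e - a)) * N * L1 - sinpi (f - a) * q * A4 (e - a) (e - b) (e - c) (e - d) * L2"
    by (simp add: field_simps)
  thus ?thesis
    unfolding K_def L1_def L2_def \<psi>_def q_def B4_def Sinprod_def N_def sg_def by (simp add: algebra_simps)
qed

section \<open>Analytic continuation\<close>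

lemma nonint_Im: "Im x \<noteq> 0 \<Longrightarrow> x \<notin> \<int>"
  by (auto elim!: Ints_cases)

lemma K_fun_perm: "K_fun a b c d e f g = K_fun a b c d g f e" "K_fun a b c d e f g = K_fun a b c d f e g"
  by (simp_all only: K_fun_def hyp4F3_def mult_ac)

definition three_term_expr where
  "three_term_expr a b c d e f g =
         A4 (1 - a) (e - a) (f - a) (g - a) *
         A4 (1 + a - f) (1 + b - f) (1 + c - f) (1 + d - f) *
         B4 (e - a) (e - b) (e - c) (e - d) (1 + e - f) e (1 + e - g) *
         K_fun a b c d e f g
       - A4 (g - a) (g - b) (g - c) (g - d) *
         A4 a (1 + a - e) (1 + a - f) (1 + a - g) *
         B4 a b c d g f e *
         K_fun (e - a) (e - b) (e - c) (e - d) (1 + e - f) (1 + e - g) e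
       - A4 a b c d *
         A4 (e - a) (e - b) (e - c) (e - d) *
         B2 a b c d e f g *
         L_fun (1 - a) (1 - b) (1 - c) (1 - d) (2 - g) (2 - f) (2 - e)"

text \<open>The real parts of the base point satisfy the convergence conditions of \<open>L_fun_dual\<close> and \<open>K_fun_expansion\<close>.
  Its imaginary parts have different orders of magnitude, so none of the combinations of the
  parameters that have to avoid the integers is real.\<close>

lemma three_term_expr_generic:
  assumes bal: "e + f + g = 1 + a + b + c + d"
    and box: "norm (a - Complex (1/2) 1) < 1/100" "norm (b - Complex (1/2) 10) < 1/100" "norm (c - Complex (1/2) 100) < 1/100"
      "norm (d - Complex (1/2) 1000) < 1/100" "norm (e - Complex (21/20) 10000) < 1/100" "norm (f - Complex (6/5) 100000) < 1/100"
  shows "three_term_expr a b c d e f g = 0"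
    and "K_defined a b c d e f g"
    and "K_defined (e - a) (e - b) (e - c) (e - d) (1 + e - f) (1 + e - g) e"
    and "L_defined (1 - a) (1 - b) (1 - c) (1 - d) (2 - g) (2 - f) (2 - e)"
proof -
  have bd1: "\<bar>Re x - r\<bar> < 1/100 \<and> \<bar>Im x - s\<bar> < 1/100" if "norm (x - Complex r s) < 1/100" for x r s
    using abs_Re_le_cmod[of "x - Complex r s"] abs_Im_le_cmod[of "x - Complex r s"] that by simp
  have gR: "Re g = 1 + Re a + Re b + Re c + Re d - Re e - Re f" "Im g = Im a + Im b + Im c + Im d - Im e - Im f"
    using arg_cong[OF bal, of Re] arg_cong[OF bal, of Im] by simp_all
  have g: "g = 1 + a + b + c + d - e - f" using bal by (simp add: algebra_simps)
  note bd = box[THEN bd1, unfolded abs_less_iff] gR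
  note cs = plus_complex.sel minus_complex.sel one_complex.sel complex_Re_numeral complex_Im_numeral
  have ef: "e - f \<notin> \<int>" and e: "e \<notin> \<int>" by (rule nonint_Im, (simp only: cs)?, use bd in linarith)+
  \<comment> \<open>\<open>D1\<close> and \<open>D2\<close> reduce the L functions in both
    expansions to a common pair. Their windows concern f - a - b and e + f - 1 - a - b and the
    analogues with c, d; at the base point the real parts are 1/5 and 1/4.\<close>
  have D1: "L_fun a b c d f e g = L_fun (e - a) (e - b) (e - c) (e - d) (1 + e - g) e (1 + e - f)"
    by (rule L_fun_dual; (simp add: g; fail)?; (rule nonint_Im)?; (simp only: cs)?; use bd in linarith)
  have eqs: "2 - e - (1 + w - e) = 1 - w" "1 + (2 - e) - (1 + w - e) = 2 - w" for w by simp_all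
  have D2: "L_fun (1 + a - e) (1 + b - e) (1 + c - e) (1 + d - e) (1 + f - e) (2 - e) (1 + g - e) =
      L_fun (1 - a) (1 - b) (1 - c) (1 - d) (2 - g) (2 - e) (2 - f)"
  proof -
    have "L_fun (1 + a - e) (1 + b - e) (1 + c - e) (1 + d - e) (1 + f - e) (2 - e) (1 + g - e) =
      L_fun (2 - e - (1 + a - e)) (2 - e - (1 + b - e)) (2 - e - (1 + c - e)) (2 - e - (1 + d - e)) (1 + (2 - e) - (1 + g - e)) (2 - e) (1 + (2 - e) - (1 + f - e))"
      by (rule L_fun_dual; (simp add: g; fail)?; (rule nonint_Im)?; (simp only: cs)?; use bd in linarith)
    thus ?thesis unfolding eqs .
  qed
  have K1: "A4 (1 - a) (e - a) (f - a) (g - a) * A4 (1 + a - f) (1 + b - f) (1 + c - f) (1 + d - f) * (sinpi e * K_fun a b c d e f g) =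
     B4 a b c d g f e * L_fun a b c d f e g
     - sinpi (f - a) * A4 a b c d * A4 (e - a) (e - b) (e - c) (e - d) *
       L_fun (1 + a - e) (1 + b - e) (1 + c - e) (1 + d - e) (1 + f - e) (2 - e) (1 + g - e)"
    by (rule K_fun_expansion; (simp add: g; fail)?; (rule nonint_Im)?; (simp only: cs)?; use bd in linarith)
  have eqs': "1 - (e - a) = 1 + a - e" "e - (e - w) = w" "1 + e - w - (e - v) = 1 + v - w" "1 + (e - w) - (1 + e - v) = v - w"
    "1 + (e - w) - e = 1 - w" "1 + (1 + e - w) - e = 2 - w" for w v by simp_all
  \<comment> \<open>The lower parameters are ordered so that the first L function is the right-hand
    side of \<open>D1\<close> and the second one the target. The window concerns 1 + a - f, with
    real part 3/10 at the base point; in \<open>K1\<close> it is g - a, with 1/4.\<close>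
  have K2: "A4 (1 + a - e) a (1 + a - g) (1 + a - f) * A4 (g - a) (g - b) (g - c) (g - d) * (sinpi e * K_fun (e - a) (e - b) (e - c) (e - d) e (1 + e - g) (1 + e - f)) =
     B4 (e - a) (e - b) (e - c) (e - d) (1 + e - f) (1 + e - g) e * L_fun (e - a) (e - b) (e - c) (e - d) (1 + e - g) e (1 + e - f)
     - sinpi (1 + a - g) * A4 (e - a) (e - b) (e - c) (e - d) * A4 a b c d *
       L_fun (1 - a) (1 - b) (1 - c) (1 - d) (2 - g) (2 - e) (2 - f)"
  proof -
    have "A4 (1 - (e - a)) (e - (e - a)) (1 + e - g - (e - a)) (1 + e - f - (e - a)) * A4 (1 + (e - a) - (1 + e - g)) (1 + (e - b) - (1 + e - g)) (1 + (e - c) - (1 + e - g)) (1 + (e - d) - (1 + e - g)) *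
         (sinpi e * K_fun (e - a) (e - b) (e - c) (e - d) e (1 + e - g) (1 + e - f)) =
     B4 (e - a) (e - b) (e - c) (e - d) (1 + e - f) (1 + e - g) e * L_fun (e - a) (e - b) (e - c) (e - d) (1 + e - g) e (1 + e - f)
     - sinpi (1 + e - g - (e - a)) * A4 (e - a) (e - b) (e - c) (e - d) * A4 (e - (e - a)) (e - (e - b)) (e - (e - c)) (e - (e - d)) *
       L_fun (1 + (e - a) - e) (1 + (e - b) - e) (1 + (e - c) - e) (1 + (e - d) - e) (1 + (1 + e - g) - e) (2 - e) (1 + (1 + e - f) - e)"
      by (rule K_fun_expansion; (simp add: g; fail)?; (rule nonint_Im)?; (simp only: cs)?; use bd in linarith)
    thus ?thesis unfolding eqs' .
  qed
  have KP: "K_fun (e - a) (e - b) (e - c) (e - d) e (1 + e - g) (1 + e - f) = K_fun (e - a) (e - b) (e - c) (e - d) (1 + e - f) (1 + e - g) e"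
    by (rule K_fun_perm)
  have LP: "L_fun (1 - a) (1 - b) (1 - c) (1 - d) (2 - g) (2 - e) (2 - f) = L_fun (1 - a) (1 - b) (1 - c) (1 - d) (2 - g) (2 - f) (2 - e)"
    by (rule L_fun_perm)
  define p q where "p = A4 (1 - a) (e - a) (f - a) (g - a) * A4 (1 + a - f) (1 + b - f) (1 + c - f) (1 + d - f)"
    and "q = A4 (g - a) (g - b) (g - c) (g - d) * A4 a (1 + a - e) (1 + a - f) (1 + a - g)"
  define K K' L where "K = K_fun a b c d e f g" and "K' = K_fun (e - a) (e - b) (e - c) (e - d) (1 + e - f) (1 + e - g) e"
    and "L = L_fun (1 - a) (1 - b) (1 - c) (1 - d) (2 - g) (2 - f) (2 - e)"
  define r L1 where "r = A4 a b c d * A4 (e - a) (e - b) (e - c) (e - d)" and "L1 = L_fun a b c d f e g"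
  define x y where "x = B4 (e - a) (e - b) (e - c) (e - d) (1 + e - f) e (1 + e - g)" and "y = B4 a b c d g f e"
  have q': "q = A4 (1 + a - e) a (1 + a - g) (1 + a - f) * A4 (g - a) (g - b) (g - c) (g - d)"
    unfolding q_def A4_def by (simp only: mult_ac)
  have x': "x = B4 (e - a) (e - b) (e - c) (e - d) (1 + e - f) (1 + e - g) e"
    unfolding x_def B4_def Sinprod_def by (simp add: mult_ac)
  have sga: "sinpi (1 + a - g) = sinpi (g - a)" using sinpi_one_minus[of "g - a"] by (simp add: algebra_simps)
  have E1: "p * (sinpi e * K) = y * L1 - sinpi (f - a) * r * L"
    using K1 unfolding D2 LP p_def K_def y_def L1_def r_def L_def by (simp only: mult.assoc)
  have E2: "q * (sinpi e * K') = x * L1 - sinpi (g - a) * r * L"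
    using K2 unfolding KP LP D1[symmetric] q'[symmetric] x'[symmetric] sga r_def L1_def K'_def L_def by (simp only: mult_ac)
  \<comment> \<open>Taking \<open>x\<close> times \<open>E1\<close> minus \<open>y\<close> times
    \<open>E2\<close> eliminates \<open>L1\<close>; this expression is, up to sign, the factor left
    in front of r * L.\<close>
  have trig: "x * sinpi (f - a) - y * sinpi (g - a) = - sinpi e * B2 a b c d e f g"
  proof -
    have s: "1 + e - g - (e - a) = 1 + a - g" "e - (e - a) = a" "1 + e - f - (e - a) = 1 - (f - a)" "1 + e - g = 1 - (g - e)" by simp_all
    let ?\<pi> = "of_real pi :: complex"
    have xx: "x = 1 / ?\<pi> ^ 4 * (sinpi a * sinpi (g - a)) * (sinpi (e - b) * sinpi (e - c) * sinpi (e - d) + sinpi (f - a) * sinpi e * sinpi (g - e))"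
      unfolding x_def B4_def Sinprod_def list.map prod_list.Cons prod_list.Nil s(1-3)
      unfolding s(4) sga sinpi_one_minus by (simp only: mult_1_right mult.assoc)
    have yy: "y = 1 / ?\<pi> ^ 4 * (sinpi (f - a) * sinpi (e - a)) * (sinpi b * sinpi c * sinpi d + sinpi (g - a) * sinpi f * sinpi e)"
      unfolding y_def B4_def Sinprod_def by simp
    have bb: "B2 a b c d e f g = 1 / ?\<pi> ^ 4 * (sinpi (f - a) * sinpi (g - a)) * (sinpi (b - a) * sinpi (c - a) * sinpi (d - a) + sinpi (e - 2 * a) * sinpi (f - a) * sinpi (g - a))"
      unfolding B2_def Sinprod_def by simp
    show ?thesis unfolding xx yy bb using sinpi_coefficients[OF bal] by algebra
  qed
  have "sinpi e * three_term_expr a b c d e f g = 0"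
    unfolding three_term_expr_def p_def[symmetric] q_def[symmetric] K_def[symmetric] K'_def[symmetric] L_def[symmetric] r_def[symmetric] x_def[symmetric] y_def[symmetric]
    using E1 E2 trig by algebra
  thus "three_term_expr a b c d e f g = 0" using sinpi_nonzero[OF e] by simp
  show "K_defined a b c d e f g" unfolding K_defined_def
    by (intro conjI sinpi_nonzero nonint_not_nonpos_Int; rule nonint_Im; (simp only: cs)?; use bd in linarith)
  show "K_defined (e - a) (e - b) (e - c) (e - d) (1 + e - f) (1 + e - g) e" unfolding K_defined_def
    by (intro conjI sinpi_nonzero nonint_not_nonpos_Int; rule nonint_Im; (simp only: cs)?; use bd in linarith)
  show "L_defined (1 - a) (1 - b) (1 - c) (1 - d) (2 - g) (2 - f) (2 - e)" unfolding L_defined_def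
    by (intro conjI sinpi_nonzero nonint_not_nonpos_Int; rule nonint_Im; (simp only: cs)?; use bd in linarith)
qed

section \<open>Holomorphic dependence on the parameters\<close>

lemma holomorphic_pochhammer [holomorphic_intros]:
  assumes "h holomorphic_on S"
  shows "(\<lambda>z. pochhammer (h z) n :: complex) holomorphic_on S"
  by (induction n) (use assms in \<open>auto simp: pochhammer_Suc intro!: holomorphic_intros\<close>)

text \<open>On the closed unit disc around any point the parameters are bounded, so
  \<open>hyp_term_bound\<close> gives a majorant and the entire partial sums converge uniformly
  there.\<close>

lemma holomorphic_hyp_reg:
  assumes hol: "a holomorphic_on UNIV" "b holomorphic_on UNIV" "c holomorphic_on UNIV" "d holomorphic_on UNIV"
      "e holomorphic_on UNIV" "f holomorphic_on UNIV" "g holomorphic_on UNIV"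
    and bal: "\<And>z. e z + f z + g z = 1 + a z + b z + c z + d z"
  shows "(\<lambda>z. hyp_reg (a z) (b z) (c z) (d z) (e z) (f z) (g z)) holomorphic_on UNIV"
proof (rule holomorphic_uniform_sequence)
  show "(\<lambda>z. \<Sum>n<N. hyp_term (a z) (b z) (c z) (d z) (e z) (f z) (g z) n) holomorphic_on UNIV" for N
    unfolding hyp_term_def by (intro holomorphic_intros hol) auto
  fix w :: complex
  have bdd: "bounded (h ` cball w 1)" if "h holomorphic_on UNIV" for h :: "complex \<Rightarrow> complex"
    using that by (intro compact_imp_bounded compact_continuous_image holomorphic_on_imp_continuous_on) (auto intro: holomorphic_on_subset)
  define X where "X = a ` cball w 1 \<union> b ` cball w 1 \<union> c ` cball w 1 \<union> d ` cball w 1 \<union> e ` cball w 1 \<union> f ` cball w 1 \<union> g ` cball w 1"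
  have "bounded X" unfolding X_def by (intro bounded_Un[THEN iffD2] conjI bdd hol)
  then obtain M where M: "\<forall>v\<in>X. norm v \<le> M" unfolding bounded_iff ..
  obtain C where C: "\<And>a b c d e f g n. norm a \<le> M \<Longrightarrow> norm b \<le> M \<Longrightarrow> norm c \<le> M \<Longrightarrow> norm d \<le> M \<Longrightarrow> norm e \<le> M \<Longrightarrow> norm f \<le> M \<Longrightarrow> norm g \<le> M \<Longrightarrow>
       e + f + g = 1 + a + b + c + d \<Longrightarrow> norm (hyp_term a b c d e f g n) \<le> C * (real n + 1) powr (-2)"
    by (rule hyp_term_bound[of M]) blast
  have "uniform_limit (cball w 1) (\<lambda>N z. \<Sum>n<N. hyp_term (a z) (b z) (c z) (d z) (e z) (f z) (g z) n)
      (\<lambda>z. \<Sum>n. hyp_term (a z) (b z) (c z) (d z) (e z) (f z) (g z) n) sequentially"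
  proof (rule Weierstrass_m_test)
    show "norm (hyp_term (a z) (b z) (c z) (d z) (e z) (f z) (g z) n) \<le> C * (real n + 1) powr (-2)" if z: "z \<in> cball w 1" for n z
    proof (rule C)
      show "e z + f z + g z = 1 + a z + b z + c z + d z" by (rule bal)
      have "a z \<in> X" "b z \<in> X" "c z \<in> X" "d z \<in> X" "e z \<in> X" "f z \<in> X" "g z \<in> X"
        using z by (simp_all add: X_def)
      thus "norm (a z) \<le> M" "norm (b z) \<le> M" "norm (c z) \<le> M" "norm (d z) \<le> M" "norm (e z) \<le> M" "norm (f z) \<le> M" "norm (g z) \<le> M"
        using M by simp_all
    qed
    show "summable (\<lambda>n. C * (real n + 1) powr (-2))" by (intro summable_mult summable_powr_shift) auto
  qed
  thus "\<exists>r>0. cball w r \<subseteq> UNIV \<and> uniform_limit (cball w r) (\<lambda>N z. \<Sum>n<N. hyp_term (a z) (b z) (c z) (d z) (e z) (f z) (g z) n)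
      (\<lambda>z. hyp_reg (a z) (b z) (c z) (d z) (e z) (f z) (g z)) sequentially"
    unfolding hyp_reg_def by (intro exI[of _ 1]) auto
qed auto

text \<open>K times its sine, written with regularised series. It is entire on the balanced
  hyperplane and equals sinpi a * K wherever K is defined.\<close>

definition K_reg where
  "K_reg a b c d e f g = hyp_reg a b c d e f g * (rGamma a * rGamma (1 + a - e) * rGamma (1 + a - f) * rGamma (1 + a - g))
     + hyp_reg a (1 + a - e) (1 + a - f) (1 + a - g) (1 + a - b) (1 + a - c) (1 + a - d) *
         (rGamma a * rGamma b * rGamma c * rGamma d)"

definition L_reg where
  "L_reg a b c d e f g = hyp_reg a b c d e f g * (rGamma (1 + a - e) * rGamma (1 + b - e) * rGamma (1 + c - e) * rGamma (1 + d - e))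
     - hyp_reg (1 + a - e) (1 + b - e) (1 + c - e) (1 + d - e) (2 - e) (1 + f - e) (1 + g - e) *
         (rGamma a * rGamma b * rGamma c * rGamma d)"

lemma sinpi_K_fun:
  "e + f + g = 1 + a + b + c + d \<Longrightarrow> K_defined a b c d e f g \<Longrightarrow> sinpi a * K_fun a b c d e f g = K_reg a b c d e f g"
  unfolding K_defined_def K_reg_def by (subst K_fun_reg) auto

lemma sinpi_L_fun:
  "e + f + g = 1 + a + b + c + d \<Longrightarrow> L_defined a b c d e f g \<Longrightarrow> sinpi e * L_fun a b c d e f g = L_reg a b c d e f g"
  unfolding L_defined_def L_reg_def by (subst L_fun_reg) auto

lemma holomorphic_K_reg:
  assumes hol: "a holomorphic_on UNIV" "b holomorphic_on UNIV" "c holomorphic_on UNIV" "d holomorphic_on UNIV"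
      "e holomorphic_on UNIV" "f holomorphic_on UNIV" "g holomorphic_on UNIV"
    and bal: "\<And>z. e z + f z + g z = 1 + a z + b z + c z + d z"
  shows "(\<lambda>z. K_reg (a z) (b z) (c z) (d z) (e z) (f z) (g z)) holomorphic_on UNIV"
proof -
  have g: "g z = 1 + a z + b z + c z + d z - e z - f z" for z using bal[of z] by (simp add: algebra_simps)
  have bal': "(1 + a z - b z) + (1 + a z - c z) + (1 + a z - d z) = 1 + a z + (1 + a z - e z) + (1 + a z - f z) + (1 + a z - g z)" for z
    by (simp add: g)
  show ?thesis unfolding K_reg_def
    by (intro holomorphic_intros holomorphic_hyp_reg hol bal bal')
qed

lemma holomorphic_L_reg:
  assumes hol: "a holomorphic_on UNIV" "b holomorphic_on UNIV" "c holomorphic_on UNIV" "d holomorphic_on UNIV"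
      "e holomorphic_on UNIV" "f holomorphic_on UNIV" "g holomorphic_on UNIV"
    and bal: "\<And>z. e z + f z + g z = 1 + a z + b z + c z + d z"
  shows "(\<lambda>z. L_reg (a z) (b z) (c z) (d z) (e z) (f z) (g z)) holomorphic_on UNIV"
proof -
  have g: "g z = 1 + a z + b z + c z + d z - e z - f z" for z using bal[of z] by (simp add: algebra_simps)
  have bal': "(2 - e z) + (1 + f z - e z) + (1 + g z - e z) = 1 + (1 + a z - e z) + (1 + b z - e z) + (1 + c z - e z) + (1 + d z - e z)" for z
    by (simp add: g)
  show ?thesis unfolding L_reg_def
    by (intro holomorphic_intros holomorphic_hyp_reg hol bal bal')
qed

text \<open>The sines in the denominators of \<open>K\<close> and \<open>L\<close> are cleared, which makes the expression entire in the parameters.\<close>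

definition three_term_reg where
  "three_term_reg a b c d e f g =
         A4 (1 - a) (e - a) (f - a) (g - a) *
         A4 (1 + a - f) (1 + b - f) (1 + c - f) (1 + d - f) *
         B4 (e - a) (e - b) (e - c) (e - d) (1 + e - f) e (1 + e - g) *
         (sinpi (e - a) * sinpi (2 - g)) * K_reg a b c d e f g
       - A4 (g - a) (g - b) (g - c) (g - d) *
         A4 a (1 + a - e) (1 + a - f) (1 + a - g) *
         B4 a b c d g f e *
         (sinpi a * sinpi (2 - g)) * K_reg (e - a) (e - b) (e - c) (e - d) (1 + e - f) (1 + e - g) e
       - A4 a b c d *
         A4 (e - a) (e - b) (e - c) (e - d) *
         B2 a b c d e f g *
         (sinpi a * sinpi (e - a)) * L_reg (1 - a) (1 - b) (1 - c) (1 - d) (2 - g) (2 - f) (2 - e)"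

lemma three_term_reg_eq:
  assumes bal: "e + f + g = 1 + a + b + c + d"
    and D: "K_defined a b c d e f g" "K_defined (e - a) (e - b) (e - c) (e - d) (1 + e - f) (1 + e - g) e"
      "L_defined (1 - a) (1 - b) (1 - c) (1 - d) (2 - g) (2 - f) (2 - e)"
  shows "three_term_reg a b c d e f g = sinpi a * sinpi (e - a) * sinpi (2 - g) * three_term_expr a b c d e f g"
proof -
  have g: "g = 1 + a + b + c + d - e - f" using bal by (simp add: algebra_simps)
  have b: "(1 + e - f) + (1 + e - g) + e = 1 + (e - a) + (e - b) + (e - c) + (e - d)"
    "(2 - g) + (2 - f) + (2 - e) = 1 + (1 - a) + (1 - b) + (1 - c) + (1 - d)" by (simp_all add: g)
  show ?thesis
    unfolding three_term_reg_def three_term_expr_def sinpi_K_fun[OF bal D(1), symmetric] sinpi_K_fun[OF b(1) D(2), symmetric]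
      sinpi_L_fun[OF b(2) D(3), symmetric] right_diff_distrib
    by (simp only: mult_ac)
qed

text \<open>A complex line joins the base point (z = 0) to the given point (z = 1), so the identity
  theorem in one variable suffices. The last coordinate is computed from the other six, which keeps
  the whole line balanced.\<close>

lemma three_term_reg_eq_0:
  assumes bal: "e + f + g = 1 + a + b + c + d"
  shows "three_term_reg a b c d e f g = 0"
proof -
  define path :: "complex \<Rightarrow> complex \<Rightarrow> complex \<Rightarrow> complex" where "path u v z = u + z * (v - u)" for u v z
  let ?a = "path (Complex (1/2) 1) a" and ?b = "path (Complex (1/2) 10) b" and ?c = "path (Complex (1/2) 100) c"
    and ?d = "path (Complex (1/2) 1000) d" and ?e = "path (Complex (21/20) 10000) e" and ?f = "path (Complex (6/5) 100000) f"
  let ?g = "\<lambda>z. 1 + ?a z + ?b z + ?c z + ?d z - ?e z - ?f z"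
  define \<Phi> where "\<Phi> z = three_term_reg (?a z) (?b z) (?c z) (?d z) (?e z) (?f z) (?g z)" for z
  have hp: "path u v holomorphic_on UNIV" for u v unfolding path_def by (intro holomorphic_intros)
  have hg: "?g holomorphic_on UNIV" by (intro holomorphic_intros hp)
  have balz: "?e z + ?f z + ?g z = 1 + ?a z + ?b z + ?c z + ?d z" for z by simp
  have holPhi: "\<Phi> holomorphic_on UNIV"
    unfolding \<Phi>_def three_term_reg_def A4_def B2_def B4_def Sinprod_def sinpi_def list.map prod_list.Cons prod_list.Nil
    by (intro holomorphic_intros holomorphic_K_reg holomorphic_L_reg hp) (simp_all add: algebra_simps)
  have near: "\<forall>\<^sub>F z in nhds 0. norm (path u v z - u) < 1/100" for u v
  proof -
    have "((\<lambda>z. norm (path u v z - u)) \<longlongrightarrow> norm (u + 0 * (v - u) - u)) (nhds 0)"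
      unfolding path_def by (intro tendsto_intros filterlim_ident)
    thus ?thesis by (rule order_tendstoD) simp
  qed
  have "\<forall>\<^sub>F z in nhds 0. \<Phi> z = 0"
    using near[of "Complex (1/2) 1" a] near[of "Complex (1/2) 10" b] near[of "Complex (1/2) 100" c]
      near[of "Complex (1/2) 1000" d] near[of "Complex (21/20) 10000" e] near[of "Complex (6/5) 100000" f]
  proof eventually_elim
    case (elim z)
    show ?case
      unfolding \<Phi>_def three_term_reg_eq[OF balz three_term_expr_generic(2-4)[OF balz elim]] three_term_expr_generic(1)[OF balz elim] by simp
  qed
  then obtain r where r: "r > 0" "\<And>z. dist z 0 < r \<Longrightarrow> \<Phi> z = 0"
    unfolding eventually_nhds_metric by blast
  have "\<Phi> 1 = 0"
  proof (rule analytic_continuation[OF holPhi])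
    show "(0::complex) islimpt ball 0 r" using r(1) by (intro interior_limit_point) auto
  qed (use r in \<open>auto simp: dist_commute\<close>)
  moreover have "?g 1 = g" using bal by (simp add: path_def algebra_simps)
  ultimately show ?thesis by (simp add: \<Phi>_def path_def)
qed

theorem proposition6p17:
  fixes a b c d e f g :: complex
  assumes "(a, b, c, d, e, f, g) \<in> V"
    and "K_defined a b c d e f g"
    and "K_defined (e - a) (e - b) (e - c) (e - d) (1 + e - f) (1 + e - g) e"
    and "L_defined (1 - a) (1 - b) (1 - c) (1 - d) (2 - g) (2 - f) (2 - e)"
  shows "A4 (1 - a) (e - a) (f - a) (g - a) *
         A4 (1 + a - f) (1 + b - f) (1 + c - f) (1 + d - f) *
         B4 (e - a) (e - b) (e - c) (e - d) (1 + e - f) e (1 + e - g) *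
         K_fun a b c d e f g
       - A4 (g - a) (g - b) (g - c) (g - d) *
         A4 a (1 + a - e) (1 + a - f) (1 + a - g) *
         B4 a b c d g f e *
         K_fun (e - a) (e - b) (e - c) (e - d) (1 + e - f) (1 + e - g) e
       - A4 a b c d *
         A4 (e - a) (e - b) (e - c) (e - d) *
         B2 a b c d e f g *
         L_fun (1 - a) (1 - b) (1 - c) (1 - d) (2 - g) (2 - f) (2 - e)
       = 0"
proof -
  have bal: "e + f + g = 1 + a + b + c + d"
    using assms(1) by (auto simp: V_def algebra_simps)
  have "sinpi a * sinpi (e - a) * sinpi (2 - g) * three_term_expr a b c d e f g = 0"
    using three_term_reg_eq_0[OF bal] three_term_reg_eq[OF bal assms(2-4)] by simp
  \<comment> \<open>The three sines cleared for the continuation are nonzero by the definedness of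
    the two K functions and of L, so they can be divided out again.\<close>
  moreover have "sinpi a \<noteq> 0" "sinpi (e - a) \<noteq> 0" "sinpi (2 - g) \<noteq> 0"
    using assms(2-4) by (auto simp: K_defined_def L_defined_def)
  ultimately show ?thesis by (simp add: three_term_expr_def)
qed

end
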